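(* (i) The elements $A_n^{+}(p,t)$ (resp. $A_n^-(p,t)$), $0\le n\le p-1$, $1\le t\le p$, form a basis of $Q_p$ (resp. $Q_0$), and for $\alpha=\pm$ $$A_m^{\alpha}(p,t_1)A_n^{\alpha}(p,t_2)=\begin{cases}A_m^{\alpha}(p,t_2),&n=t_1-1,\\0,&\text{otherwise.}\end{cases}$$ Hence $Q_0$ and $Q_p$ are isomorphic to the matrix algebra $M_p(\mathbb{C})$ as algebras. (ii) Let $1\le s\le p-1$. The elements $B_n^+(s,t),X_k^+(s,t),Y_k^+(s,t),A_n^+(s,t)$ and $B_k^-(p-s,u),X_n^-(p-s,u),Y_n^-(p-s,u),A_k^-(p-s,u)$, with $1\le t\le s$, $1\le u\le p-s$, $0\le n\le s-1$, $0\le k\le p-s-1$, form a basis of $Q_s$. For $1\le t,t_1,t_2,n+1\le s$ and $1\le u,u_1,u_2,k+1\le p-s$ the following products hold: $$B_n^+(s,t_1)B_{t_1-1}^+(s,t_2)=B_n^+(s,t_2),\quad B_n^+(s,t_1)A_{t_1-1}^+(s,t_2)=A_n^+(s,t_2),$$ $$X_k^+(s,t_1)B_{t_1-1}^+(s,t_2)=X_k^+(s,t_2),\quad Y_k^+(s,t_1)B_{t_1-1}^+(s,t_2)=Y_k^+(s,t_2),\quad A_n^+(s,t_1)B_{t_1-1}^+(s,t_2)=A_n^+(s,t_2),$$ $$B_k^-(p-s,u)X_{u-1}^+(s,t_2)=X_k^+(s,t_2),\quad B_k^-(p-s,u)Y_{u-1}^+(s,t_2)=Y_k^+(s,t_2),$$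 $$X_n^-(p-s,u)Y_{u-1}^+(s,t_2)=A_n^+(s,t_2),\quad Y_n^-(p-s,u)X_{u-1}^+(s,t_2)=A_n^+(s,t_2),$$ $$B_n^+(s,t)X_{t-1}^-(p-s,u_2)=X_n^-(p-s,u_2),\quad B_n^+(s,t)Y_{t-1}^-(p-s,u_2)=Y_n^-(p-s,u_2),$$ $$X_k^+(s,t)Y_{t-1}^-(p-s,u_2)=A_k^-(p-s,u_2),\quad Y_k^+(s,t)X_{t-1}^-(p-s,u_2)=A_k^-(p-s,u_2),$$ $$B_k^-(p-s,u_1)B_{u_1-1}^-(p-s,u_2)=B_k^-(p-s,u_2),\quad B_k^-(p-s,u_1)A_{u_1-1}^-(p-s,u_2)=A_k^-(p-s,u_2),$$ $$X_n^-(p-s,u_1)B_{u_1-1}^-(p-s,u_2)=X_n^-(p-s,u_2),\quad Y_n^-(p-s,u_1)B_{u_1-1}^-(p-s,u_2)=Y_n^-(p-s,u_2),$$ $$A_k^-(p-s,u_1)B_{u_1-1}^-(p-s,u_2)=A_k^-(p-s,u_2),$$ and all other products of two elements of this basis of $Q_s$ are zero.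
   Context: Let $p\ge 2$ be an integer and $q=\exp(\pi\sqrt{-1}/p)$. $\overline{U}_q(sl_2)$ is the associative unital $\mathbb{C}$-algebra generated by $E,F,K,K^{-1}$ with relations $KK^{-1}=K^{-1}K=1$, $KEK^{-1}=q^2E$, $KFK^{-1}=q^{-2}F$, $EF-FE=\frac{K-K^{-1}}{q-q^{-1}}$, $E^p=F^p=0$, $K^{2p}=1$. Write $[n]=\frac{q^n-q^{-n}}{q-q^{-1}}$. Empty products are $1$ and empty sums are $0$. A sign $\alpha\in\{+,-\}$ is identified with $\pm1$. The Casimir element $C=EF+\frac{q^{-1}K+qK^{-1}}{(q-q^{-1})^2}$ is central, and $\overline{U}_q(sl_2)=\bigoplus_{s=0}^pQ_s$ as algebras, where $Q_s$ is the generalized eigenspace of (multiplication by) $C$ with eigenvalue $\frac{q^s+q^{-s}}{(q-q^{-1})^2}$. For $1\le s,t\le p$ put $v^\alpha(s,t)=\sum_{\ell=0}^{2p-1}(\alpha q^{-(s-2t+1)})^\ell K^\ell$ and $a_n^\alpha(s,t)=F^nE^{p-1}F^{p-t}v^\alpha(s,t)$. For $1\le s\le p-1$, $1\le t\le s$, $0\le n\le s-1$, $0\le k\le p-s-1$ put $\mu_m^\alpha(s)=\prod_{j=p-s-(m-1)}^{p-s-1}(-\alpha[j][p-s-j])$, $b_n^\alpha(s,t)=F^n\sum_{m=1}^{p-s}\mu_m^\alpha(s)E^{p-m-1}F^{p-t-m}v^\alpha(s,t)$, $y_k^\alpha(s,t)=F^{s+k}b_0^\alpha(s,t)$, $x_k^\alpha(s,t)=\frac{E^{p-s-k-1}}{\prod_{i=k+1}^{p-s-1}(-\alpha[i][p-s-i])}\sum_{m=1}^{p-s}\mu_m^\alpha(s)E^{p-m}F^{p-t-m}v^\alpha(s,t)$.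 For $1\le s\le p-1$ put $\gamma_s=2p\prod_{m=1}^{p-s-1}(-[m][p-s-m])\prod_{i=1}^{s-1}([i][s-i])$ and $\delta_s=2p\prod_{m=1}^{p-s-1}(-[m][p-s-m])\sum_{j=1}^{s-1}\prod_{1\le k\le s-1,\,k\ne j}([k][s-k])+2p\prod_{i=1}^{s-1}([i][s-i])\sum_{n=1}^{p-s-1}\prod_{1\le k\le p-s-1,\,k\ne n}(-[k][p-s-k])$. Define $A_n^{\alpha}(p,t)=\frac{1}{2p\prod_{i=1}^{p-1}(\alpha[i][p-i])}a_n^{\alpha}(p,t)$ for $0\le n\le p-1$, $1\le t\le p$. For $1\le s\le p-1$, $1\le t\le s$, $1\le u\le p-s$, $0\le n\le s-1$, $0\le k\le p-s-1$ define $B_n^+(s,t)=\frac1{\gamma_s}\big(b_n^+(s,t)-\frac{\delta_s}{\gamma_s}a_n^+(s,t)\big)$, $X_k^+(s,t)=\frac1{\gamma_s}x_k^+(s,t)$, $Y_k^+(s,t)=\frac1{\gamma_s}y_k^+(s,t)$, $A_n^+(s,t)=\frac1{\gamma_s}a_n^+(s,t)$, $B_k^-(p-s,u)=\frac1{\gamma_s}\big(b_k^-(p-s,u)-\frac{\delta_s}{\gamma_s}a_k^-(p-s,u)\big)$, $X_n^-(p-s,u)=\frac1{\gamma_s}x_n^-(p-s,u)$, $Y_n^-(p-s,u)=\frac1{\gamma_s}y_n^-(p-s,u)$, $A_k^-(p-s,u)=\frac1{\gamma_s}a_k^-(p-s,u)$. *)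

theory Defs
  imports
    Complex_Main
    "HOL-Library.Poly_Mapping"
    "HOL-Algebra.QuotRing"
    "Jordan_Normal_Form.VS_Connect"
begin

section \<open>The free algebra on four generators\<close>

text \<open>Words form a monoid under concatenation. It is written additively, because the
  convolution product on \<^typ>\<open>'a \<Rightarrow>\<^sub>0 'b\<close> expects an additive monoid of exponents.\<close>

datatype 'a free_monoid = Word "'a list"

instantiation free_monoid :: (type) monoid_add
begin

definition zero_free_monoid :: "'a free_monoid" where
  "zero_free_monoid = Word []"

fun plus_free_monoid :: "'a free_monoid \<Rightarrow> 'a free_monoid \<Rightarrow> 'a free_monoid" where
  "plus_free_monoid (Word u) (Word v) = Word (u @ v)"

instance
proof
  fix a b c :: "'a free_monoid"
  show "a + b + c = a + (b + c)" by (cases a; cases b; cases c) simp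
  show "0 + a = a" by (cases a) (simp add: zero_free_monoid_def)
  show "a + 0 = a" by (cases a) (simp add: zero_free_monoid_def)
qed

end

datatype gen = Gen_E | Gen_F | Gen_K | Gen_Kinv

type_synonym free_alg = "gen free_monoid \<Rightarrow>\<^sub>0 complex"

definition gen :: "gen \<Rightarrow> free_alg" where
  "gen g = Poly_Mapping.single (Word [g]) 1"

text \<open>The scalar \<open>c\<close> as a multiple of the unit; scalar multiplication is \<open>scal c * x\<close>.\<close>

definition scal :: "complex \<Rightarrow> free_alg" where
  "scal c = Poly_Mapping.single 0 c"

abbreviation gE :: free_alg where "gE \<equiv> gen Gen_E"
abbreviation gF :: free_alg where "gF \<equiv> gen Gen_F"
abbreviation gK :: free_alg where "gK \<equiv> gen Gen_K"
abbreviation gKinv :: free_alg where "gKinv \<equiv> gen Gen_Kinv"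


section \<open>The restricted quantum group\<close>

definition q :: "nat \<Rightarrow> complex" where
  "q p = exp (of_real pi * \<i> / of_nat p)"

definition qint :: "nat \<Rightarrow> nat \<Rightarrow> complex" where
  "qint p n = (q p ^ n - inverse (q p) ^ n) / (q p - inverse (q p))"

definition relators :: "nat \<Rightarrow> free_alg set" where
  "relators p =
    {gK * gKinv - 1,
     gKinv * gK - 1,
     gK * gE * gKinv - scal (q p ^ 2) * gE,
     gK * gF * gKinv - scal (inverse (q p) ^ 2) * gF,
     gE * gF - gF * gE - scal (1 / (q p - inverse (q p))) * (gK - gKinv),
     gE ^ p,
     gF ^ p,
     gK ^ (2 * p) - 1}"

definition rel_ideal :: "nat \<Rightarrow> free_alg set" where
  "rel_ideal p = Idl\<^bsub>class_ring\<^esub> (relators p)"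

definition cls :: "nat \<Rightarrow> free_alg \<Rightarrow> free_alg set" where
  "cls p x = rel_ideal p +>\<^bsub>class_ring\<^esub> x"

definition Uq :: "nat \<Rightarrow> (complex, free_alg set) module" where
  "Uq p =
    (let R = class_ring Quot rel_ideal p in
      \<lparr>carrier = carrier R, mult = mult R, one = one R, zero = zero R, add = add R,
       smult = (\<lambda>c X. cls p (scal c) \<otimes>\<^bsub>R\<^esub> X)\<rparr>)"

definition casimir :: "nat \<Rightarrow> free_alg set" where
  "casimir p = cls p (gE * gF
     + scal (1 / (q p - inverse (q p)) ^ 2) * (scal (inverse (q p)) * gK + scal (q p) * gKinv))"

definition casimir_eigval :: "nat \<Rightarrow> nat \<Rightarrow> complex" where
  "casimir_eigval p s = (q p ^ s + inverse (q p) ^ s) / (q p - inverse (q p)) ^ 2"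

definition Q_space :: "nat \<Rightarrow> nat \<Rightarrow> free_alg set set" where
  "Q_space p s =
    {x \<in> carrier (Uq p). \<exists>n::nat.
       ((casimir p \<ominus>\<^bsub>Uq p\<^esub> casimir_eigval p s \<odot>\<^bsub>Uq p\<^esub> \<one>\<^bsub>Uq p\<^esub>) [^]\<^bsub>Uq p\<^esub> n) \<otimes>\<^bsub>Uq p\<^esub> x
         = \<zero>\<^bsub>Uq p\<^esub>}"

text \<open>The block as an algebra in its own right: its unit is not that of the whole algebra.\<close>

definition Q :: "nat \<Rightarrow> nat \<Rightarrow> (complex, free_alg set) module" where
  "Q p s = (Uq p)\<lparr>carrier := Q_space p s,
     one := (THE e. e \<in> Q_space p s \<and>
       (\<forall>x\<in>Q_space p s. e \<otimes>\<^bsub>Uq p\<^esub> x = x \<and> x \<otimes>\<^bsub>Uq p\<^esub> e = x))\<rparr>"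

definition family_basis :: "(complex, 'a) module \<Rightarrow> 'i set \<Rightarrow> ('i \<Rightarrow> 'a) \<Rightarrow> bool" where
  "family_basis V I f \<longleftrightarrow>
    vectorspace class_ring V \<and> inj_on f I \<and> vectorspace.basis class_ring V (f ` I)"

definition algebra_isomorphic ::
  "(complex, 'a) module \<Rightarrow> (complex, 'b) module \<Rightarrow> bool" where
  "algebra_isomorphic A B \<longleftrightarrow>
    (\<exists>\<phi>\<in>ring_iso A B. \<forall>c. \<forall>x\<in>carrier A. \<phi> (c \<odot>\<^bsub>A\<^esub> x) = c \<odot>\<^bsub>B\<^esub> \<phi> x)"


section \<open>The elements, written as representatives in the free algebra\<close>

text \<open>A sign \<open>\<alpha>\<close> is the complex number \<open>1\<close> or \<open>-1\<close>.\<close>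

definition v_rep :: "nat \<Rightarrow> complex \<Rightarrow> nat \<Rightarrow> nat \<Rightarrow> free_alg" where
  "v_rep p \<alpha> s t =
    (\<Sum>l<2 * p. scal ((\<alpha> * q p powi (- (int s - 2 * int t + 1))) ^ l) * gK ^ l)"

definition a_rep :: "nat \<Rightarrow> complex \<Rightarrow> nat \<Rightarrow> nat \<Rightarrow> nat \<Rightarrow> free_alg" where
  "a_rep p \<alpha> s t n = gF ^ n * gE ^ (p - 1) * gF ^ (p - t) * v_rep p \<alpha> s t"

definition mu :: "nat \<Rightarrow> complex \<Rightarrow> nat \<Rightarrow> nat \<Rightarrow> complex" where
  "mu p \<alpha> s m = (\<Prod>j = p - s - (m - 1)..p - s - 1. - \<alpha> * qint p j * qint p (p - s - j))"

definition b_rep :: "nat \<Rightarrow> complex \<Rightarrow> nat \<Rightarrow> nat \<Rightarrow> nat \<Rightarrow> free_alg" where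
  "b_rep p \<alpha> s t n = gF ^ n *
    (\<Sum>m = 1..p - s. scal (mu p \<alpha> s m) * gE ^ (p - m - 1) * gF ^ (p - t - m) * v_rep p \<alpha> s t)"

definition y_rep :: "nat \<Rightarrow> complex \<Rightarrow> nat \<Rightarrow> nat \<Rightarrow> nat \<Rightarrow> free_alg" where
  "y_rep p \<alpha> s t k = gF ^ (s + k) * b_rep p \<alpha> s t 0"

definition x_rep :: "nat \<Rightarrow> complex \<Rightarrow> nat \<Rightarrow> nat \<Rightarrow> nat \<Rightarrow> free_alg" where
  "x_rep p \<alpha> s t k =
    scal (1 / (\<Prod>i = k + 1..p - s - 1. - \<alpha> * qint p i * qint p (p - s - i))) * gE ^ (p - s - k - 1) *
    (\<Sum>m = 1..p - s. scal (mu p \<alpha> s m) * gE ^ (p - m) * gF ^ (p - t - m) * v_rep p \<alpha> s t)"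

definition gamma :: "nat \<Rightarrow> nat \<Rightarrow> complex" where
  "gamma p s = 2 * of_nat p
     * (\<Prod>m = 1..p - s - 1. - qint p m * qint p (p - s - m))
     * (\<Prod>i = 1..s - 1. qint p i * qint p (s - i))"

definition delta :: "nat \<Rightarrow> nat \<Rightarrow> complex" where
  "delta p s =
     2 * of_nat p * (\<Prod>m = 1..p - s - 1. - qint p m * qint p (p - s - m))
       * (\<Sum>j = 1..s - 1. \<Prod>k \<in> {1..s - 1} - {j}. qint p k * qint p (s - k))
   + 2 * of_nat p * (\<Prod>i = 1..s - 1. qint p i * qint p (s - i))
       * (\<Sum>n = 1..p - s - 1. \<Prod>k \<in> {1..p - s - 1} - {n}. - qint p k * qint p (p - s - k))"

text \<open>The elements \<open>A\<^sub>n\<^sup>\<alpha>(p,t)\<close>, whose normalization differs from that of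
  \<open>A\<^sub>n\<^sup>\<alpha>(s,t)\<close> with \<open>s < p\<close>.\<close>

definition A_top :: "nat \<Rightarrow> complex \<Rightarrow> nat \<Rightarrow> nat \<Rightarrow> free_alg set" where
  "A_top p \<alpha> n t = cls p
    (scal (1 / (2 * of_nat p * (\<Prod>i = 1..p - 1. \<alpha> * qint p i * qint p (p - i)))) * a_rep p \<alpha> p t n)"

text \<open>Labels of the basis of the block \<open>s\<close>. The first argument is the lower index
  (\<open>n\<close> or \<open>k\<close>), the second one the index \<open>t\<close> or \<open>u\<close>; the label \<open>XP k t\<close> stands for
  \<open>X\<^sub>k\<^sup>+(s,t)\<close> and \<open>XM n u\<close> for \<open>X\<^sub>n\<^sup>-(p-s,u)\<close>, and similarly for the others.\<close>

datatype label =
    BP nat nat | XP nat nat | YP nat nat | AP nat nat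
  | BM nat nat | XM nat nat | YM nat nat | AM nat nat

definition labels :: "nat \<Rightarrow> nat \<Rightarrow> label set" where
  "labels p s =
     {BP n t | n t. n < s \<and> t \<in> {1..s}} \<union>
     {XP k t | k t. k < p - s \<and> t \<in> {1..s}} \<union>
     {YP k t | k t. k < p - s \<and> t \<in> {1..s}} \<union>
     {AP n t | n t. n < s \<and> t \<in> {1..s}} \<union>
     {BM k u | k u. k < p - s \<and> u \<in> {1..p - s}} \<union>
     {XM n u | n u. n < s \<and> u \<in> {1..p - s}} \<union>
     {YM n u | n u. n < s \<and> u \<in> {1..p - s}} \<union>
     {AM k u | k u. k < p - s \<and> u \<in> {1..p - s}}"

fun elt :: "nat \<Rightarrow> nat \<Rightarrow> label \<Rightarrow> free_alg set" where
  "elt p s (BP n t) = cls p (scal (1 / gamma p s) *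
     (b_rep p 1 s t n - scal (delta p s / gamma p s) * a_rep p 1 s t n))"
| "elt p s (XP k t) = cls p (scal (1 / gamma p s) * x_rep p 1 s t k)"
| "elt p s (YP k t) = cls p (scal (1 / gamma p s) * y_rep p 1 s t k)"
| "elt p s (AP n t) = cls p (scal (1 / gamma p s) * a_rep p 1 s t n)"
| "elt p s (BM k u) = cls p (scal (1 / gamma p s) *
     (b_rep p (-1) (p - s) u k - scal (delta p s / gamma p s) * a_rep p (-1) (p - s) u k))"
| "elt p s (XM n u) = cls p (scal (1 / gamma p s) * x_rep p (-1) (p - s) u n)"
| "elt p s (YM n u) = cls p (scal (1 / gamma p s) * y_rep p (-1) (p - s) u n)"
| "elt p s (AM k u) = cls p (scal (1 / gamma p s) * a_rep p (-1) (p - s) u k)"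

text \<open>The multiplication table of a block; \<^const>\<open>None\<close> means that the product is zero.\<close>

fun label_mult :: "label \<Rightarrow> label \<Rightarrow> label option" where
  "label_mult (BP n t1) (BP m t2) = (if m = t1 - 1 then Some (BP n t2) else None)"
| "label_mult (BP n t1) (AP m t2) = (if m = t1 - 1 then Some (AP n t2) else None)"
| "label_mult (XP k t1) (BP m t2) = (if m = t1 - 1 then Some (XP k t2) else None)"
| "label_mult (YP k t1) (BP m t2) = (if m = t1 - 1 then Some (YP k t2) else None)"
| "label_mult (AP n t1) (BP m t2) = (if m = t1 - 1 then Some (AP n t2) else None)"
| "label_mult (BM k u)  (XP m t2) = (if m = u - 1 then Some (XP k t2) else None)"
| "label_mult (BM k u)  (YP m t2) = (if m = u - 1 then Some (YP k t2) else None)"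
| "label_mult (XM n u)  (YP m t2) = (if m = u - 1 then Some (AP n t2) else None)"
| "label_mult (YM n u)  (XP m t2) = (if m = u - 1 then Some (AP n t2) else None)"
| "label_mult (BP n t)  (XM m u2) = (if m = t - 1 then Some (XM n u2) else None)"
| "label_mult (BP n t)  (YM m u2) = (if m = t - 1 then Some (YM n u2) else None)"
| "label_mult (XP k t)  (YM m u2) = (if m = t - 1 then Some (AM k u2) else None)"
| "label_mult (YP k t)  (XM m u2) = (if m = t - 1 then Some (AM k u2) else None)"
| "label_mult (BM k u1) (BM m u2) = (if m = u1 - 1 then Some (BM k u2) else None)"
| "label_mult (BM k u1) (AM m u2) = (if m = u1 - 1 then Some (AM k u2) else None)"
| "label_mult (XM n u1) (BM m u2) = (if m = u1 - 1 then Some (XM n u2) else None)"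
| "label_mult (YM n u1) (BM m u2) = (if m = u1 - 1 then Some (YM n u2) else None)"
| "label_mult (AM k u1) (BM m u2) = (if m = u1 - 1 then Some (AM k u2) else None)"
| "label_mult _ _ = None"

end

theory Submission
  imports Defs "HOL-Library.Function_Algebras" "HOL-Computational_Algebra.Polynomial"
begin

text \<open>On a vector of weight \<open>\<alpha> q^(s-1-2i)\<close> the products \<open>FE\<close> and \<open>EF\<close> act as \<open>Z + \<beta>\<^sub>i\<close> and
  \<open>Z + \<beta>\<^sub>i\<^sub>+\<^sub>1\<close>, where \<open>Z = C - \<alpha>(q^s+q^-s)/(q-q\<inverse>)^2\<close> is central and \<open>\<beta>\<^sub>i = \<alpha>[i][s-i]\<close>. Hence
  \<open>a\<^sub>0 = Z b\<^sub>0\<close> by telescoping, \<open>Z a\<^sub>0 = 0\<close>, and left multiplication by \<open>b\<^sub>0(s,t)\<close> sends \<open>F^(t-1) x\<close>,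
  for \<open>x\<close> of weight \<open>\<alpha> q^(s-1)\<close> with \<open>Z^2 x = 0\<close>, to \<open>\<gamma> x + \<delta> Z x\<close>: the constants are the first two
  coefficients of a product of factors \<open>Z + \<beta>\<^sub>i\<close>. This yields the multiplication table. Sandwiching
  between basis elements shows that each family is linearly independent as soon as no \<open>a\<^sub>0\<close> vanishes,
  and the blocks are independent of one another because they are killed by \<open>(C - c\<^sub>s)^2\<close> for distinct
  \<open>c\<^sub>s\<close>. The families have \<open>2p^3\<close> elements in total, as many as the monomials \<open>E^i F^j K^l\<close> spanning
  the algebra, so each one spans its generalized eigenspace.\<close>

section \<open>Quantum integers and Casimir eigenvalues\<close>

text \<open>Since q^p = -1, the pair (-\<alpha>, p - s), called the partner below, has the same
  Casimir eigenvalue as (\<alpha>, s), and the factors \<beta> of (\<alpha>, s) at indices -j and s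
  + j are the factors of the partner at j. Actions are therefore computed once for a general sign;
  the minus half of a block is the plus half applied to the partner. Among the factors that E^j F^j
  collects for j < p, only \<beta>_s is zero. Products that contain it lose their constant term and
  start with Z. This is why a_0 acts as \<gamma> Z where b_0 acts as \<gamma> + \<delta> Z, and, as
  Z^2 = 0, subtracting (\<delta>/\<gamma>) a_0 in B leaves an exact matrix unit. X and Y come from
  pushing b_0 by E^(p-s) and F^s to the highest weight of the partner. The obstacle is that the
  relations alone cannot show a_0 to be nonzero: they also hold in collapsed quotients such as E = F
  = 0, K = 1. A module over the polynomials in the Casimir element settles this by degrees: E^(p-1)
  F^(p-1) produces a polynomial of degree p - 1, while the relations only kill multiples of one of
  degree p.\<close>

definition q_pow :: "nat \<Rightarrow> int \<Rightarrow> complex" where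
  "q_pow p k = q p powi k"

text \<open>Weights run over all integers, so \<open>qint\<close> and \<open>casimir_eigval\<close>
  get versions with an integer argument.\<close>

definition q_int :: "nat \<Rightarrow> int \<Rightarrow> complex" where
  "q_int p k = (q_pow p k - q_pow p (- k)) / (q p - inverse (q p))"

definition cas_eig :: "nat \<Rightarrow> int \<Rightarrow> complex" where
  "cas_eig p k = (q_pow p k + q_pow p (- k)) / (q p - inverse (q p)) ^ 2"

lemma q_nonzero [simp]: "q p \<noteq> 0"
  by (simp add: q_def)

lemma q_pow_nonzero [simp]: "q_pow p k \<noteq> 0"
  by (simp add: q_pow_def)

lemma q_pow_0 [simp]: "q_pow p 0 = 1"
  by (simp add: q_pow_def)

lemma q_pow_1 [simp]: "q_pow p 1 = q p"
  by (simp add: q_pow_def)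

lemma q_pow_add: "q_pow p (a + b) = q_pow p a * q_pow p b"
  by (simp add: q_pow_def power_int_add)

lemma q_pow_minus: "q_pow p (- a) = inverse (q_pow p a)"
  by (simp add: q_pow_def power_int_minus)

lemma q_pow_diff: "q_pow p (a - b) = q_pow p a * inverse (q_pow p b)"
  using q_pow_add[of p a "- b"] by (simp add: q_pow_minus)

lemma q_pow_double: "q_pow p (i * 2) = q_pow p i * q_pow p i" "q_pow p (2 * i) = q_pow p i * q_pow p i"
  using q_pow_add[of p i i] by (simp_all add: mult.commute)

lemma q_pow_nat: "q_pow p (int n) = q p ^ n"
  by (simp add: q_pow_def)

lemma q_pow_power: "q_pow p a ^ n = q_pow p (int n * a)"
  by (simp add: q_pow_def power_int_mult mult.commute flip: power_int_of_nat)

lemma q_pow_cis: "p > 0 \<Longrightarrow> q_pow p k = cis (pi * of_int k / of_nat p)"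
  by (simp add: q_pow_def q_def exp_power_int cis_conv_exp mult_ac)

text \<open>\<open>q p\<close> is a primitive 2p-th root of unity; comparisons of weights reduce to
  divisibility by 2p.\<close>

lemma q_pow_eq_1_iff:
  assumes "p > 0"
  shows "q_pow p k = 1 \<longleftrightarrow> 2 * int p dvd k"
proof
  assume "q_pow p k = 1"
  then have "cos (pi * of_int k / of_nat p) = 1"
    using assms by (simp add: q_pow_cis complex_eq_iff)
  then obtain n :: int where "pi * of_int k / of_nat p = of_int n * 2 * pi"
    by (auto simp: cos_one_2pi_int)
  then have "real_of_int k = of_int (n * 2 * int p)"
    using assms by (simp add: field_simps)
  then have "k = n * 2 * int p"
    by (simp only: of_int_eq_iff)
  then show "2 * int p dvd k"
    by simp
next
  assume "2 * int p dvd k"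
  then obtain n where n: "k = 2 * int p * n" ..
  then have "q_pow p k = cis (2 * pi * of_int n)"
    using assms by (simp add: q_pow_cis field_simps)
  also have "\<dots> = 1"
    by (simp add: complex_eq_iff)
  finally show "q_pow p k = 1" .
qed

lemma q_pow_p: "p > 0 \<Longrightarrow> q_pow p (int p) = - 1"
  by (simp add: q_pow_cis)

lemma q_pow_eq_iff: "p > 0 \<Longrightarrow> q_pow p a = q_pow p b \<longleftrightarrow> 2 * int p dvd a - b"
  by (simp add: q_pow_diff divide_eq_eq flip: q_pow_eq_1_iff divide_inverse)

lemma q_minus_inverse_nonzero:
  assumes "p \<ge> 2"
  shows "q p - inverse (q p) \<noteq> 0"
proof
  assume "q p - inverse (q p) = 0"
  then have "q_pow p 1 = q_pow p (- 1)"
    unfolding q_pow_minus by simp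
  then have "2 * int p dvd 1 - (- 1)"
    using assms by (subst (asm) q_pow_eq_iff) auto
  then show False
    using assms by (auto dest!: zdvd_imp_le)
qed

lemma q_int_minus: "q_int p (- k) = - q_int p k"
  by (simp add: q_int_def minus_divide_left del: divide_minus_left)

lemma q_int_nat: "q_int p (int n) = qint p n"
  by (simp add: q_int_def qint_def q_pow_nat q_pow_minus power_inverse)

lemma q_int_p_plus: "p > 0 \<Longrightarrow> q_int p (int p + k) = - q_int p k"
  using q_pow_add[of p "int p" k] q_pow_diff[of p "- k" "int p"]
  by (simp add: q_int_def q_pow_p add.commute minus_divide_left del: divide_minus_left)

lemma q_int_p_minus: "p > 0 \<Longrightarrow> q_int p (int p - k) = q_int p k"
  using q_int_p_plus[of p "- k"] by (simp add: q_int_minus)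

lemma q_int_0 [simp]: "q_int p 0 = 0"
  by (simp add: q_int_def)

lemma q_int_nonzero:
  assumes "p \<ge> 2" "0 < i" "i < int p"
  shows "q_int p i \<noteq> 0"
proof
  assume "q_int p i = 0"
  then have "q_pow p i = q_pow p (- i)"
    using q_minus_inverse_nonzero[OF assms(1)] by (simp add: q_int_def)
  then have "2 * int p dvd 2 * i"
    using assms by (simp add: q_pow_eq_iff)
  then show False
    using assms by (auto dest!: zdvd_imp_le)
qed

text \<open>The numerator factors: q^s + q^-s - q^(s-2i) - q^(2i-s) = (q^i - q^-i)(q^(s-i) -
  q^(i-s)). This is the origin of \<open>beta\<close>.\<close>

lemma cas_eig_diff: "cas_eig p s - cas_eig p (s - 2 * i) = q_int p i * q_int p (s - i)"
proof -
  have 1: "s - 2 * i = s - i - i" by simp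
  show ?thesis
    unfolding cas_eig_def q_int_def
    by (simp only: 1 minus_diff_eq times_divide_times_eq power2_eq_square flip: diff_divide_distrib)
       (rule arg_cong2[where f = "(/)"], simp_all add: q_pow_diff q_pow_minus q_pow_double field_simps)
qed

lemma cas_eig_p_minus: "p > 0 \<Longrightarrow> cas_eig p (int p - k) = - cas_eig p k"
  using q_pow_diff[of p k "int p"] q_pow_add[of p "int p" "- k"]
  by (simp add: cas_eig_def q_pow_p minus_divide_left del: divide_minus_left)

lemma casimir_eigval_cas_eig: "casimir_eigval p s = cas_eig p (int s)"
  by (simp add: cas_eig_def casimir_eigval_def q_pow_nat q_pow_minus power_inverse)

text \<open>x + 1/x = y + 1/y forces x = y or xy = 1, so 2p divides s - s' or s + s'. In the given
  range this leaves s = s', the sum reaching 0 or 2p only for s = s' = 0 or s = s' = p.\<close>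

lemma cas_eig_inj:
  assumes p: "p \<ge> 2" and "s \<le> p" "s' \<le> p" and eq: "cas_eig p (int s) = cas_eig p (int s')"
  shows "s = s'"
proof -
  let ?x = "q_pow p (int s)" and ?y = "q_pow p (int s')"
  have "?x + inverse ?x = ?y + inverse ?y"
    using eq q_minus_inverse_nonzero[OF p] by (simp add: cas_eig_def q_pow_minus)
  then have "(?x - ?y) * (?x * ?y - 1) = 0"
    by (simp add: field_simps)
  then have "?x = ?y \<or> ?x * ?y = 1"
    by auto
  then have "2 * int p dvd int s - int s' \<or> 2 * int p dvd int s + int s'"
    using p by (simp add: q_pow_eq_iff flip: q_pow_eq_1_iff q_pow_add)
  then show ?thesis
  proof
    assume "2 * int p dvd int s - int s'"
    then have "\<bar>2 * int p\<bar> \<le> \<bar>int s - int s'\<bar>" if "s \<noteq> s'"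
      using that by (intro dvd_imp_le_int) auto
    then show ?thesis
      using assms by linarith
  next
    assume d: "2 * int p dvd int s + int s'"
    show ?thesis
    proof (cases "s + s' = 0")
      case False
      then have "2 * int p \<le> int s + int s'"
        using d by (intro zdvd_imp_le) auto
      then show ?thesis using assms by linarith
    qed simp
  qed
qed

section \<open>Casimir shifts and the low coefficients of a product of linear factors\<close>

definition beta :: "nat \<Rightarrow> complex \<Rightarrow> int \<Rightarrow> int \<Rightarrow> complex" where
  "beta p \<alpha> s i = \<alpha> * q_int p i * q_int p (s - i)"

lemma beta_0 [simp]: "beta p \<alpha> s 0 = 0" and beta_s [simp]: "beta p \<alpha> s s = 0"
  by (simp_all add: beta_def)

text \<open>Both quantum integers change sign when the index moves by p.\<close>

lemma beta_p_plus: "p > 0 \<Longrightarrow> beta p \<alpha> s (int p + i) = beta p \<alpha> s i"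
  using q_int_p_plus[of p i] q_int_p_plus[of p "i - s"] q_int_minus[of p "s - i"]
    q_int_minus[of p "int p + (i - s)"]
  by (simp add: beta_def algebra_simps)

text \<open>[-j] = -[j] and [s+j] = [p-s-j], so the factors below index 0, and likewise those above
  index s, belong to the partner (-\<alpha>, p - s).\<close>

lemma beta_minus: "p > 0 \<Longrightarrow> beta p \<alpha> s (- j) = beta p (- \<alpha>) (int p - s) j"
  using q_int_p_minus[of p "s + j"] by (simp add: beta_def q_int_minus algebra_simps)

lemma beta_s_plus: "p > 0 \<Longrightarrow> beta p \<alpha> s (s + j) = beta p (- \<alpha>) (int p - s) j"
  using q_int_p_minus[of p "s + j"] by (simp add: beta_def q_int_minus algebra_simps)

lemma beta_nonzero:
  assumes "p \<ge> 2" "\<alpha> \<noteq> 0" "0 < i" "i < s" "s \<le> int p"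
  shows "beta p \<alpha> s i \<noteq> 0"
  using assms by (simp add: beta_def q_int_nonzero)

text \<open>The coefficient of z in the product of all z + f j, that is, the elementary symmetric
  polynomial of degree one less than the number of factors.\<close>

definition prod_omit :: "('i \<Rightarrow> complex) \<Rightarrow> 'i set \<Rightarrow> complex" where
  "prod_omit f A = (\<Sum>j\<in>A. \<Prod>k\<in>A - {j}. f k)"

lemma prod_omit_insert:
  assumes "finite A" "x \<notin> A"
  shows "prod_omit f (insert x A) = prod f A + f x * prod_omit f A"
proof -
  have "(\<Sum>j\<in>A. \<Prod>k\<in>insert x A - {j}. f k) = (\<Sum>j\<in>A. f x * (\<Prod>k\<in>A - {j}. f k))"
  proof (rule sum.cong)
    fix j assume "j \<in> A"
    then have "insert x A - {j} = insert x (A - {j})" using assms by auto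
    then show "(\<Prod>k\<in>insert x A - {j}. f k) = f x * (\<Prod>k\<in>A - {j}. f k)"
      using assms by simp
  qed simp
  then show ?thesis
    using assms by (simp add: prod_omit_def sum_distrib_left)
qed

lemma prod_omit_empty [simp]: "prod_omit f {} = 0"
  by (simp add: prod_omit_def)

text \<open>Every summand except the one that omits \<open>j\<close> contains the factor
  \<open>f j\<close>.\<close>

lemma prod_omit_zero:
  assumes "finite A" "j \<in> A" "f j = 0"
  shows "prod_omit f A = prod f (A - {j})"
  using prod_omit_insert[of "A - {j}" j f] assms by (simp add: insert_absorb)

lemma prod_omit_union:
  assumes "finite A" "finite B" "A \<inter> B = {}"
  shows "prod_omit f (A \<union> B) = prod f B * prod_omit f A + prod f A * prod_omit f B"
  using assms
proof (induction A rule: finite_induct)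
  case (insert x A)
  then have "prod_omit f (insert x (A \<union> B)) = prod f (A \<union> B) + f x * prod_omit f (A \<union> B)"
    by (intro prod_omit_insert) auto
  with insert show ?case
    by (simp add: prod_omit_insert prod.union_disjoint algebra_simps)
qed simp

lemma prod_omit_reindex:
  assumes "inj_on h A"
  shows "prod_omit f (h ` A) = prod_omit (\<lambda>i. f (h i)) A"
proof -
  have "prod f (h ` A - {h j}) = (\<Prod>k\<in>A - {j}. f (h k))" if "j \<in> A" for j
  proof -
    have "h ` A - {h j} = h ` (A - {j})"
      using assms that by (auto simp: inj_on_def)
    moreover have "inj_on h (A - {j})"
      using assms by (rule inj_on_subset) auto
    ultimately show ?thesis by (simp add: prod.reindex)
  qed
  then show ?thesis
    using assms by (simp add: prod_omit_def sum.reindex)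
qed

lemma prod_omit_cong: "A = B \<Longrightarrow> (\<And>i. i \<in> B \<Longrightarrow> f i = g i) \<Longrightarrow> prod_omit f A = prod_omit g B"
  unfolding prod_omit_def by (intro sum.cong prod.cong) auto

section \<open>The relations in a ring with central scalars\<close>

text \<open>The relations are imposed in an arbitrary unital ring type, where identities are
  computed without a carrier; the map \<open>sc\<close> embeds the scalars into the centre. The
  quotient \<open>Uq\<close> is tied to this setting through \<open>comp_emb\<close>.\<close>

locale uq_alg =
  fixes p :: nat and sc :: "complex \<Rightarrow> 'r::ring_1" and E F K K' :: 'r
  assumes p2: "2 \<le> p"
    and sc_add: "sc (c + d) = sc c + sc d"
    and sc_mult: "sc (c * d) = sc c * sc d"
    and sc_1: "sc 1 = 1"
    and sc_central: "x * sc c = sc c * x"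
    and KK': "K * K' = 1" and K'K: "K' * K = 1"
    and KEK': "K * E * K' = sc (q p ^ 2) * E"
    and KFK': "K * F * K' = sc (inverse (q p) ^ 2) * F"
    and EF_FE: "E * F - F * E = sc (1 / (q p - inverse (q p))) * (K - K')"
    and E_power_p: "E ^ p = 0" and F_power_p: "F ^ p = 0"
    and K_power_2p: "K ^ (2 * p) = 1"
begin

lemma p0: "0 < p" and p1: "1 \<le> p" using p2 by simp_all

definition smul :: "complex \<Rightarrow> 'r \<Rightarrow> 'r" (infixr "*s" 75) where
  "c *s x = sc c * x"

lemma smul_mult_left [simp]: "(c *s x) * y = c *s (x * y)"
  by (simp add: smul_def mult.assoc)

lemma smul_mult_right [simp]: "x * (c *s y) = c *s (x * y)"
  unfolding smul_def by (metis mult.assoc sc_central)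

sublocale vs: vector_space smul
  by unfold_locales (simp_all add: smul_def distrib_left distrib_right sc_add sc_mult sc_1 mult.assoc)

lemma smul_smul [simp]: "c *s d *s x = (c * d) *s x"
  by (rule vs.scale_scale)

definition Cas :: 'r where
  "Cas = E * F + (1 / (q p - inverse (q p)) ^ 2) *s (inverse (q p) *s K + q p *s K')"

lemma KE: "K * E = (q p ^ 2) *s (E * K)"
proof -
  have "K * E = K * E * (K' * K)" by (simp add: K'K)
  also have "\<dots> = (K * E * K') * K" by (simp add: mult.assoc)
  finally show ?thesis unfolding KEK' by (simp add: smul_def mult.assoc)
qed

lemma KF: "K * F = (inverse (q p) ^ 2) *s (F * K)"
proof -
  have "K * F = K * F * (K' * K)" by (simp add: K'K)
  also have "\<dots> = (K * F * K') * K" by (simp add: mult.assoc)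
  finally show ?thesis unfolding KFK' by (simp add: smul_def mult.assoc)
qed

lemma K'E: "K' * E = (inverse (q p) ^ 2) *s (E * K')"
proof -
  have "E * K' = K' * (K * E * K')" by (simp add: K'K flip: mult.assoc)
  then have "E * K' = (q p ^ 2) *s (K' * E)" by (simp add: KEK' flip: smul_def)
  then show ?thesis by (simp flip: power_mult_distrib)
qed

lemma K'F: "K' * F = (q p ^ 2) *s (F * K')"
proof -
  have "F * K' = K' * (K * F * K')" by (simp add: K'K flip: mult.assoc)
  then have "F * K' = (inverse (q p) ^ 2) *s (K' * F)" by (simp add: KFK' flip: smul_def)
  then show ?thesis by (simp flip: power_mult_distrib)
qed

lemma q_cancel: "q p * (inverse (q p) * c) = c" "inverse (q p) * (q p * c) = c"
  by simp_all

lemma FE_eq: "F * E = E * F - (1 / (q p - inverse (q p))) *s (K - K')"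
  using EF_FE by (simp add: smul_def algebra_simps)

lemma Cas_alt: "Cas = F * E + (1 / (q p - inverse (q p)) ^ 2) *s (q p *s K + inverse (q p) *s K')"
proof -
  let ?w = "q p - inverse (q p)"
  have w: "?w \<noteq> 0" by (rule q_minus_inverse_nonzero[OF p2])
  have "1 / ?w = 1 / ?w ^ 2 * ?w" using w by (simp add: power2_eq_square)
  then have "(1 / ?w) *s (K - K') = (1 / ?w ^ 2) *s ?w *s (K - K')"
    by simp
  then show ?thesis
    unfolding Cas_def FE_eq
    by (simp only:) (simp add: vs.scale_right_diff_distrib vs.scale_right_distrib
        vs.scale_left_diff_distrib algebra_simps)
qed

text \<open>Both sides contain E F E: the left one through the form \<open>Cas_def\<close>, the
  right one through \<open>Cas_alt\<close>. Moving E past K and K' turns the coefficients of one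
  form into those of the other.\<close>

lemma Cas_E: "Cas * E = E * Cas"
proof -
  have "Cas * E = E * F * E + (1 / (q p - inverse (q p)) ^ 2) *s (q p *s (E * K) + inverse (q p) *s (E * K'))"
    unfolding Cas_def
    by (simp add: distrib_right KE K'E power2_eq_square q_cancel)
  also have "\<dots> = E * Cas"
    unfolding Cas_alt by (simp add: distrib_left mult.assoc)
  finally show ?thesis .
qed

lemma Cas_F: "Cas * F = F * Cas"
proof -
  have "Cas * F = F * E * F + (1 / (q p - inverse (q p)) ^ 2) *s (inverse (q p) *s (F * K) + q p *s (F * K'))"
    unfolding Cas_alt
    by (simp add: distrib_right KF K'F power2_eq_square q_cancel)
  also have "\<dots> = F * Cas"
    unfolding Cas_def by (simp add: distrib_left mult.assoc)
  finally show ?thesis .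
qed

lemma Cas_E_pow: "Cas * E ^ n = E ^ n * Cas"
  by (rule power_commuting_commutes[symmetric]) (rule Cas_E[symmetric])

lemma Cas_F_pow: "Cas * F ^ n = F ^ n * Cas"
  by (rule power_commuting_commutes[symmetric]) (rule Cas_F[symmetric])

definition Z :: "complex \<Rightarrow> int \<Rightarrow> 'r" where
  "Z \<alpha> s = Cas - (\<alpha> * cas_eig p s) *s 1"

lemma Z_E_pow [simp]: "Z \<alpha> s * (E ^ n * x) = E ^ n * (Z \<alpha> s * x)"
  unfolding Z_def by (simp add: left_diff_distrib right_diff_distrib Cas_E_pow flip: mult.assoc)

lemma Z_F_pow [simp]: "Z \<alpha> s * (F ^ n * x) = F ^ n * (Z \<alpha> s * x)"
  unfolding Z_def by (simp add: left_diff_distrib right_diff_distrib Cas_F_pow flip: mult.assoc)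

lemma Z_E [simp]: "Z \<alpha> s * (E * x) = E * (Z \<alpha> s * x)"
  using Z_E_pow[of _ _ 1] by simp

lemma Z_F [simp]: "Z \<alpha> s * (F * x) = F * (Z \<alpha> s * x)"
  using Z_F_pow[of _ _ 1] by simp

text \<open>The partner has the same Casimir eigenvalue, so both families of a block share one
  nilpotent operator.\<close>

lemma Z_flip: "Z (- \<alpha>) (int p - s) = Z \<alpha> s"
  by (simp add: Z_def cas_eig_p_minus[OF p0])

definition wt :: "complex \<Rightarrow> int \<Rightarrow> 'r \<Rightarrow> bool" where
  "wt \<alpha> k x \<longleftrightarrow> K * x = (\<alpha> * q_pow p k) *s x"

lemma wt_smul: "wt \<alpha> k x \<Longrightarrow> wt \<alpha> k (c *s x)"
  by (simp add: wt_def mult_ac)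

lemma wt_diff: "wt \<alpha> k x \<Longrightarrow> wt \<alpha> k y \<Longrightarrow> wt \<alpha> k (x - y)"
  by (simp add: wt_def right_diff_distrib vs.scale_right_diff_distrib)

lemma wt_sum: "(\<And>i. i \<in> A \<Longrightarrow> wt \<alpha> k (f i)) \<Longrightarrow> wt \<alpha> k (sum f A)"
  by (simp add: wt_def sum_distrib_left vs.scale_sum_right)

lemma q_pow_shift: "q_pow p (k + 2) = q_pow p k * q p ^ 2" "q_pow p (k - 2) = q_pow p k * inverse (q p) ^ 2"
  using q_pow_nat[of p 2] by (simp_all add: q_pow_add q_pow_diff power_inverse)

lemma sign_q_pow: "\<alpha> * \<alpha> = 1 \<Longrightarrow> \<alpha> * q_pow p (- k) * (\<alpha> * q_pow p k) = 1"
proof -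
  assume "\<alpha> * \<alpha> = 1"
  have "\<alpha> * q_pow p (- k) * (\<alpha> * q_pow p k) = (\<alpha> * \<alpha>) * (q_pow p k * q_pow p (- k))"
    by (simp only: mult_ac)
  with \<open>\<alpha> * \<alpha> = 1\<close> show ?thesis by (simp add: q_pow_minus)
qed

lemma wt_E: "wt \<alpha> k x \<Longrightarrow> wt \<alpha> (k + 2) (E * x)"
  unfolding wt_def
  by (subst mult.assoc[symmetric]) (simp add: KE mult.assoc q_pow_shift mult_ac)

lemma wt_F: "wt \<alpha> k x \<Longrightarrow> wt \<alpha> (k - 2) (F * x)"
  unfolding wt_def
  by (subst mult.assoc[symmetric]) (simp add: KF mult.assoc q_pow_shift mult_ac)

lemma wt_E_pow: "wt \<alpha> k x \<Longrightarrow> wt \<alpha> (k + 2 * int n) (E ^ n * x)"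
proof (induction n)
  case (Suc n)
  then show ?case using wt_E[of \<alpha> "k + 2 * int n" "E ^ n * x"] by (simp add: mult.assoc algebra_simps)
qed simp

lemma wt_F_pow: "wt \<alpha> k x \<Longrightarrow> wt \<alpha> (k - 2 * int n) (F ^ n * x)"
proof (induction n)
  case (Suc n)
  then show ?case using wt_F[of \<alpha> "k - 2 * int n" "F ^ n * x"] by (simp add: mult.assoc algebra_simps)
qed simp

text \<open>As q^p = -1, sign and exponent label an eigenvalue of K redundantly. Changing the sign
  lets a vector of one family be read as a vector of the partner.\<close>

lemma wt_flip: "wt \<alpha> k x \<Longrightarrow> wt (- \<alpha>) (k + int p) x"
  by (simp add: wt_def q_pow_add q_pow_p[OF p0])

lemma wt_flip_minus: "wt \<alpha> k x \<Longrightarrow> wt (- \<alpha>) (k - int p) x"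
  by (simp add: wt_def q_pow_diff q_pow_p[OF p0])

lemma K'_wt:
  assumes "wt \<alpha> k x" "\<alpha> * \<alpha> = 1"
  shows "K' * x = (\<alpha> * q_pow p (- k)) *s x"
proof -
  have "x = K' * (K * x)" by (simp add: K'K flip: mult.assoc)
  also have "\<dots> = (\<alpha> * q_pow p k) *s (K' * x)" using assms by (simp add: wt_def)
  finally have "(\<alpha> * q_pow p (- k)) *s x = (\<alpha> * q_pow p (- k)) *s (\<alpha> * q_pow p k) *s (K' * x)"
    by (rule arg_cong)
  also have "\<dots> = K' * x"
    unfolding smul_smul sign_q_pow[OF assms(2)] by simp
  finally show ?thesis by simp
qed

lemma EF_wt:
  assumes "wt \<alpha> k x" "\<alpha> * \<alpha> = 1"
  shows "E * (F * x) = Cas * x - (\<alpha> * cas_eig p (k - 1)) *s x"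
proof -
  have "Cas * x = E * (F * x) + (1 / (q p - inverse (q p)) ^ 2 * (inverse (q p) * (\<alpha> * q_pow p k) + q p * (\<alpha> * q_pow p (- k)))) *s x"
    using K'_wt[OF assms] assms(1)
    unfolding Cas_def wt_def
    by (simp add: distrib_right mult.assoc vs.scale_left_distrib vs.scale_right_distrib distrib_left)
  also have "1 / (q p - inverse (q p)) ^ 2 * (inverse (q p) * (\<alpha> * q_pow p k) + q p * (\<alpha> * q_pow p (- k))) = \<alpha> * cas_eig p (k - 1)"
    using q_pow_add[of p 1 "- k"] by (simp add: cas_eig_def q_pow_diff divide_inverse algebra_simps)
  finally show ?thesis by simp
qed

lemma FE_wt:
  assumes "wt \<alpha> k x" "\<alpha> * \<alpha> = 1"
  shows "F * (E * x) = Cas * x - (\<alpha> * cas_eig p (k + 1)) *s x"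
proof -
  have "Cas * x = F * (E * x) + (1 / (q p - inverse (q p)) ^ 2 * (q p * (\<alpha> * q_pow p k) + inverse (q p) * (\<alpha> * q_pow p (- k)))) *s x"
    using K'_wt[OF assms] assms(1)
    unfolding Cas_alt wt_def
    by (simp add: distrib_right mult.assoc vs.scale_left_distrib vs.scale_right_distrib distrib_left)
  also have "1 / (q p - inverse (q p)) ^ 2 * (q p * (\<alpha> * q_pow p k) + inverse (q p) * (\<alpha> * q_pow p (- k))) = \<alpha> * cas_eig p (k + 1)"
    using q_pow_diff[of p "- 1" k] q_pow_minus[of p 1] by (simp add: cas_eig_def q_pow_add q_pow_minus divide_inverse algebra_simps)
  finally show ?thesis by simp
qed

lemma FE_index:
  assumes "wt \<alpha> (s - 1 - 2 * i) x" "\<alpha> * \<alpha> = 1"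
  shows "F * (E * x) = Z \<alpha> s * x + beta p \<alpha> s i *s x"
proof -
  have 1: "s - 1 - 2 * i + 1 = s - 2 * i" by simp
  have "beta p \<alpha> s i = \<alpha> * cas_eig p s - \<alpha> * cas_eig p (s - 2 * i)"
    using cas_eig_diff[of p s i] by (simp add: beta_def algebra_simps)
  then show ?thesis
    unfolding FE_wt[OF assms] Z_def 1 by (simp add: left_diff_distrib vs.scale_left_diff_distrib)
qed

lemma EF_index:
  assumes "wt \<alpha> (s - 1 - 2 * i) x" "\<alpha> * \<alpha> = 1"
  shows "E * (F * x) = Z \<alpha> s * x + beta p \<alpha> s (i + 1) *s x"
proof -
  have 1: "s - 1 - 2 * i - 1 = s - 2 * (i + 1)" by simp
  have "beta p \<alpha> s (i + 1) = \<alpha> * cas_eig p s - \<alpha> * cas_eig p (s - 2 * (i + 1))"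
    using cas_eig_diff[of p s "i + 1"] by (simp add: beta_def algebra_simps)
  then show ?thesis
    unfolding EF_wt[OF assms] Z_def 1 by (simp add: left_diff_distrib vs.scale_left_diff_distrib)
qed

text \<open>The operator (Z + f 0) ... (Z + f (n - 1)) applied to \<open>x\<close>; the factors
  commute, as they are polynomials in Z.\<close>

primrec Z_prod :: "complex \<Rightarrow> int \<Rightarrow> (nat \<Rightarrow> complex) \<Rightarrow> nat \<Rightarrow> 'r \<Rightarrow> 'r" where
  "Z_prod \<alpha> s f 0 x = x"
| "Z_prod \<alpha> s f (Suc n) x = Z \<alpha> s * Z_prod \<alpha> s f n x + f n *s Z_prod \<alpha> s f n x"

lemma Z_prod_E_pow: "Z_prod \<alpha> s f n (E ^ m * x) = E ^ m * Z_prod \<alpha> s f n x"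
  by (induction n) (simp_all add: distrib_left)

lemma EF_pow:
  assumes "wt \<alpha> (s - 1 - 2 * i) x" "\<alpha> * \<alpha> = 1"
  shows "E ^ n * (F ^ n * x) = Z_prod \<alpha> s (\<lambda>j. beta p \<alpha> s (i + 1 + int j)) n x"
proof (induction n)
  case (Suc n)
  have w: "wt \<alpha> (s - 1 - 2 * (i + int n)) (F ^ n * x)"
    using wt_F_pow[OF assms(1), of n] by (simp add: algebra_simps)
  have "E ^ Suc n * (F ^ Suc n * x) = E ^ n * (E * (F * (F ^ n * x)))"
    by (simp only: power_Suc2[of E] power_Suc[of F] mult.assoc)
  also have "\<dots> = Z \<alpha> s * (E ^ n * (F ^ n * x)) + beta p \<alpha> s (i + 1 + int n) *s (E ^ n * (F ^ n * x))"
    unfolding EF_index[OF w assms(2)] by (simp add: distrib_left add_ac)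
  finally show ?case by (simp add: Suc)
qed simp

lemma FE_pow:
  assumes "wt \<alpha> (s - 1 - 2 * i) x" "\<alpha> * \<alpha> = 1"
  shows "F ^ n * (E ^ n * x) = Z_prod \<alpha> s (\<lambda>j. beta p \<alpha> s (i - int j)) n x"
proof (induction n)
  case (Suc n)
  have w: "wt \<alpha> (s - 1 - 2 * (i - int n)) (E ^ n * x)"
    using wt_E_pow[OF assms(1), of n] by (simp add: algebra_simps)
  have "F ^ Suc n * (E ^ Suc n * x) = F ^ n * (F * (E * (E ^ n * x)))"
    by (simp only: power_Suc2[of F] power_Suc[of E] mult.assoc)
  also have "\<dots> = Z \<alpha> s * (F ^ n * (E ^ n * x)) + beta p \<alpha> s (i - int n) *s (F ^ n * (E ^ n * x))"
    unfolding FE_index[OF w assms(2)] by (simp add: distrib_left)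
  finally show ?case by (simp add: Suc)
qed simp

text \<open>Every term of the expanded product with two factors Z kills \<open>x\<close>, so only
  the constant and the linear coefficient remain.\<close>

lemma Z_prod_nilpotent:
  assumes "Z \<alpha> s * (Z \<alpha> s * x) = 0"
  shows "Z_prod \<alpha> s f n x = prod f {..<n} *s x + prod_omit f {..<n} *s (Z \<alpha> s * x)"
proof (induction n)
  case (Suc n)
  then show ?case
    using assms prod_omit_insert[of "{..<n}" n f]
    by (simp add: lessThan_Suc distrib_left vs.scale_left_distrib vs.scale_right_distrib algebra_simps)
qed simp

lemma Z_prod_kernel:
  assumes "Z \<alpha> s * x = 0"
  shows "Z_prod \<alpha> s f n x = prod f {..<n} *s x"
  using Z_prod_nilpotent[of \<alpha> s x f n] assms by simp

text \<open>The element \<open>v\<^sup>\<alpha>(s,t)\<close> for \<open>k = s - 2t + 1\<close>.\<close>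

definition V :: "complex \<Rightarrow> int \<Rightarrow> 'r" where
  "V \<alpha> k = (\<Sum>l<2 * p. (\<alpha> * q_pow p (- k)) ^ l *s K ^ l)"

lemma sign_qz_power:
  assumes "\<alpha> * \<alpha> = 1"
  shows "(\<alpha> * q_pow p k) ^ (2 * p) = 1"
proof -
  have "q_pow p k ^ (2 * p) = 1"
    unfolding q_pow_power q_pow_eq_1_iff[OF p0] by simp
  moreover have "\<alpha> ^ (2 * p) = 1"
    using assms by (simp add: power_mult power2_eq_square)
  ultimately show ?thesis
    by (simp add: power_mult_distrib)
qed

text \<open>Multiplication by K rotates the sum cyclically, because K^(2p) and the 2p-th power of
  the coefficient are both 1. Up to the factor 2p, V is the projector onto this eigenvalue of
  K.\<close>

lemma wt_V:
  assumes "\<alpha> * \<alpha> = 1"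
  shows "wt \<alpha> k (V \<alpha> k)"
proof -
  define c where "c = \<alpha> * q_pow p (- k)"
  have c: "\<alpha> * q_pow p k * c = 1"
    using sign_q_pow[OF assms, of k] by (simp add: c_def mult_ac)
  have c2p: "c ^ (2 * p) = 1"
    unfolding c_def by (rule sign_qz_power[OF assms])
  have "K * V \<alpha> k = (\<Sum>l<2 * p. c ^ l *s K ^ Suc l)"
    by (simp add: V_def c_def sum_distrib_left)
  also have "\<dots> = (\<alpha> * q_pow p k) *s (\<Sum>l<2 * p. c ^ Suc l *s K ^ Suc l)"
    using c by (simp add: vs.scale_sum_right flip: mult.assoc)
  also have "(\<Sum>l<2 * p. c ^ Suc l *s K ^ Suc l) = (\<Sum>l<2 * p. c ^ l *s K ^ l)"
    using sum.lessThan_Suc_shift[of "\<lambda>l. c ^ l *s K ^ l" "2 * p"]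
      sum.lessThan_Suc[of "\<lambda>l. c ^ l *s K ^ l" "2 * p"] c2p K_power_2p
    by (simp add: algebra_simps)
  finally show ?thesis
    by (simp add: wt_def V_def c_def)
qed

lemma V_mult:
  assumes "wt \<beta> j x" "\<alpha> * \<alpha> = 1"
  shows "V \<alpha> k * x = (\<Sum>l<2 * p. (\<alpha> * q_pow p (- k) * (\<beta> * q_pow p j)) ^ l) *s x"
proof -
  have "K ^ l * x = (\<beta> * q_pow p j) ^ l *s x" for l
  proof (induction l)
    case (Suc l)
    have "K ^ Suc l * x = K * (K ^ l * x)" by (simp add: mult.assoc)
    with Suc show ?case using assms(1) by (simp add: wt_def mult_ac)
  qed simp
  then show ?thesis
    by (simp add: V_def sum_distrib_right vs.scale_sum_left power_mult_distrib)
qed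

text \<open>All 2p summands act as the identity; this is the 2p in \<open>gamma\<close> and
  \<open>delta\<close>.\<close>

lemma V_mult_same:
  assumes "wt \<alpha> k x" "\<alpha> * \<alpha> = 1"
  shows "V \<alpha> k * x = (2 * of_nat p) *s x"
proof -
  show ?thesis
    unfolding V_mult[OF assms] sign_q_pow[OF assms(2)] by simp
qed

text \<open>The scalar is the geometric sum over all powers of a 2p-th root of unity different from
  1.\<close>

lemma V_mult_zero:
  assumes "wt \<beta> j x" "\<alpha> * \<alpha> = 1" "\<beta> * \<beta> = 1" "\<alpha> * q_pow p k \<noteq> \<beta> * q_pow p j"
  shows "V \<alpha> k * x = 0"
proof -
  define c where "c = \<alpha> * q_pow p (- k) * (\<beta> * q_pow p j)"
  have "c \<noteq> 1"
  proof
    assume "c = 1"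
    then have "\<alpha> * q_pow p k = (\<alpha> * q_pow p (- k) * (\<alpha> * q_pow p k)) * (\<beta> * q_pow p j)"
      by (simp add: c_def mult_ac)
    with assms(4) show False
      unfolding sign_q_pow[OF assms(2)] by simp
  qed
  have "c = (\<alpha> * \<beta>) * q_pow p (j - k)"
    by (simp add: c_def q_pow_diff q_pow_minus)
  moreover have "(\<alpha> * \<beta>) * (\<alpha> * \<beta>) = (\<alpha> * \<alpha>) * (\<beta> * \<beta>)"
    by (simp only: mult_ac)
  ultimately have "c ^ (2 * p) = 1"
    using assms sign_qz_power[of "\<alpha> * \<beta>" "j - k"] by simp
  with \<open>c \<noteq> 1\<close> have "(\<Sum>l<2 * p. c ^ l) = 0"
    by (simp add: sum_gp_strict)
  then show ?thesis
    by (simp add: V_mult[OF assms(1,2)] c_def)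
qed

end

context uq_alg
begin

section \<open>Highest weight vectors\<close>

lemma E_kill: "n \<ge> p \<Longrightarrow> E ^ n * x = 0"
  using power_add[of E p "n - p"] by (simp add: E_power_p)

lemma F_kill: "n \<ge> p \<Longrightarrow> F ^ n * x = 0"
  using power_add[of F p "n - p"] by (simp add: F_power_p)

lemma E_E_pow: "E ^ m * (E ^ n * x) = E ^ (m + n) * x"
  by (simp add: power_add mult.assoc)

lemma F_F_pow: "F ^ m * (F ^ n * x) = F ^ (m + n) * x"
  by (simp add: power_add mult.assoc)

text \<open>With \<open>N = p - m - 1\<close>, the summand of \<open>b\<^sub>0\<close> for \<open>m\<close> is \<open>\<mu>\<^sub>m W\<^sub>N\<close>, and \<open>a\<^sub>0 = W\<^sub>p\<^sub>-\<^sub>1\<close>.\<close>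

definition W :: "complex \<Rightarrow> nat \<Rightarrow> nat \<Rightarrow> nat \<Rightarrow> 'r" where
  "W \<alpha> s t N = E ^ N * (F ^ (N + 1 - t) * V \<alpha> (int s - 2 * int t + 1))"

text \<open>Mind the shift by one: this is the factor gained from E^j F^j to E^(j+1) F^(j+1) on a
  vector of weight \<alpha> q^(s-1). Its zero sits at j = s - 1.\<close>

definition beta_seq :: "complex \<Rightarrow> nat \<Rightarrow> nat \<Rightarrow> complex" where
  "beta_seq \<alpha> s j = beta p \<alpha> (int s) (1 + int j)"

definition a0 :: "complex \<Rightarrow> nat \<Rightarrow> nat \<Rightarrow> 'r" where
  "a0 \<alpha> s t = W \<alpha> s t (p - 1)"

definition b0 :: "complex \<Rightarrow> nat \<Rightarrow> nat \<Rightarrow> 'r" where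
  "b0 \<alpha> s t = (\<Sum>N=s - 1..<p - 1. prod (beta_seq \<alpha> s) {N + 1..<p - 1} *s W \<alpha> s t N)"

lemma beta_seq_zero: "1 \<le> s \<Longrightarrow> beta_seq \<alpha> s (s - 1) = 0"
  by (simp add: beta_seq_def)

lemma wt_W:
  assumes "\<alpha> * \<alpha> = 1" "t \<le> N + 1"
  shows "wt \<alpha> (int s - 1) (W \<alpha> s t N)"
  unfolding W_def
  using wt_E_pow[OF wt_F_pow[OF wt_V[OF assms(1)]], of "int s - 2 * int t + 1" "N + 1 - t" N] assms(2)
  by (simp add: of_nat_diff algebra_simps)

text \<open>\<open>W (Suc N)\<close> arises from \<open>W N\<close> by inserting E F behind E^N, and
  there E F acts as Z + \<open>beta_seq \<alpha> s N\<close>.\<close>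

lemma Z_W:
  assumes "\<alpha> * \<alpha> = 1" "t \<le> N + 1"
  shows "Z \<alpha> (int s) * W \<alpha> s t N = W \<alpha> s t (Suc N) - beta_seq \<alpha> s N *s W \<alpha> s t N"
proof -
  define y where "y = F ^ (N + 1 - t) * V \<alpha> (int s - 2 * int t + 1)"
  have "wt \<alpha> (int s - 1 - 2 * int N) y"
    using wt_F_pow[OF wt_V[OF assms(1)], of "int s - 2 * int t + 1" "N + 1 - t"] assms(2)
    by (simp add: y_def of_nat_diff algebra_simps)
  from EF_index[OF this assms(1)] have 1: "E * (F * y) = Z \<alpha> (int s) * y + beta_seq \<alpha> s N *s y"
    by (simp add: beta_seq_def add_ac)
  have "W \<alpha> s t (Suc N) = E ^ N * (E * (F * y))"
  proof -
    have "Suc N + 1 - t = Suc (N + 1 - t)"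
      using assms(2) by simp
    then show ?thesis
      by (simp only: W_def y_def power_Suc2[of E] power_Suc[of F] mult.assoc)
  qed
  also have "\<dots> = Z \<alpha> (int s) * (E ^ N * y) + beta_seq \<alpha> s N *s (E ^ N * y)"
    unfolding 1 by (simp add: distrib_left)
  finally show ?thesis by (simp add: W_def y_def)
qed

text \<open>A Horner step: raising the upper end multiplies the old sum by the new factor and adds
  one term.\<close>

lemma sum_prod_step:
  fixes f :: "nat \<Rightarrow> complex" and w :: "nat \<Rightarrow> 'r"
  assumes "m \<le> M"
  shows "(\<Sum>N=m..<Suc M. prod f {N + 1..<Suc M} *s w N)
    = f M *s (\<Sum>N=m..<M. prod f {N + 1..<M} *s w N) + w M"
proof -
  have "(\<Sum>N=m..<M. prod f {N + 1..<Suc M} *s w N) = (\<Sum>N=m..<M. f M *s prod f {N + 1..<M} *s w N)"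
    by (intro sum.cong) (auto simp: prod.atLeastLessThan_Suc mult.commute)
  then show ?thesis
    using assms by (simp add: vs.scale_sum_right)
qed

lemma Z_b0:
  assumes "\<alpha> * \<alpha> = 1" "1 \<le> t" "t \<le> s" "s < p"
  shows "Z \<alpha> (int s) * b0 \<alpha> s t = a0 \<alpha> s t"
proof -
  \<comment> \<open>The upper end is made variable for the induction. At M = s the sum is the single
    term \<open>W (s - 1)\<close>, whose factor \<open>beta_seq\<close> is zero, so Z maps it to
    \<open>W s\<close>; afterwards the terms \<open>f M * W M\<close> cancel.\<close>
  have "Z \<alpha> (int s) * (\<Sum>N=s - 1..<M. prod (beta_seq \<alpha> s) {N + 1..<M} *s W \<alpha> s t N) = W \<alpha> s t M"
    if "s \<le> M" for M
    using that
  proof (induction M rule: dec_induct)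
    case base
    have "{s - 1..<s} = {s - 1}" using assms by auto
    then show ?case
      using Z_W[OF assms(1), of t "s - 1" s] assms beta_seq_zero[of s \<alpha>] by simp
  next
    case (step M)
    then have "s - 1 \<le> M" by simp
    then show ?case
      using Z_W[OF assms(1), of t M s] step assms
      unfolding sum_prod_step[OF \<open>s - 1 \<le> M\<close>] distrib_left smul_mult_right step.IH
      by simp
  qed
  from this[of "p - 1"] show ?thesis
    using assms by (simp add: b0_def a0_def)
qed

lemma wt_a0: "\<alpha> * \<alpha> = 1 \<Longrightarrow> t \<le> p \<Longrightarrow> wt \<alpha> (int s - 1) (a0 \<alpha> s t)"
  unfolding a0_def by (rule wt_W) simp_all

lemma wt_b0: "\<alpha> * \<alpha> = 1 \<Longrightarrow> t \<le> s \<Longrightarrow> wt \<alpha> (int s - 1) (b0 \<alpha> s t)"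
  unfolding b0_def by (intro wt_sum wt_smul wt_W) auto

lemma E_a0: "E * a0 \<alpha> s t = 0"
  using E_kill[of p] p1 power_Suc[of E "p - 1"]
  by (simp add: a0_def W_def flip: mult.assoc)

text \<open>E kills \<open>a0\<close> by E^p = 0, and on this weight F E = Z + \<open>beta\<close>
  at index 0, where \<open>beta\<close> vanishes.\<close>

lemma Z_a0:
  assumes "\<alpha> * \<alpha> = 1" "t \<le> p"
  shows "Z \<alpha> (int s) * a0 \<alpha> s t = 0"
  using FE_index[of \<alpha> "int s" 0 "a0 \<alpha> s t"] wt_a0[OF assms] assms by (simp add: E_a0)

lemma E_b0:
  assumes "1 \<le> s" "s \<le> p" 
  shows "E ^ (p - s + 1) * b0 \<alpha> s t = 0"
  unfolding b0_def W_def sum_distrib_left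
proof (intro sum.neutral ballI)
  fix N assume "N \<in> {s - 1..<p - 1}"
  then have "p \<le> p - s + 1 + N" using assms by auto
  then show "E ^ (p - s + 1) * (prod (beta_seq \<alpha> s) {N + 1..<p - 1} *s
      (E ^ N * (F ^ (N + 1 - t) * V \<alpha> (int s - 2 * int t + 1)))) = 0"
    unfolding smul_mult_right E_E_pow by (simp only: E_kill vs.scale_zero_right)
qed

text \<open>F^s E^s and E^s F^s act here by the same product of factors, so F^s can be moved through
  E^(p-1) to the right, where it meets F^(p-t) and gives zero because t \<le> s.\<close>

lemma F_a0:
  assumes "\<alpha> * \<alpha> = 1" "1 \<le> t" "t \<le> s" "s \<le> p"
  shows "F ^ s * a0 \<alpha> s t = 0"
proof (cases "s = p")
  case True
  then show ?thesis by (simp add: F_kill)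
next
  case False
  then have s: "s < p" using assms by simp
  define y where "y = F ^ (p - t) * V \<alpha> (int s - 2 * int t + 1)"
  have wy: "wt \<alpha> (int s - 1 - 2 * int (p - 1)) y"
    using wt_F_pow[OF wt_V[OF assms(1)], of "int s - 2 * int t + 1" "p - t"] assms p1
    by (simp add: y_def of_nat_diff algebra_simps)
  have wE: "wt \<alpha> (int s - 1 - 2 * int s) (E ^ (p - 1 - s) * y)"
    using wt_E_pow[OF wy, of "p - 1 - s"] s by (simp add: of_nat_diff algebra_simps)
  have "F ^ s * a0 \<alpha> s t = F ^ s * (E ^ s * (E ^ (p - 1 - s) * y))"
    using assms s by (simp add: a0_def W_def y_def E_E_pow)
  also have "\<dots> = Z_prod \<alpha> (int s) (\<lambda>j. beta p \<alpha> (int s) (int s - int j)) s (E ^ (p - 1 - s) * y)"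
    by (rule FE_pow[OF wE assms(1)])
  \<comment> \<open>The reflection \<open>beta (s - j) = beta j\<close> together with the period p
    identifies the factors of F^s E^s with those of E^s F^s on \<open>y\<close>, which has index p -
    1.\<close>
  also have "(\<lambda>j. beta p \<alpha> (int s) (int s - int j)) = (\<lambda>j. beta p \<alpha> (int s) (int (p - 1) + 1 + int j))"
  proof
    fix j
    have "int (p - 1) + 1 + int j = int p + int j"
      using p1 by simp
    then show "beta p \<alpha> (int s) (int s - int j) = beta p \<alpha> (int s) (int (p - 1) + 1 + int j)"
      by (simp only: beta_p_plus[OF p0]) (simp add: beta_def)
  qed
  also have "Z_prod \<alpha> (int s) \<dots> s (E ^ (p - 1 - s) * y) = E ^ (p - 1 - s) * (E ^ s * (F ^ s * y))"
    unfolding Z_prod_E_pow EF_pow[OF wy assms(1)] ..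
  also have "F ^ s * y = 0"
    using assms by (simp add: y_def F_F_pow F_kill)
  finally show ?thesis by simp
qed

text \<open>The index s - 1 of the zero factor is removed. For s = p it lies outside the range, so
  the same formula gives the normalization of \<open>A_top\<close>.\<close>

definition norm_gamma :: "complex \<Rightarrow> nat \<Rightarrow> complex" where
  "norm_gamma \<alpha> s = 2 * of_nat p * prod (beta_seq \<alpha> s) ({..<p - 1} - {s - 1})"

definition norm_delta :: "complex \<Rightarrow> nat \<Rightarrow> complex" where
  "norm_delta \<alpha> s = 2 * of_nat p * prod_omit (beta_seq \<alpha> s) ({..<p - 1} - {s - 1})"

lemma EF_pow_0:
  assumes "wt \<alpha> (int s - 1) x" "\<alpha> * \<alpha> = 1" "Z \<alpha> (int s) * (Z \<alpha> (int s) * x) = 0"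
  shows "E ^ n * (F ^ n * x)
    = prod (beta_seq \<alpha> s) {..<n} *s x + prod_omit (beta_seq \<alpha> s) {..<n} *s (Z \<alpha> (int s) * x)"
proof -
  have "(\<lambda>j. beta p \<alpha> (int s) (0 + 1 + int j)) = beta_seq \<alpha> s"
    by (simp add: beta_seq_def fun_eq_iff)
  then show ?thesis
    using EF_pow[of \<alpha> "int s" 0 x n] Z_prod_nilpotent[OF assms(3)] assms by simp
qed

text \<open>F^(t-1) x has exactly the weight that V selects, and the powers of F add up to N, so t
  disappears from the result.\<close>

lemma W_action:
  assumes "wt \<alpha> (int s - 1) x" "\<alpha> * \<alpha> = 1" "1 \<le> t" "t \<le> N + 1"
  shows "W \<alpha> s t N * (F ^ (t - 1) * x) = (2 * of_nat p) *s (E ^ N * (F ^ N * x))"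
proof -
  have "wt \<alpha> (int s - 2 * int t + 1) (F ^ (t - 1) * x)"
    using wt_F_pow[OF assms(1), of "t - 1"] assms by (simp add: of_nat_diff algebra_simps)
  from V_mult_same[OF this assms(2)] show ?thesis
    using assms unfolding W_def by (simp add: mult.assoc F_F_pow)
qed

lemma b0_action:
  assumes x: "wt \<alpha> (int s - 1) x" and \<alpha>: "\<alpha> * \<alpha> = 1"
    and Z: "Z \<alpha> (int s) * (Z \<alpha> (int s) * x) = 0"
    and t: "1 \<le> t" "t \<le> s" "s < p"
  shows "b0 \<alpha> s t * (F ^ (t - 1) * x) = norm_gamma \<alpha> s *s x + norm_delta \<alpha> s *s (Z \<alpha> (int s) * x)"
proof -
  have f0: "beta_seq \<alpha> s (s - Suc 0) = 0"
    using beta_seq_zero[of s \<alpha>] t by simp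
  have "(\<Sum>N=s - 1..<M. prod (beta_seq \<alpha> s) {N + 1..<M} *s (E ^ N * (F ^ N * x)))
    = prod (beta_seq \<alpha> s) ({..<M} - {s - 1}) *s x + prod_omit (beta_seq \<alpha> s) ({..<M} - {s - 1}) *s (Z \<alpha> (int s) * x)"
    if "s \<le> M" for M
    using that
  proof (induction M rule: dec_induct)
    case base
    have *: "{s - 1..<s} = {s - 1}" "{..<s} - {s - 1} = {..<s - 1}" using t by auto
    then show ?case
      by (simp add: EF_pow_0[OF x \<alpha> Z])
  next
    case (step M)
    have 1: "{..<Suc M} - {s - 1} = insert M ({..<M} - {s - 1})" using step t by auto
    \<comment> \<open>For M beyond s - 1 the product contains the zero factor, so E^M F^M x is a
      multiple of Z x only. It supplies the extra summand of
      \<open>prod_omit_insert\<close>.\<close>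
    have "prod (beta_seq \<alpha> s) {..<M} = 0" "prod_omit (beta_seq \<alpha> s) {..<M} = prod (beta_seq \<alpha> s) ({..<M} - {s - 1})"
      using step t f0 by (auto intro!: prod_omit_zero prod_zero bexI[of _ "s - 1"])
    then have "E ^ M * (F ^ M * x) = prod (beta_seq \<alpha> s) ({..<M} - {s - 1}) *s (Z \<alpha> (int s) * x)"
      by (simp add: EF_pow_0[OF x \<alpha> Z])
    then show ?case
      using step t unfolding 1
      by (subst sum_prod_step) (simp_all add: prod_omit_insert vs.scale_right_distrib vs.scale_left_distrib add_ac)
  qed
  note * = this[of "p - 1"]
  have "b0 \<alpha> s t * (F ^ (t - 1) * x)
    = (2 * of_nat p) *s (\<Sum>N=s - 1..<p - 1. prod (beta_seq \<alpha> s) {N + 1..<p - 1} *s (E ^ N * (F ^ N * x)))"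
    unfolding b0_def sum_distrib_right vs.scale_sum_right
    using t by (intro sum.cong) (auto simp: W_action[OF x \<alpha> t(1), simplified] mult_ac)
  then show ?thesis
    using t * by (simp add: norm_gamma_def norm_delta_def vs.scale_right_distrib)
qed

text \<open>Here the product runs over all j < p - 1 including the zero at s - 1, which leaves only
  the term linear in Z.\<close>

lemma a0_action:
  assumes x: "wt \<alpha> (int s - 1) x" and \<alpha>: "\<alpha> * \<alpha> = 1"
    and Z: "Z \<alpha> (int s) * (Z \<alpha> (int s) * x) = 0"
    and t: "1 \<le> t" "t \<le> s" "s < p"
  shows "a0 \<alpha> s t * (F ^ (t - 1) * x) = norm_gamma \<alpha> s *s (Z \<alpha> (int s) * x)"
proof -
  have "s - 1 < p - 1" "beta_seq \<alpha> s (s - Suc 0) = 0" using beta_seq_zero[of s \<alpha>] t by simp_all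
  then have "prod (beta_seq \<alpha> s) {..<p - 1} = 0"
    "prod_omit (beta_seq \<alpha> s) {..<p - 1} = prod (beta_seq \<alpha> s) ({..<p - 1} - {s - 1})"
    using t by (auto intro!: prod_omit_zero prod_zero bexI[of _ "s - 1"])
  note * = this
  have "t \<le> p - 1 + 1" using t by simp
  show ?thesis
    unfolding a0_def W_action[OF x \<alpha> t(1) \<open>t \<le> p - 1 + 1\<close>] EF_pow_0[OF x \<alpha> Z] * by (simp add: norm_gamma_def)
qed

lemma a0_action_top:
  assumes x: "wt \<alpha> (int p - 1) x" and \<alpha>: "\<alpha> * \<alpha> = 1"
    and Z: "Z \<alpha> (int p) * x = 0"
    and t: "1 \<le> t" "t \<le> p"
  shows "a0 \<alpha> p t * (F ^ (t - 1) * x) = norm_gamma \<alpha> p *s x"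
proof -
  have "{..<p - 1} - {p - 1} = {..<p - 1}" by auto
  then show ?thesis
    using t W_action[OF x \<alpha> t(1), of "p - 1"] by (simp add: a0_def EF_pow_0[OF x \<alpha>] norm_gamma_def Z)
qed

text \<open>The denominator of x_k, written with the \<open>beta\<close> factors of the
  partner.\<close>

definition x_norm :: "complex \<Rightarrow> nat \<Rightarrow> nat \<Rightarrow> complex" where
  "x_norm \<alpha> s k = (\<Prod>i=k + 1..p - s - 1. beta p (- \<alpha>) (int (p - s)) (int i))"

definition x0 :: "complex \<Rightarrow> nat \<Rightarrow> nat \<Rightarrow> 'r" where
  "x0 \<alpha> s t = (1 / x_norm \<alpha> s 0) *s (E ^ (p - s) * b0 \<alpha> s t)"

definition y0 :: "complex \<Rightarrow> nat \<Rightarrow> nat \<Rightarrow> 'r" where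
  "y0 \<alpha> s t = F ^ s * b0 \<alpha> s t"

lemma x_norm_nonzero: "\<alpha> * \<alpha> = 1 \<Longrightarrow> s < p \<Longrightarrow> x_norm \<alpha> s k \<noteq> 0"
proof -
  assume "\<alpha> * \<alpha> = 1" "s < p"
  then have "beta p (- \<alpha>) (int (p - s)) (int i) \<noteq> 0" if "i \<in> {k + 1..p - s - 1}" for i
    using that p2 by (intro beta_nonzero) auto
  then show ?thesis
    unfolding x_norm_def by (subst prod_zero_iff) auto
qed

text \<open>The right-hand side is how x_k is given, with a lower power of E. Since Z b_0 = a_0 and
  E a_0 = 0, Z kills E^(p-s-k) b_0; hence F^k E^k acts on it by a scalar, the product of the
  partner's factors 1, ..., k, which is the quotient of the two denominators.\<close>

lemma F_x0:
  assumes \<alpha>: "\<alpha> * \<alpha> = 1" and t: "1 \<le> t" "t \<le> s" "s < p" and k: "k < p - s"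
  shows "F ^ k * x0 \<alpha> s t = (1 / x_norm \<alpha> s k) *s (E ^ (p - s - k) * b0 \<alpha> s t)"
proof -
  define y where "y = E ^ (p - s - k) * b0 \<alpha> s t"
  have wy: "wt \<alpha> (int s - 1 - 2 * (- int (p - s - k))) y"
    using wt_E_pow[OF wt_b0[OF \<alpha> t(2)], of "p - s - k"] by (simp add: y_def)
  have "Z \<alpha> (int s) * y = E ^ (p - s - k) * a0 \<alpha> s t"
    using Z_b0[OF \<alpha> t] by (simp add: y_def)
  also have "\<dots> = 0"
    using k power_Suc2[of E "p - s - k - 1"] E_a0 by (simp add: mult.assoc Suc_diff_Suc)
  finally have Zy: "Z \<alpha> (int s) * y = 0" .
  have "F ^ k * (E ^ k * y) = Z_prod \<alpha> (int s) (\<lambda>j. beta p \<alpha> (int s) (- int (p - s - k) - int j)) k y"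
    by (rule FE_pow[OF wy \<alpha>])
  also have "\<dots> = (\<Prod>j<k. beta p \<alpha> (int s) (- int (p - s - k) - int j)) *s y"
    by (rule Z_prod_kernel[OF Zy])
  also have "(\<Prod>j<k. beta p \<alpha> (int s) (- int (p - s - k) - int j))
    = (\<Prod>i=1..k. beta p (- \<alpha>) (int (p - s)) (int i))"
  proof (rule prod.reindex_bij_witness[of _ "\<lambda>i. k - i" "\<lambda>j. k - j"])
    fix j assume "j \<in> {..<k}"
    then have j: "j < k" by simp
    have "beta p \<alpha> (int s) (- int (p - s - k) - int j) = beta p \<alpha> (int s) (- (int p - int s - int (k - j)))"
      using j k t by (intro arg_cong[where f = "beta p \<alpha> (int s)"]) (simp add: of_nat_diff)
    also have "\<dots> = beta p (- \<alpha>) (int (p - s)) (int (k - j))"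
      using t by (subst beta_minus[OF p0]) (simp add: beta_def of_nat_diff mult_ac)
    finally show "beta p (- \<alpha>) (int (p - s)) (int (k - j)) = beta p \<alpha> (int s) (- int (p - s - k) - int j)" ..
  qed auto
  also have "\<dots> = x_norm \<alpha> s 0 / x_norm \<alpha> s k"
  proof -
    have "{0 + 1..p - s - 1} = {1..k} \<union> {k + 1..p - s - 1}" using k by auto
    then have "x_norm \<alpha> s 0 = (\<Prod>i=1..k. beta p (- \<alpha>) (int (p - s)) (int i)) * x_norm \<alpha> s k"
      unfolding x_norm_def by (simp add: prod.union_disjoint)
    then show ?thesis using x_norm_nonzero[OF \<alpha> t(3)] by simp
  qed
  finally have "F ^ k * (E ^ k * y) = (x_norm \<alpha> s 0 / x_norm \<alpha> s k) *s y" .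
  moreover have "E ^ k * y = E ^ (p - s) * b0 \<alpha> s t"
    using k by (simp add: y_def E_E_pow)
  ultimately show ?thesis
    using x_norm_nonzero[OF \<alpha> t(3)] by (simp add: x0_def y_def)
qed

lemma Z_flip_nat: "s \<le> p \<Longrightarrow> Z (- \<alpha>) (int (p - s)) = Z \<alpha> (int s)"
  using Z_flip[of \<alpha> "int s"] by (simp add: of_nat_diff)

text \<open>E^(p-s) and F^s carry weight s - 1 to the exponents 2p - s - 1 and -s - 1. Both become p
  - s - 1 once the sign is flipped, so \<open>x0\<close> and \<open>y0\<close> have the highest
  weight of the partner.\<close>

lemma wt_x0:
  assumes "\<alpha> * \<alpha> = 1" "t \<le> s" "s \<le> p"
  shows "wt (- \<alpha>) (int (p - s) - 1) (x0 \<alpha> s t)"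
proof -
  have "wt \<alpha> (int s - 1 + 2 * int (p - s)) (x0 \<alpha> s t)"
    unfolding x0_def using assms by (intro wt_smul wt_E_pow wt_b0)
  from wt_flip_minus[OF this] show ?thesis
    using assms by (simp add: of_nat_diff algebra_simps)
qed

lemma wt_y0:
  assumes "\<alpha> * \<alpha> = 1" "t \<le> s" "s \<le> p"
  shows "wt (- \<alpha>) (int (p - s) - 1) (y0 \<alpha> s t)"
proof -
  have "wt \<alpha> (int s - 1 - 2 * int s) (y0 \<alpha> s t)"
    unfolding y0_def using assms by (intro wt_F_pow wt_b0)
  from wt_flip[OF this] show ?thesis
    using assms by (simp add: of_nat_diff algebra_simps)
qed

lemma E_x0:
  assumes "1 \<le> s" "s \<le> p"
  shows "E * x0 \<alpha> s t = 0"
  using E_b0[OF assms, of \<alpha> t] by (simp add: x0_def mult.assoc)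

lemma Z_x0:
  assumes "\<alpha> * \<alpha> = 1" "1 \<le> s" "t \<le> s" "s \<le> p"
  shows "Z \<alpha> (int s) * x0 \<alpha> s t = 0"
  using FE_index[of "- \<alpha>" "int (p - s)" 0 "x0 \<alpha> s t"] wt_x0[of \<alpha> t s] assms
  by (simp add: E_x0 Z_flip_nat del: of_nat_diff)

lemma Z_y0:
  assumes "\<alpha> * \<alpha> = 1" "1 \<le> t" "t \<le> s" "s < p"
  shows "Z \<alpha> (int s) * y0 \<alpha> s t = 0"
  using assms by (simp add: y0_def Z_b0 F_a0)

text \<open>The factor at j = 0 of F^(p-s) E^(p-s) vanishes, so only the Z term survives, and Z b_0
  = a_0. The remaining factors cancel the denominator of \<open>x0\<close>. This gives the products
  Y X = A.\<close>

lemma F_s_x0: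
  assumes \<alpha>: "\<alpha> * \<alpha> = 1" and t: "1 \<le> t" "t \<le> s" "s < p"
  shows "F ^ (p - s) * x0 \<alpha> s t = a0 \<alpha> s t"
proof -
  have "F ^ (p - s) * (E ^ (p - s) * b0 \<alpha> s t) = Z_prod \<alpha> (int s) (\<lambda>j. beta p \<alpha> (int s) (0 - int j)) (p - s) (b0 \<alpha> s t)"
    using FE_pow[of \<alpha> "int s" 0 "b0 \<alpha> s t" "p - s"] wt_b0[OF \<alpha> t(2)] \<alpha> by simp
  also have "\<dots> = prod_omit (\<lambda>j. beta p \<alpha> (int s) (0 - int j)) {..<p - s} *s a0 \<alpha> s t"
    using t Z_b0[OF \<alpha> t] Z_a0[OF \<alpha>, of t s]
    by (subst Z_prod_nilpotent) (auto intro!: prod_zero bexI[of _ 0])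
  also have "prod_omit (\<lambda>j. beta p \<alpha> (int s) (0 - int j)) {..<p - s} = prod (\<lambda>j. beta p \<alpha> (int s) (0 - int j)) ({..<p - s} - {0})"
    using t by (intro prod_omit_zero) auto
  also have "\<dots> = x_norm \<alpha> s 0"
    unfolding x_norm_def using t beta_minus[OF p0, of \<alpha> "int s"] by (intro prod.cong) (auto simp: of_nat_diff)
  finally show ?thesis
    using x_norm_nonzero[OF \<alpha> t(3)] by (simp add: x0_def)
qed

text \<open>The counterpart for X Y = A: now the vanishing factor is the last one,
  \<open>beta\<close> at index s.\<close>

lemma E_y0:
  assumes \<alpha>: "\<alpha> * \<alpha> = 1" and t: "1 \<le> t" "t \<le> s" "s < p" and k: "k < s"
  shows "E ^ (s - k) * y0 \<alpha> s t = x_norm (- \<alpha>) (p - s) k *s (F ^ k * a0 \<alpha> s t)"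
proof -
  define y where "y = F ^ k * b0 \<alpha> s t"
  have wy: "wt \<alpha> (int s - 1 - 2 * int k) y"
    using wt_F_pow[OF wt_b0[OF \<alpha> t(2)], of k] by (simp add: y_def)
  let ?f = "\<lambda>j. beta p \<alpha> (int s) (int k + 1 + int j)"
  have "E ^ (s - k) * y0 \<alpha> s t = E ^ (s - k) * (F ^ (s - k) * y)"
    using k by (simp add: y_def y0_def F_F_pow)
  also have "\<dots> = Z_prod \<alpha> (int s) ?f (s - k) y"
    by (rule EF_pow[OF wy \<alpha>])
  also have "\<dots> = prod_omit ?f {..<s - k} *s (F ^ k * a0 \<alpha> s t)"
    using t k Z_b0[OF \<alpha> t] Z_a0[OF \<alpha>, of t s]
    by (subst Z_prod_nilpotent) (auto simp: y_def of_nat_diff intro!: prod_zero bexI[of _ "s - k - 1"])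
  also have "prod_omit ?f {..<s - k} = prod ?f ({..<s - k} - {s - k - 1})"
    using k by (intro prod_omit_zero) (auto simp: of_nat_diff)
  also have "\<dots> = x_norm (- \<alpha>) (p - s) k"
    unfolding x_norm_def using t k
    by (intro prod.reindex_bij_witness[of _ "\<lambda>i. i - k - 1" "\<lambda>j. j + k + 1"])
       (auto simp: of_nat_diff algebra_simps)
  finally show ?thesis .
qed

end

section \<open>Normalized basis elements and the symmetry of their constants\<close>

context uq_alg
begin

text \<open>On F^(t-1) x the elements b_0 and a_0 give \<gamma> x + \<delta> Z x and \<gamma> Z x,
  so the subtracted multiple of a_0 removes the Z term and leaves exactly F^n x.\<close>

definition Bg :: "complex \<Rightarrow> nat \<Rightarrow> nat \<Rightarrow> nat \<Rightarrow> 'r" where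
  "Bg \<alpha> s t n = F ^ n * ((1 / norm_gamma \<alpha> s) *s (b0 \<alpha> s t - (norm_delta \<alpha> s / norm_gamma \<alpha> s) *s a0 \<alpha> s t))"

definition Ag :: "complex \<Rightarrow> nat \<Rightarrow> nat \<Rightarrow> nat \<Rightarrow> 'r" where
  "Ag \<alpha> s t n = F ^ n * ((1 / norm_gamma \<alpha> s) *s a0 \<alpha> s t)"

definition Xg :: "complex \<Rightarrow> nat \<Rightarrow> nat \<Rightarrow> nat \<Rightarrow> 'r" where
  "Xg \<alpha> s t k = F ^ k * ((1 / norm_gamma \<alpha> s) *s x0 \<alpha> s t)"

definition Yg :: "complex \<Rightarrow> nat \<Rightarrow> nat \<Rightarrow> nat \<Rightarrow> 'r" where
  "Yg \<alpha> s t k = F ^ k * ((1 / norm_gamma \<alpha> s) *s y0 \<alpha> s t)"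

lemma beta_seq_image:
  assumes "1 \<le> s" "s < p"
  shows "{..<p - 1} - {s - 1} = (\<lambda>i. i - 1) ` {1..s - 1} \<union> (\<lambda>m. s + m - 1) ` {1..p - s - 1}"
proof (rule equalityI; rule subsetI)
  fix x assume x: "x \<in> {..<p - 1} - {s - 1}"
  show "x \<in> (\<lambda>i. i - 1) ` {1..s - 1} \<union> (\<lambda>m. s + m - 1) ` {1..p - s - 1}"
  proof (cases "x < s - 1")
    case True
    then show ?thesis by (intro UnI1 image_eqI[of _ _ "x + 1"]) auto
  next
    case False
    then show ?thesis using x assms by (intro UnI2 image_eqI[of _ _ "x + 1 - s"]) auto
  qed
qed (use assms in auto)

text \<open>Below the removed index s - 1 stand the factors of (\<alpha>, s), above it those of the
  partner. Exchanging the two halves changes nothing, so one pair of constants normalizes the whole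
  block.\<close>

lemma beta_seq_split:
  assumes s: "1 \<le> s" "s < p"
  shows "prod (beta_seq \<alpha> s) ({..<p - 1} - {s - 1})
      = (\<Prod>m=1..p - s - 1. beta p (- \<alpha>) (int (p - s)) (int m)) * (\<Prod>i=1..s - 1. beta p \<alpha> (int s) (int i))"
    and "prod_omit (beta_seq \<alpha> s) ({..<p - 1} - {s - 1})
      = (\<Prod>m=1..p - s - 1. beta p (- \<alpha>) (int (p - s)) (int m)) * prod_omit (\<lambda>i. beta p \<alpha> (int s) (int i)) {1..s - 1}
      + (\<Prod>i=1..s - 1. beta p \<alpha> (int s) (int i)) * prod_omit (\<lambda>m. beta p (- \<alpha>) (int (p - s)) (int m)) {1..p - s - 1}"
proof -
  let ?g = "\<lambda>i. i - 1 :: nat" and ?h = "\<lambda>m. s + m - 1"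
  have inj: "inj_on ?g {1..s - 1}" "inj_on ?h {1..p - s - 1}"
    by (auto simp: inj_on_def)
  have disj: "?g ` {1..s - 1} \<inter> ?h ` {1..p - s - 1} = {}"
    by auto
  have f1: "beta_seq \<alpha> s (?g i) = beta p \<alpha> (int s) (int i)" if "i \<in> {1..s - 1}" for i
    using that by (simp add: beta_seq_def of_nat_diff)
  have f2: "beta_seq \<alpha> s (?h m) = beta p (- \<alpha>) (int (p - s)) (int m)" if "m \<in> {1..p - s - 1}" for m
  proof -
    have "1 + int (s + m - 1) = int s + int m" using that by auto
    then show ?thesis
      using s by (simp add: beta_seq_def beta_s_plus[OF p0] of_nat_diff)
  qed
  have p1: "prod (beta_seq \<alpha> s) (?g ` {1..s - 1}) = (\<Prod>i=1..s - 1. beta p \<alpha> (int s) (int i))"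
    unfolding prod.reindex[OF inj(1)] o_def by (intro prod.cong refl f1)
  have p2: "prod (beta_seq \<alpha> s) (?h ` {1..p - s - 1}) = (\<Prod>m=1..p - s - 1. beta p (- \<alpha>) (int (p - s)) (int m))"
    unfolding prod.reindex[OF inj(2)] o_def by (intro prod.cong refl f2)
  have d1: "prod_omit (beta_seq \<alpha> s) (?g ` {1..s - 1}) = prod_omit (\<lambda>i. beta p \<alpha> (int s) (int i)) {1..s - 1}"
    unfolding prod_omit_reindex[OF inj(1)] by (intro prod_omit_cong refl f1)
  have d2: "prod_omit (beta_seq \<alpha> s) (?h ` {1..p - s - 1}) = prod_omit (\<lambda>m. beta p (- \<alpha>) (int (p - s)) (int m)) {1..p - s - 1}"
    unfolding prod_omit_reindex[OF inj(2)] by (intro prod_omit_cong refl f2)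
  show "prod (beta_seq \<alpha> s) ({..<p - 1} - {s - 1})
      = (\<Prod>m=1..p - s - 1. beta p (- \<alpha>) (int (p - s)) (int m)) * (\<Prod>i=1..s - 1. beta p \<alpha> (int s) (int i))"
    unfolding beta_seq_image[OF s] using disj by (subst prod.union_disjoint) (simp_all only: p1 p2 finite_imageI finite_atLeastAtMost mult.commute)
  show "prod_omit (beta_seq \<alpha> s) ({..<p - 1} - {s - 1})
      = (\<Prod>m=1..p - s - 1. beta p (- \<alpha>) (int (p - s)) (int m)) * prod_omit (\<lambda>i. beta p \<alpha> (int s) (int i)) {1..s - 1}
      + (\<Prod>i=1..s - 1. beta p \<alpha> (int s) (int i)) * prod_omit (\<lambda>m. beta p (- \<alpha>) (int (p - s)) (int m)) {1..p - s - 1}"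
    unfolding beta_seq_image[OF s] using disj by (subst prod_omit_union) (simp_all only: p1 p2 d1 d2 finite_imageI finite_atLeastAtMost)
qed

lemma norm_gamma_flip: "1 \<le> s \<Longrightarrow> s < p \<Longrightarrow> norm_gamma (- \<alpha>) (p - s) = norm_gamma \<alpha> s"
  unfolding norm_gamma_def using beta_seq_split(1)[of s \<alpha>] beta_seq_split(1)[of "p - s" "- \<alpha>"] by simp

lemma norm_delta_flip: "1 \<le> s \<Longrightarrow> s < p \<Longrightarrow> norm_delta (- \<alpha>) (p - s) = norm_delta \<alpha> s"
  unfolding norm_delta_def using beta_seq_split(2)[of s \<alpha>] beta_seq_split(2)[of "p - s" "- \<alpha>"] by simp

lemma norm_gamma_nonzero:
  assumes "\<alpha> * \<alpha> = 1" "1 \<le> s" "s \<le> p"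
  shows "norm_gamma \<alpha> s \<noteq> 0"
proof -
  have "\<alpha> \<noteq> 0" using assms by auto
  have "prod (beta_seq \<alpha> s) ({..<p - 1} - {s - 1}) \<noteq> 0"
  proof (cases "s < p")
    case True
    have "beta p (- \<alpha>) (int (p - s)) (int m) \<noteq> 0" if "m \<in> {1..p - s - 1}" for m
      using that True p2 \<open>\<alpha> \<noteq> 0\<close> by (intro beta_nonzero) auto
    moreover have "beta p \<alpha> (int s) (int i) \<noteq> 0" if "i \<in> {1..s - 1}" for i
      using that True p2 \<open>\<alpha> \<noteq> 0\<close> by (intro beta_nonzero) auto
    ultimately show ?thesis
      unfolding beta_seq_split(1)[OF assms(2) True] mult_eq_0_iff
      by (subst (1 2) prod_zero_iff) blast+
  next
    case False
    then have "beta_seq \<alpha> s j \<noteq> 0" if "j \<in> {..<p - 1}" for j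
      using that p2 \<open>\<alpha> \<noteq> 0\<close> assms unfolding beta_seq_def by (intro beta_nonzero) auto
    then show ?thesis by (subst prod_zero_iff) auto
  qed
  then show ?thesis
    using p0 by (simp add: norm_gamma_def)
qed

section \<open>Left actions\<close>

context
  fixes \<alpha> :: complex and s :: nat
  assumes \<alpha>: "\<alpha> * \<alpha> = 1" and s: "1 \<le> s" "s < p"
begin

lemma gam0: "norm_gamma \<alpha> s \<noteq> 0"
  using norm_gamma_nonzero \<alpha> s by simp

lemma Xg_alt: "1 \<le> t \<Longrightarrow> t \<le> s \<Longrightarrow> k < p - s \<Longrightarrow>
  Xg \<alpha> s t k = (1 / norm_gamma \<alpha> s * (1 / x_norm \<alpha> s k)) *s (E ^ (p - s - k) * b0 \<alpha> s t)"
  unfolding Xg_def smul_mult_right by (subst F_x0[OF \<alpha>]) (simp_all add: s)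

context
  fixes t x
  assumes t: "1 \<le> t" "t \<le> s"
    and x: "wt \<alpha> (int s - 1) x" and Zx: "Z \<alpha> (int s) * (Z \<alpha> (int s) * x) = 0"
begin

text \<open>Every right factor in the table is F^m x with x a vector of highest weight killed by
  Z^2. These four actions and the vanishing rules after them determine all products.\<close>

lemma Bg_action: "Bg \<alpha> s t n * (F ^ (t - 1) * x) = F ^ n * x"
proof -
  have "Bg \<alpha> s t n * (F ^ (t - 1) * x) =
    F ^ n * ((1 / norm_gamma \<alpha> s) *s (b0 \<alpha> s t * (F ^ (t - 1) * x) - (norm_delta \<alpha> s / norm_gamma \<alpha> s) *s (a0 \<alpha> s t * (F ^ (t - 1) * x))))"
    by (simp add: Bg_def mult.assoc left_diff_distrib)
  then show ?thesis
    unfolding b0_action[OF x \<alpha> Zx t s(2)] a0_action[OF x \<alpha> Zx t s(2)] using gam0 by simp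
qed

lemma Ag_action: "Ag \<alpha> s t n * (F ^ (t - 1) * x) = F ^ n * (Z \<alpha> (int s) * x)"
proof -
  have "Ag \<alpha> s t n * (F ^ (t - 1) * x) = F ^ n * ((1 / norm_gamma \<alpha> s) *s (a0 \<alpha> s t * (F ^ (t - 1) * x)))"
    by (simp add: Ag_def mult.assoc)
  then show ?thesis
    unfolding a0_action[OF x \<alpha> Zx t s(2)] using gam0 by simp
qed

lemma Xg_action: "k < p - s \<Longrightarrow> Xg \<alpha> s t k * (F ^ (t - 1) * x)
  = (1 / x_norm \<alpha> s k) *s (E ^ (p - s - k) * (x + (norm_delta \<alpha> s / norm_gamma \<alpha> s) *s (Z \<alpha> (int s) * x)))"
proof -
  assume k: "k < p - s"
  have "Xg \<alpha> s t k * (F ^ (t - 1) * x)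
    = (1 / norm_gamma \<alpha> s * (1 / x_norm \<alpha> s k)) *s (E ^ (p - s - k) * (b0 \<alpha> s t * (F ^ (t - 1) * x)))"
    unfolding Xg_alt[OF t k] by (simp add: mult.assoc)
  then show ?thesis
    unfolding b0_action[OF x \<alpha> Zx t s(2)] using gam0
    by (simp add: distrib_left vs.scale_right_distrib)
qed

lemma Yg_action: "Yg \<alpha> s t k * (F ^ (t - 1) * x)
  = F ^ (s + k) * (x + (norm_delta \<alpha> s / norm_gamma \<alpha> s) *s (Z \<alpha> (int s) * x))"
proof -
  have "Yg \<alpha> s t k * (F ^ (t - 1) * x) = (1 / norm_gamma \<alpha> s) *s (F ^ (s + k) * (b0 \<alpha> s t * (F ^ (t - 1) * x)))"
    by (simp add: Yg_def y0_def mult.assoc add.commute power_add)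
  then show ?thesis
    unfolding b0_action[OF x \<alpha> Zx t s(2)] using gam0
    by (simp add: distrib_left vs.scale_right_distrib)
qed

end

lemma source_zero:
  assumes "wt \<beta> j x" "\<beta> * \<beta> = 1" "\<alpha> * q_pow p (int s - 2 * int t + 1) \<noteq> \<beta> * q_pow p j"
  shows "Bg \<alpha> s t n * x = 0" "Ag \<alpha> s t n * x = 0" "Xg \<alpha> s t n * x = 0" "Yg \<alpha> s t n * x = 0"
proof -
  have V: "V \<alpha> (int s - 2 * int t + 1) * x = 0"
    by (rule V_mult_zero[OF assms(1) \<alpha> assms(2,3)])
  then have W: "W \<alpha> s t N * x = 0" for N
    by (simp add: W_def mult.assoc)
  have a: "a0 \<alpha> s t * x = 0" and b: "b0 \<alpha> s t * x = 0"
    by (simp_all add: a0_def b0_def W sum_distrib_right)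
  show "Bg \<alpha> s t n * x = 0" "Ag \<alpha> s t n * x = 0" "Xg \<alpha> s t n * x = 0" "Yg \<alpha> s t n * x = 0"
    by (simp_all add: Bg_def Ag_def Xg_def Yg_def x0_def y0_def mult.assoc left_diff_distrib a b)
qed

lemma source_zero_same:
  assumes "wt \<alpha> (int s - 1) x" "m < s" "1 \<le> t" "t \<le> s" "m \<noteq> t - 1"
  shows "Bg \<alpha> s t n * (F ^ m * x) = 0" "Ag \<alpha> s t n * (F ^ m * x) = 0"
    "Xg \<alpha> s t n * (F ^ m * x) = 0" "Yg \<alpha> s t n * (F ^ m * x) = 0"
proof -
  have "\<not> 2 * int p dvd 2 * (int m + 1 - int t)"
  proof
    assume "2 * int p dvd 2 * (int m + 1 - int t)"
    then have "int p dvd int m + 1 - int t" by (simp only: dvd_mult_cancel_left) simp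
    then have "\<bar>int p\<bar> \<le> \<bar>int m + 1 - int t\<bar>" using assms by (intro dvd_imp_le_int) auto
    then show False using assms s by auto
  qed
  moreover have "2 * (int m + 1 - int t) = int s - 2 * int t + 1 - (int s - 1 - 2 * int m)" by simp
  ultimately have "q_pow p (int s - 2 * int t + 1) \<noteq> q_pow p (int s - 1 - 2 * int m)"
    by (simp only: q_pow_eq_iff[OF p0] not_False_eq_True)
  then have "\<alpha> * q_pow p (int s - 2 * int t + 1) \<noteq> \<alpha> * q_pow p (int s - 1 - 2 * int m)"
    using \<alpha> by auto
  from source_zero[OF wt_F_pow[OF assms(1)] \<alpha> this]
  show "Bg \<alpha> s t n * (F ^ m * x) = 0" "Ag \<alpha> s t n * (F ^ m * x) = 0"
    "Xg \<alpha> s t n * (F ^ m * x) = 0" "Yg \<alpha> s t n * (F ^ m * x) = 0" .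
qed

text \<open>The exponents differ by 2(s + m + 1 - t) with 0 < s + m + 1 - t < p, so no weight of the
  partner is ever selected by V.\<close>

lemma source_zero_other:
  assumes "wt (- \<alpha>) (int (p - s) - 1) x" "m < p - s" "1 \<le> t" "t \<le> s"
  shows "Bg \<alpha> s t n * (F ^ m * x) = 0" "Ag \<alpha> s t n * (F ^ m * x) = 0"
    "Xg \<alpha> s t n * (F ^ m * x) = 0" "Yg \<alpha> s t n * (F ^ m * x) = 0"
proof -
  have w: "wt \<alpha> (int (p - s) - 1 - 2 * int m - int p) (F ^ m * x)"
    using wt_flip_minus[OF wt_F_pow[OF assms(1)], of m] by simp
  have "\<not> 2 * int p dvd 2 * (int s + int m + 1 - int t)"
  proof
    assume "2 * int p dvd 2 * (int s + int m + 1 - int t)"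
    then have "int p dvd int s + int m + 1 - int t" by (simp only: dvd_mult_cancel_left) simp
    then have "int p \<le> int s + int m + 1 - int t" using assms by (intro zdvd_imp_le) auto
    then show False using assms s by auto
  qed
  moreover have "2 * (int s + int m + 1 - int t) = int s - 2 * int t + 1 - (int (p - s) - 1 - 2 * int m - int p)"
    using s by (simp add: of_nat_diff)
  ultimately have "q_pow p (int s - 2 * int t + 1) \<noteq> q_pow p (int (p - s) - 1 - 2 * int m - int p)"
    by (simp only: q_pow_eq_iff[OF p0] not_False_eq_True)
  then have "\<alpha> * q_pow p (int s - 2 * int t + 1) \<noteq> \<alpha> * q_pow p (int (p - s) - 1 - 2 * int m - int p)"
    using \<alpha> by auto
  from source_zero[OF w \<alpha> this]
  show "Bg \<alpha> s t n * (F ^ m * x) = 0" "Ag \<alpha> s t n * (F ^ m * x) = 0"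
    "Xg \<alpha> s t n * (F ^ m * x) = 0" "Yg \<alpha> s t n * (F ^ m * x) = 0" .
qed

lemma sign_flip: "(- \<alpha>) * (- \<alpha>) = 1" and pos_flip: "1 \<le> p - s" "p - s < p"
  using \<alpha> s by auto

lemma B_right:
  assumes "1 \<le> t2" "t2 \<le> s"
  defines "x \<equiv> (1 / norm_gamma \<alpha> s) *s (b0 \<alpha> s t2 - (norm_delta \<alpha> s / norm_gamma \<alpha> s) *s a0 \<alpha> s t2)"
  shows "wt \<alpha> (int s - 1) x" "Z \<alpha> (int s) * x = (1 / norm_gamma \<alpha> s) *s a0 \<alpha> s t2"
    "Z \<alpha> (int s) * (Z \<alpha> (int s) * x) = 0"
proof -
  show "wt \<alpha> (int s - 1) x"
    unfolding x_def using assms s by (intro wt_smul wt_diff wt_b0 wt_a0 \<alpha>) auto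
  have Za: "Z \<alpha> (int s) * a0 \<alpha> s t2 = 0" using Z_a0[OF \<alpha>, of t2 s] assms s by simp
  show 1: "Z \<alpha> (int s) * x = (1 / norm_gamma \<alpha> s) *s a0 \<alpha> s t2"
    unfolding x_def using Z_b0[OF \<alpha> assms(1,2) s(2)] Za by (simp add: right_diff_distrib)
  show "Z \<alpha> (int s) * (Z \<alpha> (int s) * x) = 0"
    unfolding 1 by (simp add: Za)
qed

lemma A_right:
  assumes "1 \<le> t2" "t2 \<le> s"
  defines "x \<equiv> (1 / norm_gamma \<alpha> s) *s a0 \<alpha> s t2"
  shows "wt \<alpha> (int s - 1) x" "Z \<alpha> (int s) * x = 0"
  unfolding x_def using assms s Z_a0[OF \<alpha>, of t2 s] by (auto intro!: wt_smul wt_a0 \<alpha>)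

text \<open>The partner's \<open>x0\<close> has the highest weight of (\<alpha>, s), which is why it
  can follow an element ending in this family.\<close>

lemma X_right:
  assumes "u \<le> p - s"
  defines "x \<equiv> (1 / norm_gamma (- \<alpha>) (p - s)) *s x0 (- \<alpha>) (p - s) u"
  shows "wt \<alpha> (int s - 1) x" "Z \<alpha> (int s) * x = 0"
proof -
  show "wt \<alpha> (int s - 1) x"
    unfolding x_def using wt_x0[OF sign_flip assms(1)] s by (auto intro!: wt_smul)
  show "Z \<alpha> (int s) * x = 0"
    unfolding x_def using Z_x0[OF sign_flip, of "p - s" u] assms s
    by (simp add: Z_flip_nat del: of_nat_diff)
qed

lemma Y_right:
  assumes "1 \<le> u" "u \<le> p - s"
  defines "x \<equiv> (1 / norm_gamma (- \<alpha>) (p - s)) *s y0 (- \<alpha>) (p - s) u"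
  shows "wt \<alpha> (int s - 1) x" "Z \<alpha> (int s) * x = 0"
proof -
  show "wt \<alpha> (int s - 1) x"
    unfolding x_def using wt_y0[OF sign_flip assms(2)] s by (auto intro!: wt_smul)
  show "Z \<alpha> (int s) * x = 0"
    unfolding x_def using Z_y0[OF sign_flip, of u "p - s"] assms s
    by (simp add: Z_flip_nat del: of_nat_diff)
qed

text \<open>X and Y contain b_0 without correction, so they act with an extra (\<delta>/\<gamma>) Z;
  on the corrected vector in B this restores b_0.\<close>

lemma b_combination:
  "(1 / norm_gamma \<alpha> s) *s (b0 \<alpha> s t2 - (norm_delta \<alpha> s / norm_gamma \<alpha> s) *s a0 \<alpha> s t2)
    + (norm_delta \<alpha> s / norm_gamma \<alpha> s) *s ((1 / norm_gamma \<alpha> s) *s a0 \<alpha> s t2) = (1 / norm_gamma \<alpha> s) *s b0 \<alpha> s t2"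
  by (simp add: vs.scale_right_diff_distrib)

lemma E_pos_kill: "E * x = 0 \<Longrightarrow> 0 < n \<Longrightarrow> E ^ n * x = 0"
  by (cases n) (simp_all add: power_Suc2 mult.assoc del: power_Suc)

context
  fixes t m
  assumes t: "1 \<le> t" "t \<le> s" and m: "m < s"
begin

lemma mult_right_B:
  assumes t2: "1 \<le> t2" "t2 \<le> s"
  shows "Bg \<alpha> s t n * Bg \<alpha> s t2 m = (if m = t - 1 then Bg \<alpha> s t2 n else 0)"
    and "Ag \<alpha> s t n * Bg \<alpha> s t2 m = (if m = t - 1 then Ag \<alpha> s t2 n else 0)"
    and "k < p - s \<Longrightarrow> Xg \<alpha> s t k * Bg \<alpha> s t2 m = (if m = t - 1 then Xg \<alpha> s t2 k else 0)"
    and "Yg \<alpha> s t k * Bg \<alpha> s t2 m = (if m = t - 1 then Yg \<alpha> s t2 k else 0)"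
proof -
  note R = B_right[OF t2]
  note act = Bg_action[OF t R(1,3)] Ag_action[OF t R(1,3)] Yg_action[OF t R(1,3)]
  note actX = Xg_action[OF t R(1,3)]
  note zero = source_zero_same[OF R(1) m t]
  show "Bg \<alpha> s t n * Bg \<alpha> s t2 m = (if m = t - 1 then Bg \<alpha> s t2 n else 0)"
    unfolding Bg_def[of \<alpha> s t2] by (cases "m = t - 1") (simp_all only: act zero if_True if_False simp_thms)
  show "Ag \<alpha> s t n * Bg \<alpha> s t2 m = (if m = t - 1 then Ag \<alpha> s t2 n else 0)"
    unfolding Bg_def[of \<alpha> s t2] Ag_def[of \<alpha> s t2] by (cases "m = t - 1") (simp_all only: act zero R(2) if_True if_False simp_thms)
  show "Xg \<alpha> s t k * Bg \<alpha> s t2 m = (if m = t - 1 then Xg \<alpha> s t2 k else 0)" if "k < p - s"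
    unfolding Bg_def[of \<alpha> s t2] Xg_alt[OF t2 that]
    by (cases "m = t - 1") (simp_all only: actX[OF that] zero R(2) simp_thms b_combination if_True if_False simp_thms, simp)
  show "Yg \<alpha> s t k * Bg \<alpha> s t2 m = (if m = t - 1 then Yg \<alpha> s t2 k else 0)"
    unfolding Bg_def[of \<alpha> s t2] Yg_def[of \<alpha> s t2]
    by (cases "m = t - 1") (simp_all only: act zero R(2) b_combination if_True if_False simp_thms,
        simp add: y0_def F_F_pow add.commute)
qed

lemma mult_right_A:
  assumes t2: "1 \<le> t2" "t2 \<le> s"
  shows "Bg \<alpha> s t n * Ag \<alpha> s t2 m = (if m = t - 1 then Ag \<alpha> s t2 n else 0)"
    and "Ag \<alpha> s t n * Ag \<alpha> s t2 m = 0"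
    and "k < p - s \<Longrightarrow> Xg \<alpha> s t k * Ag \<alpha> s t2 m = 0"
    and "Yg \<alpha> s t k * Ag \<alpha> s t2 m = 0"
proof -
  note R = A_right[OF t2]
  have Z: "Z \<alpha> (int s) * (Z \<alpha> (int s) * ((1 / norm_gamma \<alpha> s) *s a0 \<alpha> s t2)) = 0"
    by (simp only: R(2) mult_zero_right)
  note act = Bg_action[OF t R(1) Z] Ag_action[OF t R(1) Z] Yg_action[OF t R(1) Z]
  note actX = Xg_action[OF t R(1) Z]
  note zero = source_zero_same[OF R(1) m t]
  have E0: "E ^ (p - s - k) * a0 \<alpha> s t2 = 0" if "k < p - s" for k
    using that by (intro E_pos_kill E_a0) simp
  have F0: "F ^ (s + k) * a0 \<alpha> s t2 = 0" for k
    using F_a0[OF \<alpha> t2] s F_F_pow[of k s "a0 \<alpha> s t2"] by (simp add: add.commute)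
  show "Bg \<alpha> s t n * Ag \<alpha> s t2 m = (if m = t - 1 then Ag \<alpha> s t2 n else 0)"
    unfolding Ag_def[of \<alpha> s t2] by (cases "m = t - 1") (simp_all only: act zero if_True if_False simp_thms)
  show "Ag \<alpha> s t n * Ag \<alpha> s t2 m = 0"
    unfolding Ag_def[of \<alpha> s t2] by (cases "m = t - 1") (simp_all only: act zero R(2) mult_zero_right simp_thms)
  show "Xg \<alpha> s t k * Ag \<alpha> s t2 m = 0" if "k < p - s"
    unfolding Ag_def[of \<alpha> s t2]
    by (cases "m = t - 1") (simp_all only: actX[OF that] zero R(2) simp_thms, simp add: E0[OF that, unfolded diff_diff_left])
  show "Yg \<alpha> s t k * Ag \<alpha> s t2 m = 0"
    unfolding Ag_def[of \<alpha> s t2]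
    by (cases "m = t - 1") (simp_all only: act zero R(2) simp_thms, simp add: F0)
qed

text \<open>X X vanishes because E kills \<open>x0\<close>; Y X survives because F^s carries the
  partner's \<open>x0\<close> to its \<open>a0\<close>.\<close>

lemma mult_right_X:
  assumes u: "1 \<le> u" "u \<le> p - s"
  shows "Bg \<alpha> s t n * Xg (- \<alpha>) (p - s) u m = (if m = t - 1 then Xg (- \<alpha>) (p - s) u n else 0)"
    and "Ag \<alpha> s t n * Xg (- \<alpha>) (p - s) u m = 0"
    and "k < p - s \<Longrightarrow> Xg \<alpha> s t k * Xg (- \<alpha>) (p - s) u m = 0"
    and "Yg \<alpha> s t k * Xg (- \<alpha>) (p - s) u m = (if m = t - 1 then Ag (- \<alpha>) (p - s) u k else 0)"
proof -
  note R = X_right[OF u(2)]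
  let ?x = "(1 / norm_gamma (- \<alpha>) (p - s)) *s x0 (- \<alpha>) (p - s) u"
  have Z: "Z \<alpha> (int s) * (Z \<alpha> (int s) * ?x) = 0"
    by (simp only: R(2) mult_zero_right)
  note act = Bg_action[OF t R(1) Z] Ag_action[OF t R(1) Z] Yg_action[OF t R(1) Z]
  note actX = Xg_action[OF t R(1) Z]
  note zero = source_zero_same[OF R(1) m t]
  have E0: "E ^ (p - s - k) * x0 (- \<alpha>) (p - s) u = 0" if "k < p - s" for k
    using that s by (intro E_pos_kill E_x0) auto
  have F0: "F ^ (s + k) * x0 (- \<alpha>) (p - s) u = F ^ k * a0 (- \<alpha>) (p - s) u" for k
    using F_s_x0[OF sign_flip u pos_flip(2)] s F_F_pow[of k s "x0 (- \<alpha>) (p - s) u"] by (simp add: add.commute)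
  show "Bg \<alpha> s t n * Xg (- \<alpha>) (p - s) u m = (if m = t - 1 then Xg (- \<alpha>) (p - s) u n else 0)"
    unfolding Xg_def[of "- \<alpha>"] by (cases "m = t - 1") (simp_all only: act zero if_True if_False simp_thms)
  show "Ag \<alpha> s t n * Xg (- \<alpha>) (p - s) u m = 0"
    unfolding Xg_def[of "- \<alpha>"] by (cases "m = t - 1") (simp_all only: act zero R(2) mult_zero_right simp_thms)
  show "Xg \<alpha> s t k * Xg (- \<alpha>) (p - s) u m = 0" if "k < p - s"
    unfolding Xg_def[of "- \<alpha>"]
    by (cases "m = t - 1") (simp_all only: actX[OF that] zero R(2) simp_thms, simp add: E0[OF that, unfolded diff_diff_left])
  show "Yg \<alpha> s t k * Xg (- \<alpha>) (p - s) u m = (if m = t - 1 then Ag (- \<alpha>) (p - s) u k else 0)"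
    unfolding Xg_def[of "- \<alpha>"] Ag_def[of "- \<alpha>"]
    by (cases "m = t - 1") (simp_all only: act zero R(2) if_True if_False simp_thms, simp add: F0)
qed

text \<open>The roles are exchanged: Y Y vanishes by F^p = 0, while E^(p-s-k) carries the partner's
  \<open>y0\<close> to F^k \<open>a0\<close> times \<open>x_norm \<alpha> s k\<close>, the
  denominator in X.\<close>

lemma mult_right_Y:
  assumes u: "1 \<le> u" "u \<le> p - s"
  shows "Bg \<alpha> s t n * Yg (- \<alpha>) (p - s) u m = (if m = t - 1 then Yg (- \<alpha>) (p - s) u n else 0)"
    and "Ag \<alpha> s t n * Yg (- \<alpha>) (p - s) u m = 0"
    and "k < p - s \<Longrightarrow> Xg \<alpha> s t k * Yg (- \<alpha>) (p - s) u m = (if m = t - 1 then Ag (- \<alpha>) (p - s) u k else 0)"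
    and "Yg \<alpha> s t k * Yg (- \<alpha>) (p - s) u m = 0"
proof -
  note R = Y_right[OF u]
  let ?x = "(1 / norm_gamma (- \<alpha>) (p - s)) *s y0 (- \<alpha>) (p - s) u"
  have Z: "Z \<alpha> (int s) * (Z \<alpha> (int s) * ?x) = 0"
    by (simp only: R(2) mult_zero_right)
  note act = Bg_action[OF t R(1) Z] Ag_action[OF t R(1) Z] Yg_action[OF t R(1) Z]
  note actX = Xg_action[OF t R(1) Z]
  note zero = source_zero_same[OF R(1) m t]
  have E0: "E ^ (p - s - k) * y0 (- \<alpha>) (p - s) u = x_norm \<alpha> s k *s (F ^ k * a0 (- \<alpha>) (p - s) u)" if "k < p - s" for k
    using E_y0[OF sign_flip u pos_flip(2) that] s by simp
  have F0: "F ^ (s + k) * y0 (- \<alpha>) (p - s) u = 0" for k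
    using s by (simp add: y0_def F_F_pow F_kill)
  show "Bg \<alpha> s t n * Yg (- \<alpha>) (p - s) u m = (if m = t - 1 then Yg (- \<alpha>) (p - s) u n else 0)"
    unfolding Yg_def[of "- \<alpha>"] by (cases "m = t - 1") (simp_all only: act zero if_True if_False simp_thms)
  show "Ag \<alpha> s t n * Yg (- \<alpha>) (p - s) u m = 0"
    unfolding Yg_def[of "- \<alpha>"] by (cases "m = t - 1") (simp_all only: act zero R(2) mult_zero_right simp_thms)
  show "Xg \<alpha> s t k * Yg (- \<alpha>) (p - s) u m = (if m = t - 1 then Ag (- \<alpha>) (p - s) u k else 0)" if "k < p - s"
    unfolding Yg_def[of "- \<alpha>"] Ag_def[of "- \<alpha>"]
    by (cases "m = t - 1") (simp_all only: actX[OF that] zero R(2) simp_thms if_True if_False simp_thms,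
        simp add: E0[OF that, unfolded diff_diff_left] x_norm_nonzero[OF \<alpha> s(2)])
  show "Yg \<alpha> s t k * Yg (- \<alpha>) (p - s) u m = 0"
    unfolding Yg_def[of "- \<alpha>"]
    by (cases "m = t - 1") (simp_all only: act zero R(2) simp_thms, simp add: F0)
qed

end

end

end

context uq_alg
begin

text \<open>In all sixteen cases the right factor is F^m applied to a highest weight vector of the
  partner.\<close>

lemma mult_cross:
  assumes \<alpha>: "\<alpha> * \<alpha> = 1" and s: "1 \<le> s" "s < p" and t: "1 \<le> t" "t \<le> s" and m: "m < p - s"
  shows "1 \<le> u \<Longrightarrow> u \<le> p - s \<Longrightarrow> Bg \<alpha> s t n * Bg (- \<alpha>) (p - s) u m = 0"
    and "1 \<le> u \<Longrightarrow> u \<le> p - s \<Longrightarrow> Ag \<alpha> s t n * Bg (- \<alpha>) (p - s) u m = 0"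
    and "1 \<le> u \<Longrightarrow> u \<le> p - s \<Longrightarrow> Xg \<alpha> s t n * Bg (- \<alpha>) (p - s) u m = 0"
    and "1 \<le> u \<Longrightarrow> u \<le> p - s \<Longrightarrow> Yg \<alpha> s t n * Bg (- \<alpha>) (p - s) u m = 0"
    and "1 \<le> u \<Longrightarrow> u \<le> p - s \<Longrightarrow> Bg \<alpha> s t n * Ag (- \<alpha>) (p - s) u m = 0"
    and "1 \<le> u \<Longrightarrow> u \<le> p - s \<Longrightarrow> Ag \<alpha> s t n * Ag (- \<alpha>) (p - s) u m = 0"
    and "1 \<le> u \<Longrightarrow> u \<le> p - s \<Longrightarrow> Xg \<alpha> s t n * Ag (- \<alpha>) (p - s) u m = 0"
    and "1 \<le> u \<Longrightarrow> u \<le> p - s \<Longrightarrow> Yg \<alpha> s t n * Ag (- \<alpha>) (p - s) u m = 0"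
    and "1 \<le> u \<Longrightarrow> u \<le> s \<Longrightarrow> Bg \<alpha> s t n * Xg \<alpha> s u m = 0"
    and "1 \<le> u \<Longrightarrow> u \<le> s \<Longrightarrow> Ag \<alpha> s t n * Xg \<alpha> s u m = 0"
    and "1 \<le> u \<Longrightarrow> u \<le> s \<Longrightarrow> Xg \<alpha> s t n * Xg \<alpha> s u m = 0"
    and "1 \<le> u \<Longrightarrow> u \<le> s \<Longrightarrow> Yg \<alpha> s t n * Xg \<alpha> s u m = 0"
    and "1 \<le> u \<Longrightarrow> u \<le> s \<Longrightarrow> Bg \<alpha> s t n * Yg \<alpha> s u m = 0"
    and "1 \<le> u \<Longrightarrow> u \<le> s \<Longrightarrow> Ag \<alpha> s t n * Yg \<alpha> s u m = 0"
    and "1 \<le> u \<Longrightarrow> u \<le> s \<Longrightarrow> Xg \<alpha> s t n * Yg \<alpha> s u m = 0"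
    and "1 \<le> u \<Longrightarrow> u \<le> s \<Longrightarrow> Yg \<alpha> s t n * Yg \<alpha> s u m = 0"
proof -
  have s': "1 \<le> p - s" "p - s < p" "- \<alpha> * - \<alpha> = 1" using s \<alpha> by auto
  show "1 \<le> u \<Longrightarrow> u \<le> p - s \<Longrightarrow> Bg \<alpha> s t n * Bg (- \<alpha>) (p - s) u m = 0"
    "1 \<le> u \<Longrightarrow> u \<le> p - s \<Longrightarrow> Ag \<alpha> s t n * Bg (- \<alpha>) (p - s) u m = 0"
    "1 \<le> u \<Longrightarrow> u \<le> p - s \<Longrightarrow> Xg \<alpha> s t n * Bg (- \<alpha>) (p - s) u m = 0"
    "1 \<le> u \<Longrightarrow> u \<le> p - s \<Longrightarrow> Yg \<alpha> s t n * Bg (- \<alpha>) (p - s) u m = 0"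
    unfolding Bg_def[of "- \<alpha>"]
    using source_zero_other[OF \<alpha> s B_right(1)[OF s'(3,1,2)] m t] by blast+
  show "1 \<le> u \<Longrightarrow> u \<le> p - s \<Longrightarrow> Bg \<alpha> s t n * Ag (- \<alpha>) (p - s) u m = 0"
    "1 \<le> u \<Longrightarrow> u \<le> p - s \<Longrightarrow> Ag \<alpha> s t n * Ag (- \<alpha>) (p - s) u m = 0"
    "1 \<le> u \<Longrightarrow> u \<le> p - s \<Longrightarrow> Xg \<alpha> s t n * Ag (- \<alpha>) (p - s) u m = 0"
    "1 \<le> u \<Longrightarrow> u \<le> p - s \<Longrightarrow> Yg \<alpha> s t n * Ag (- \<alpha>) (p - s) u m = 0"
    unfolding Ag_def[of "- \<alpha>"]
    using source_zero_other[OF \<alpha> s A_right(1)[OF s'(3,1,2)] m t] by blast+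
  have x: "u \<le> s \<Longrightarrow> wt (- \<alpha>) (int (p - s) - 1) ((1 / norm_gamma \<alpha> s) *s x0 \<alpha> s u)"
    and y: "u \<le> s \<Longrightarrow> wt (- \<alpha>) (int (p - s) - 1) ((1 / norm_gamma \<alpha> s) *s y0 \<alpha> s u)"
    using s by (auto intro!: wt_smul wt_x0 wt_y0 \<alpha> simp del: of_nat_diff)
  show "1 \<le> u \<Longrightarrow> u \<le> s \<Longrightarrow> Bg \<alpha> s t n * Xg \<alpha> s u m = 0"
    "1 \<le> u \<Longrightarrow> u \<le> s \<Longrightarrow> Ag \<alpha> s t n * Xg \<alpha> s u m = 0"
    "1 \<le> u \<Longrightarrow> u \<le> s \<Longrightarrow> Xg \<alpha> s t n * Xg \<alpha> s u m = 0"
    "1 \<le> u \<Longrightarrow> u \<le> s \<Longrightarrow> Yg \<alpha> s t n * Xg \<alpha> s u m = 0"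
    unfolding Xg_def[of \<alpha> s u m]
    using source_zero_other[OF \<alpha> s x m t] by blast+
  show "1 \<le> u \<Longrightarrow> u \<le> s \<Longrightarrow> Bg \<alpha> s t n * Yg \<alpha> s u m = 0"
    "1 \<le> u \<Longrightarrow> u \<le> s \<Longrightarrow> Ag \<alpha> s t n * Yg \<alpha> s u m = 0"
    "1 \<le> u \<Longrightarrow> u \<le> s \<Longrightarrow> Xg \<alpha> s t n * Yg \<alpha> s u m = 0"
    "1 \<le> u \<Longrightarrow> u \<le> s \<Longrightarrow> Yg \<alpha> s t n * Yg \<alpha> s u m = 0"
    unfolding Yg_def[of \<alpha> s u m]
    using source_zero_other[OF \<alpha> s y m t] by blast+
qed

text \<open>For s = p no factor below p - 1 vanishes, so \<open>a0\<close> already acts by the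
  scalar \<open>norm_gamma\<close> and no \<open>b0\<close> enters.\<close>

lemma Ag_top_mult:
  assumes \<alpha>: "\<alpha> * \<alpha> = 1" and t: "1 \<le> t1" "t1 \<le> p" "1 \<le> t2" "t2 \<le> p" and n: "n < p"
  shows "Ag \<alpha> p t1 m * Ag \<alpha> p t2 n = (if n = t1 - 1 then Ag \<alpha> p t2 m else 0)"
proof -
  define x where "x = (1 / norm_gamma \<alpha> p) *s a0 \<alpha> p t2"
  have x: "wt \<alpha> (int p - 1) x" and Zx: "Z \<alpha> (int p) * x = 0"
    using Z_a0[OF \<alpha> t(4), of p] by (simp_all add: x_def wt_smul wt_a0 \<alpha> t)
  show ?thesis
  proof (cases "n = t1 - 1")
    case True
    have "Ag \<alpha> p t1 m * (F ^ n * x) = F ^ m * ((1 / norm_gamma \<alpha> p) *s (a0 \<alpha> p t1 * (F ^ (t1 - 1) * x)))"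
      using True by (simp add: Ag_def mult.assoc)
    also have "\<dots> = F ^ m * x"
      unfolding a0_action_top[OF x \<alpha> Zx t(1,2)] using norm_gamma_nonzero[OF \<alpha> p1] by simp
    finally show ?thesis using True by (simp add: Ag_def[of \<alpha> p t2] x_def)
  next
    case False
    have "\<not> 2 * int p dvd 2 * (int n + 1 - int t1)"
    proof
      assume "2 * int p dvd 2 * (int n + 1 - int t1)"
      then have "int p dvd int n + 1 - int t1" by (simp only: dvd_mult_cancel_left) simp
      then have "\<bar>int p\<bar> \<le> \<bar>int n + 1 - int t1\<bar>" using False t by (intro dvd_imp_le_int) auto
      then show False using t n by auto
    qed
    moreover have "2 * (int n + 1 - int t1) = int p - 2 * int t1 + 1 - (int p - 1 - 2 * int n)" by simp
    ultimately have "q_pow p (int p - 2 * int t1 + 1) \<noteq> q_pow p (int p - 1 - 2 * int n)"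
      by (simp only: q_pow_eq_iff[OF p0] not_False_eq_True)
    then have "V \<alpha> (int p - 2 * int t1 + 1) * (F ^ n * x) = 0"
      using \<alpha> by (intro V_mult_zero[OF wt_F_pow[OF x] \<alpha> \<alpha>]) auto
    then have "Ag \<alpha> p t1 m * (F ^ n * x) = 0"
      unfolding Ag_def a0_def W_def by (simp add: mult.assoc)
    then show ?thesis
      using False by (simp add: Ag_def[of \<alpha> p t2] x_def)
  qed
qed

section \<open>The multiplication table\<close>

primrec block_elt :: "nat \<Rightarrow> label \<Rightarrow> 'r" where
  "block_elt s (BP n t) = Bg 1 s t n"
| "block_elt s (XP k t) = Xg 1 s t k"
| "block_elt s (YP k t) = Yg 1 s t k"
| "block_elt s (AP n t) = Ag 1 s t n"
| "block_elt s (BM k u) = Bg (- 1) (p - s) u k"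
| "block_elt s (XM n u) = Xg (- 1) (p - s) u n"
| "block_elt s (YM n u) = Yg (- 1) (p - s) u n"
| "block_elt s (AM k u) = Ag (- 1) (p - s) u k"

text \<open>Products with a minus left factor are the plus rules for (-1, p - s), read with p - (p -
  s) = s.\<close>

lemma block_elt_mult:
  assumes s: "1 \<le> s" "s < p" and ij: "i \<in> labels p s" "j \<in> labels p s"
  shows "block_elt s i * block_elt s j = (case label_mult i j of Some k \<Rightarrow> block_elt s k | None \<Rightarrow> 0)"
proof -
  have one: "(1::complex) * 1 = 1" "(- 1 :: complex) * (- 1) = 1" by simp_all
  have s': "1 \<le> p - s" "p - s < p" and pps: "p - (p - s) = s" using s by auto
  note pos = mult_right_B[OF one(1) s] mult_right_A[OF one(1) s] mult_right_X[OF one(1) s]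
    mult_right_Y[OF one(1) s] mult_cross[OF one(1) s]
  note neg = mult_right_B[OF one(2) s'] mult_right_A[OF one(2) s'] mult_right_X[OF one(2) s']
    mult_right_Y[OF one(2) s'] mult_cross[OF one(2) s']
  note rules = pos neg[unfolded pps minus_minus]
  show ?thesis
    using ij by (cases i; cases j) (simp_all add: labels_def rules)
qed

text \<open>For t = 1, \<open>a0\<close> is E^(p-1) F^(p-1) V. The sign -1 is absorbed by shifting
  the weight by p, which explains the quantification over all weights in the assumption.\<close>

lemma a0_top_nonzero:
  assumes "\<And>k. E ^ (p - 1) * (F ^ (p - 1) * V 1 k) \<noteq> 0" "\<alpha> = 1 \<or> \<alpha> = - 1"
  shows "a0 \<alpha> s 1 \<noteq> 0"
proof -
  have "V (- 1) k = V 1 (k - int p)" for k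
    using p0 by (simp add: V_def q_pow_diff q_pow_minus q_pow_p)
  then show ?thesis
    using assms p2 by (auto simp: a0_def W_def)
qed

end

section \<open>Cardinalities of the label sets\<close>

lemma card_labels:
  assumes "s \<le> p"
  shows "finite (labels p s)" "card (labels p s) = 2 * p ^ 2"
proof -
  let ?P = "{..<s} \<times> {1..s}" and ?Q = "{..<p - s} \<times> {1..s}"
    and ?R = "{..<p - s} \<times> {1..p - s}" and ?S = "{..<s} \<times> {1..p - s}"
  have eq: "labels p s = case_prod BP ` ?P \<union> (case_prod XP ` ?Q \<union> (case_prod YP ` ?Q \<union> (case_prod AP ` ?P \<union>
      (case_prod BM ` ?R \<union> (case_prod XM ` ?S \<union> (case_prod YM ` ?S \<union> case_prod AM ` ?R))))))"
  proof -
    have "{f n t | n t. n < a \<and> t \<in> {1..b}} = case_prod f ` ({..<a} \<times> {1..b})"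
      for f :: "nat \<Rightarrow> nat \<Rightarrow> label" and a b
      by (auto, blast)
    then show ?thesis
      unfolding labels_def by (simp only: Un_assoc)
  qed
  show "finite (labels p s)"
    unfolding eq by simp
  have inj: "inj_on (case_prod BP) A" "inj_on (case_prod XP) A" "inj_on (case_prod YP) A"
    "inj_on (case_prod AP) A" "inj_on (case_prod BM) A" "inj_on (case_prod XM) A"
    "inj_on (case_prod YM) A" "inj_on (case_prod AM) A" for A
    by (auto simp: inj_on_def)
  have "card (labels p s) = s * s + ((p - s) * s + ((p - s) * s + (s * s +
      ((p - s) * (p - s) + (s * (p - s) + (s * (p - s) + (p - s) * (p - s)))))))"
    unfolding eq
    by (subst card_Un_disjoint, simp, simp, (auto; fail))
      (subst card_Un_disjoint, simp, simp, (auto; fail),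
       subst card_Un_disjoint, simp, simp, (auto; fail), subst card_Un_disjoint, simp, simp, (auto; fail),
       subst card_Un_disjoint, simp, simp, (auto; fail), subst card_Un_disjoint, simp, simp, (auto; fail),
       subst card_Un_disjoint, simp, simp, (auto; fail), simp add: card_image inj)
  also obtain d where d: "p = s + d" using assms by (auto simp: le_iff_add)
  then have "s * s + ((p - s) * s + ((p - s) * s + (s * s +
      ((p - s) * (p - s) + (s * (p - s) + (s * (p - s) + (p - s) * (p - s))))))) = 2 * p ^ 2"
    by (simp add: power2_eq_square algebra_simps)
  finally show "card (labels p s) = 2 * p ^ 2" .
qed

text \<open>The matrix blocks reuse the labels \<open>AM\<close> at s = 0, where p - s = p, and
  \<open>AP\<close> at s = p, so that \<open>block_elt\<close> describes all p + 1 blocks.\<close>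

definition block_labels :: "nat \<Rightarrow> nat \<Rightarrow> label set" where
  "block_labels p s = (if s = 0 then case_prod AM ` ({..<p} \<times> {1..p})
    else if s = p then case_prod AP ` ({..<p} \<times> {1..p}) else labels p s)"

lemma finite_block_labels: "s \<le> p \<Longrightarrow> finite (block_labels p s)"
  by (simp add: block_labels_def card_labels)

lemma card_all_block_labels:
  assumes "p \<ge> 1"
  shows "card (Sigma {..p} (block_labels p)) = 2 * p ^ 3"
proof -
  have c: "card (block_labels p s) = (if s = 0 \<or> s = p then p ^ 2 else 2 * p ^ 2)" if "s \<le> p" for s
    using that by (auto simp: block_labels_def card_labels card_image inj_on_def power2_eq_square)
  have "{..p} = insert 0 (insert p {1..p - 1})"
    using assms by auto
  moreover have "card (Sigma {..p} (block_labels p)) = (\<Sum>s\<in>{..p}. card (block_labels p s))"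
    by (intro card_SigmaI) (auto simp: finite_block_labels)
  ultimately have "card (Sigma {..p} (block_labels p)) = p ^ 2 + (p ^ 2 + (\<Sum>s\<in>{1..p - 1}. card (block_labels p s)))"
    using assms by (simp add: c)
  also have "(\<Sum>s\<in>{1..p - 1}. card (block_labels p s)) = (\<Sum>s\<in>{1..p - 1}. 2 * p ^ 2)"
    using assms by (intro sum.cong) (auto simp: c)
  finally show ?thesis
    using assms by (cases p) (simp_all add: power2_eq_square power3_eq_cube algebra_simps)
qed

section \<open>Independent families and spanning by counting\<close>

context vector_space
begin

text \<open>Two indices with equal values would give a relation with coefficients 1 and -1, so
  injectivity comes along with independence.\<close>

lemma family_independent:
  assumes I: "finite I" and *: "\<And>c. (\<Sum>i\<in>I. c i *s f i) = 0 \<Longrightarrow> \<forall>i\<in>I. c i = 0"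
  shows "inj_on f I" "independent (f ` I)"
proof -
  show inj: "inj_on f I"
  proof (rule inj_onI, rule ccontr)
    fix i j assume ij: "i \<in> I" "j \<in> I" "f i = f j" "i \<noteq> j"
    define c where "c k = (if k = i then 1 else if k = j then - 1 else (0::'a))" for k
    have "(\<Sum>k\<in>I. c k *s f k) = (\<Sum>k\<in>{i, j}. c k *s f k)"
      using I ij by (intro sum.mono_neutral_right) (auto simp: c_def)
    also have "\<dots> = 0"
      using ij by (simp add: c_def)
    finally have "c i = 0"
      using * ij by blast
    then show False by (simp add: c_def)
  qed
  show "independent (f ` I)"
  proof (rule independent_if_scalars_zero)
    fix u x assume "(\<Sum>v\<in>f ` I. u v *s v) = 0" "x \<in> f ` I"
    then show "u x = 0"
      using *[of "u \<circ> f"] by (auto simp: sum.reindex[OF inj])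
  qed (use I in simp)
qed

text \<open>Exchange argument: a vector outside the span would enlarge the independent set beyond
  the size of T. The claim is relative to \<open>span T\<close>, as the ambient space may be
  larger.\<close>

lemma family_spans:
  assumes I: "finite I" and f: "inj_on f I" "independent (f ` I)"
    and T: "finite T" "card T \<le> card I" "f ` I \<subseteq> span T" and x: "x \<in> span T"
  shows "\<exists>c. x = (\<Sum>i\<in>I. c i *s f i)"
proof -
  have "x \<in> span (f ` I)"
  proof (rule ccontr)
    assume nx: "x \<notin> span (f ` I)"
    then have "independent (insert x (f ` I))"
      using f by (simp add: independent_insertI)
    from independent_span_bound[OF T(1) this] have "card (insert x (f ` I)) \<le> card T"
      using T x by auto
    moreover have "x \<notin> f ` I" using nx span_base by blast
    ultimately show False
      using T I f(1) by (simp add: card_image)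
  qed
  then obtain u where "x = (\<Sum>v\<in>f ` I. u v *s v)"
    using I by (auto simp: span_finite)
  then have "x = (\<Sum>i\<in>I. (u \<circ> f) i *s f i)"
    by (simp add: sum.reindex[OF f(1)])
  then show ?thesis by blast
qed

end

context uq_alg
begin

section \<open>Generalized eigenspaces of the Casimir element\<close>

definition N :: "complex \<Rightarrow> 'r" where "N c = Cas - c *s 1"

lemma N_comm: "N a * N b = N b * N a"
  by (simp add: N_def algebra_simps)

lemma N_pow_comm: "N a ^ n * (N b * y) = N b * (N a ^ n * y)"
  unfolding mult.assoc[symmetric] power_commuting_commutes[OF N_comm[of a b], of n] ..

lemma N_eigen: "N b * y = 0 \<Longrightarrow> N a ^ n * y = (b - a) ^ n *s y"
proof (induction n)
  case (Suc n)
  have "N a * y = N b * y + (b - a) *s y"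
    by (simp add: N_def left_diff_distrib vs.scale_left_diff_distrib)
  with Suc show ?case by (simp add: mult.assoc mult.commute)
qed simp

text \<open>By induction \<open>N b * y\<close> is zero, so y is an eigenvector, on which the power
  of \<open>N a\<close> is the nonzero scalar (b - a)^n.\<close>

lemma N_disjoint:
  assumes "a \<noteq> b"
  shows "N a ^ n * y = 0 \<Longrightarrow> N b ^ m * y = 0 \<Longrightarrow> y = 0"
proof (induction m arbitrary: y)
  case (Suc m)
  have "N b * y = 0"
  proof (rule Suc.IH)
    show "N a ^ n * (N b * y) = 0"
      unfolding N_pow_comm Suc.prems(1) by simp
    show "N b ^ m * (N b * y) = 0"
      using Suc.prems(2) unfolding power_Suc2 mult.assoc .
  qed
  then show ?case
    using N_eigen[of b y a n] Suc.prems(1) assms by simp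
qed simp

lemma N_pow_add: "N a ^ n * y = 0 \<Longrightarrow> N a ^ (m + n) * y = 0"
  by (simp add: power_add mult.assoc)

text \<open>A power of \<open>N (e a)\<close> removes the component at \<open>a\<close>. By
  induction it kills all the others too, and these then lie in two different generalized
  eigenspaces.\<close>

lemma eigen_sum:
  assumes "finite S" "inj_on e S" "\<And>s. s \<in> S \<Longrightarrow> \<exists>n. N (e s) ^ n * x s = 0" "(\<Sum>s\<in>S. x s) = 0"
  shows "\<forall>s\<in>S. x s = 0"
  using assms
proof (induction S arbitrary: x rule: finite_induct)
  case (insert a S)
  obtain n where n: "N (e a) ^ n * x a = 0" using insert.prems by auto
  have "(\<Sum>s\<in>S. N (e a) ^ n * x s) = N (e a) ^ n * (\<Sum>s\<in>insert a S. x s)"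
    unfolding sum_distrib_left using insert.hyps n by simp
  also have "\<dots> = 0"
    unfolding insert.prems(3) by simp
  finally have "(\<Sum>s\<in>S. N (e a) ^ n * x s) = 0" .
  moreover have "\<exists>m. N (e s) ^ m * (N (e a) ^ n * x s) = 0" if s: "s \<in> S" for s
  proof -
    obtain m where "N (e s) ^ m * x s = 0" using insert.prems s by auto
    moreover have comm: "N (e s) ^ m * N (e a) ^ n = N (e a) ^ n * N (e s) ^ m"
      by (intro power_commuting_commutes power_commuting_commutes[symmetric] N_comm)
    have "N (e s) ^ m * (N (e a) ^ n * x s) = N (e a) ^ n * (N (e s) ^ m * x s)"
      unfolding mult.assoc[symmetric] comm ..
    ultimately show ?thesis by auto
  qed
  ultimately have 0: "\<forall>s\<in>S. N (e a) ^ n * x s = 0"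
    using insert.IH[of "\<lambda>s. N (e a) ^ n * x s"] insert.prems(1) by (auto intro: inj_on_subset)
  have "x s = 0" if s: "s \<in> S" for s
  proof -
    obtain m where "N (e s) ^ m * x s = 0" using insert.prems s by auto
    moreover have "e a \<noteq> e s" using insert.prems(1) insert.hyps s by auto
    ultimately show ?thesis using N_disjoint 0 s by blast
  qed
  then show ?case
    using insert by simp
qed simp

lemma N_cas_eig: "N (cas_eig p (int s)) = Z 1 (int s)"
  by (simp add: N_def Z_def)

lemma N_square_block_elt:
  assumes s: "s \<le> p" and i: "i \<in> block_labels p s"
  shows "N (cas_eig p (int s)) ^ 2 * block_elt s i = 0"
proof -
  have Zm: "Z 1 (int s) = Z (- 1) (int (p - s))"
    using Z_flip_nat[OF s, of 1] by simp
  have one: "(1::complex) * 1 = 1" "(- 1 :: complex) * (- 1) = 1" by simp_all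
  have "Z 1 (int s) * (Z 1 (int s) * block_elt s i) = 0"
  proof (cases "s = 0 \<or> s = p")
    case True
    then show ?thesis
    proof
      assume "s = 0"
      with i obtain k u where "i = AM k u" "u \<le> p" by (auto simp: block_labels_def)
      then show ?thesis
        using Z_a0[OF one(2), of u p] \<open>s = 0\<close> unfolding Zm by (simp add: Ag_def)
    next
      assume "s = p"
      with i p0 obtain k u where "i = AP k u" "u \<le> p" by (auto simp: block_labels_def)
      then show ?thesis
        using Z_a0[OF one(1), of u p] \<open>s = p\<close> by (simp add: Ag_def)
    qed
  next
    case False
    then have "1 \<le> s" "s < p" using s by auto
    note P = B_right(3)[OF one(1) this] A_right(2)[OF one(1) this] X_right(2)[OF one(1) this]
      Y_right(2)[OF one(1) this]
    have "1 \<le> p - s" "p - s < p" using \<open>1 \<le> s\<close> \<open>s < p\<close> by auto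
    note M = B_right(3)[OF one(2) this] A_right(2)[OF one(2) this] X_right(2)[OF one(2) this]
      Y_right(2)[OF one(2) this]
    have pps: "p - (p - s) = s" using s by simp
    have i: "i \<in> labels p s" using i False by (simp add: block_labels_def)
    note rules = P M[unfolded pps minus_minus, folded Zm]
    show ?thesis
      using i
      by (cases i) (simp_all only: block_elt.simps Bg_def Ag_def Xg_def Yg_def Z_F_pow,
          auto simp: labels_def rules simp del: of_nat_diff smul_mult_right)
  qed
  then show ?thesis
    by (simp add: N_cas_eig power2_eq_square mult.assoc)
qed

end

section \<open>Spanning monomials and linear independence\<close>

lemma label_mult_closed:
  "i \<in> labels p s \<Longrightarrow> j \<in> labels p s \<Longrightarrow> label_mult i j = Some k \<Longrightarrow> k \<in> labels p s"
  by (cases i; cases j) (auto simp: labels_def split: if_splits)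

context uq_alg
begin

text \<open>The Poincare-Birkhoff-Witt monomials. Closure under left multiplication by the
  generators makes their span contain the image of the whole algebra.\<close>

definition PBW :: "'r set" where
  "PBW = vs.span ((\<lambda>(i, j, l). E ^ i * (F ^ j * K ^ l)) ` ({..<p} \<times> {..<p} \<times> {..<2 * p}))"

lemma PBW_subspace: "vs.subspace PBW"
  by (simp add: PBW_def)

lemmas PBW_add = vs.subspace_add[OF PBW_subspace]
  and PBW_diff = vs.subspace_diff[OF PBW_subspace]
  and PBW_smul = vs.subspace_scale[OF PBW_subspace]
  and PBW_sum = vs.subspace_sum[OF PBW_subspace]
  and PBW_0 = vs.subspace_0[OF PBW_subspace]

lemma PBW_monomial: "E ^ i * (F ^ j * K ^ l) \<in> PBW"
proof (cases "i < p \<and> j < p")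
  case True
  have "K ^ l = K ^ (2 * p * (l div (2 * p)) + l mod (2 * p))"
    by simp
  also have "\<dots> = K ^ (l mod (2 * p))"
    unfolding power_add power_mult[of K "2 * p"] K_power_2p by simp
  finally have "K ^ l = K ^ (l mod (2 * p))" .
  moreover have "E ^ i * (F ^ j * K ^ (l mod (2 * p))) \<in> PBW"
    unfolding PBW_def using True p0
    by (intro vs.span_base image_eqI[of _ _ "(i, j, l mod (2 * p))"]) auto
  ultimately show ?thesis by simp
next
  case False
  then have "E ^ i * (F ^ j * K ^ l) = 0"
    by (auto simp: E_kill F_kill not_less)
  then show ?thesis by (simp add: PBW_0)
qed

lemma PBW_left_mult:
  assumes "\<And>i j l. a * (E ^ i * (F ^ j * K ^ l)) \<in> PBW" "x \<in> PBW"
  shows "a * x \<in> PBW"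
  using assms(2) unfolding PBW_def
proof (induction rule: vs.span_induct_alt)
  case base
  then show ?case by (simp add: vs.span_zero)
next
  case (step c x y)
  then have "a * x \<in> PBW"
    using assms(1) by auto
  with step show ?case
    unfolding distrib_left smul_mult_right by (metis PBW_def PBW_add PBW_smul)
qed

lemma PBW_E: "x \<in> PBW \<Longrightarrow> E * x \<in> PBW"
proof (rule PBW_left_mult)
  show "E * (E ^ i * (F ^ j * K ^ l)) \<in> PBW" for i j l
    using PBW_monomial[of "Suc i" j l] by (simp add: mult.assoc)
qed

lemma K_E_pow: "K * (E ^ i * x) = (q p ^ (2 * i)) *s (E ^ i * (K * x))"
proof (induction i)
  case (Suc i)
  have "K * (E ^ Suc i * x) = (K * E) * (E ^ i * x)"
    by (simp add: mult.assoc)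
  also have "\<dots> = (q p ^ 2) *s (E * (K * (E ^ i * x)))"
    unfolding KE by (simp add: mult.assoc)
  finally show ?case
    unfolding Suc by (simp add: mult.assoc power2_eq_square)
qed simp

lemma K_F_pow: "K * (F ^ i * x) = (inverse (q p) ^ (2 * i)) *s (F ^ i * (K * x))"
proof (induction i)
  case (Suc i)
  have "K * (F ^ Suc i * x) = (K * F) * (F ^ i * x)"
    by (simp add: mult.assoc)
  also have "\<dots> = (inverse (q p) ^ 2) *s (F * (K * (F ^ i * x)))"
    unfolding KF by (simp add: mult.assoc)
  finally show ?case
    unfolding Suc by (simp add: mult.assoc power2_eq_square)
qed simp

lemma PBW_K: "x \<in> PBW \<Longrightarrow> K * x \<in> PBW"
proof (rule PBW_left_mult)
  show "K * (E ^ i * (F ^ j * K ^ l)) \<in> PBW" for i j l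
    unfolding K_E_pow K_F_pow smul_mult_right power_Suc[symmetric]
    by (intro PBW_smul PBW_monomial)
qed

lemma PBW_K_pow: "x \<in> PBW \<Longrightarrow> K ^ n * x \<in> PBW"
  by (induction n) (simp_all add: mult.assoc PBW_K)

lemma K'_eq: "K' = K ^ (2 * p - 1)"
proof -
  have "K' = K' * K ^ Suc (2 * p - 1)"
    using K_power_2p p0 by (simp del: power_Suc)
  also have "\<dots> = (K' * K) * K ^ (2 * p - 1)"
    by (simp add: mult.assoc)
  finally show ?thesis by (simp add: K'K)
qed

lemma PBW_K': "x \<in> PBW \<Longrightarrow> K' * x \<in> PBW"
  unfolding K'_eq by (rule PBW_K_pow)

text \<open>F is the generator that has to cross E: each crossing costs a term in K and K', already
  known to preserve the span.\<close>

lemma PBW_F: "x \<in> PBW \<Longrightarrow> F * x \<in> PBW"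
proof (rule PBW_left_mult)
  show "F * (E ^ i * (F ^ j * K ^ l)) \<in> PBW" for i j l
  proof (induction i)
    case 0
    then show ?case
      using PBW_monomial[of 0 "Suc j" l] by (simp add: mult.assoc)
  next
    case (Suc i)
    let ?y = "E ^ i * (F ^ j * K ^ l)"
    have "F * (E ^ Suc i * (F ^ j * K ^ l)) = (F * E) * ?y"
      by (simp add: mult.assoc)
    also have "\<dots> = E * (F * ?y) - (1 / (q p - inverse (q p))) *s (K * ?y - K' * ?y)"
      unfolding FE_eq left_diff_distrib smul_mult_left by (simp add: mult.assoc)
    also have "\<dots> \<in> PBW"
      by (intro PBW_diff PBW_smul PBW_E PBW_K PBW_K' PBW_monomial Suc)
    finally show ?case .
  qed
qed

lemma PBW_1: "1 \<in> PBW"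
  using PBW_monomial[of 0 0 0] by simp

lemma PBW_E_pow: "x \<in> PBW \<Longrightarrow> E ^ n * x \<in> PBW"
  by (induction n) (simp_all add: mult.assoc PBW_E)

lemma PBW_F_pow: "x \<in> PBW \<Longrightarrow> F ^ n * x \<in> PBW"
  by (induction n) (simp_all add: mult.assoc PBW_F)

lemma PBW_block_elt: "block_elt s i \<in> PBW"
proof -
  have V: "V \<alpha> k \<in> PBW" for \<alpha> k
    unfolding V_def using PBW_monomial[of 0 0] by (intro PBW_sum PBW_smul) simp
  have W: "W \<alpha> s t n \<in> PBW" for \<alpha> s t n
    unfolding W_def by (intro PBW_E_pow PBW_F_pow V)
  have a: "a0 \<alpha> s t \<in> PBW" and b: "b0 \<alpha> s t \<in> PBW" for \<alpha> s t
    unfolding a0_def b0_def by (intro PBW_sum PBW_smul W)+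
  have "Bg \<alpha> s t n \<in> PBW" "Ag \<alpha> s t n \<in> PBW" "Xg \<alpha> s t n \<in> PBW" "Yg \<alpha> s t n \<in> PBW" for \<alpha> s t n
    unfolding Bg_def Ag_def Xg_def Yg_def x0_def y0_def
    by (intro PBW_diff PBW_smul PBW_F_pow PBW_E_pow a b)+
  then show ?thesis by (cases i) simp_all
qed

text \<open>The sandwich argument. Terms whose coefficient is already known to vanish may survive
  the multiplication, which permits a treatment in stages.\<close>

lemma isolate:
  assumes I: "finite I" and sum: "(\<Sum>i\<in>I. c i *s f i) = 0" and j: "j \<in> I"
    and other: "\<And>i. i \<in> I \<Longrightarrow> i \<noteq> j \<Longrightarrow> c i = 0 \<or> l * f i * r = 0"
    and j': "l * f j * r \<noteq> 0"
  shows "c j = 0"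
proof -
  have "(\<Sum>i\<in>I. c i *s (l * f i * r)) = l * (\<Sum>i\<in>I. c i *s f i) * r"
    by (simp add: sum_distrib_left sum_distrib_right)
  also have "\<dots> = 0" unfolding sum by simp
  also have "(\<Sum>i\<in>I. c i *s (l * f i * r)) = (\<Sum>i\<in>{j}. c i *s (l * f i * r))"
    using I j other by (intro sum.mono_neutral_right) auto
  finally show ?thesis using j' by simp
qed

end

text \<open>The axioms of \<open>uq_alg\<close> also hold in collapsed quotients; this assumption
  excludes them and is discharged by \<open>longest_monomial_not_in_rel_ideal\<close>.\<close>

locale uq_alg_nonzero = uq_alg +
  assumes nonzero: "E ^ (p - 1) * (F ^ (p - 1) * V 1 k) \<noteq> 0"
begin

lemma Ag_nonzero: "1 \<le> s \<Longrightarrow> s \<le> p \<Longrightarrow> \<alpha> = 1 \<or> \<alpha> = - 1 \<Longrightarrow> Ag \<alpha> s 1 0 \<noteq> 0"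
  using a0_top_nonzero[OF nonzero] norm_gamma_nonzero[of \<alpha> s] by (auto simp: Ag_def)

lemma independent_labels:
  assumes s: "1 \<le> s" "s < p" and sum: "(\<Sum>i\<in>labels p s. c i *s block_elt s i) = 0"
  shows "\<forall>i\<in>labels p s. c i = 0"
proof -
  define tri where "tri l i r = (case label_mult l i of None \<Rightarrow> None | Some k \<Rightarrow> label_mult k r)" for l i r
  have tri: "block_elt s l * block_elt s i * block_elt s r = (case tri l i r of None \<Rightarrow> 0 | Some k \<Rightarrow> block_elt s k)"
    if "l \<in> labels p s" "i \<in> labels p s" "r \<in> labels p s" for l i r
    using that label_mult_closed[of l p s i]
    by (auto simp: tri_def block_elt_mult[OF s] split: option.splits)
  have fin: "finite (labels p s)" using card_labels s by simp
  have nz: "block_elt s (AP 0 1) \<noteq> 0" "block_elt s (AM 0 1) \<noteq> 0"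
    using Ag_nonzero[of s 1] Ag_nonzero[of "p - s" "- 1"] s by auto
  have *: "c j = 0"
    if "j \<in> labels p s" "l \<in> labels p s" "r \<in> labels p s" "tri l j r \<in> {Some (AP 0 1), Some (AM 0 1)}"
      "\<And>i. i \<in> labels p s \<Longrightarrow> i \<noteq> j \<Longrightarrow> c i = 0 \<or> tri l i r = None" for j l r
  proof (rule isolate[OF fin sum that(1), where l = "block_elt s l" and r = "block_elt s r"])
    fix i assume "i \<in> labels p s" "i \<noteq> j"
    then have "c i = 0 \<or> tri l i r = None" by (rule that(5))
    then show "c i = 0 \<or> block_elt s l * block_elt s i * block_elt s r = 0"
      using tri[OF that(2) \<open>i \<in> labels p s\<close> that(3)] by (metis option.case(1))
  next
    show "block_elt s l * block_elt s j * block_elt s r \<noteq> 0"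
      using that nz by (auto simp: tri)
  qed
  have labels_simps:
    "BP n t \<in> labels p s \<longleftrightarrow> n < s \<and> 1 \<le> t \<and> t \<le> s" "AP n t \<in> labels p s \<longleftrightarrow> n < s \<and> 1 \<le> t \<and> t \<le> s"
    "XP n t \<in> labels p s \<longleftrightarrow> n < p - s \<and> 1 \<le> t \<and> t \<le> s" "YP n t \<in> labels p s \<longleftrightarrow> n < p - s \<and> 1 \<le> t \<and> t \<le> s"
    "BM n t \<in> labels p s \<longleftrightarrow> n < p - s \<and> 1 \<le> t \<and> t \<le> p - s" "AM n t \<in> labels p s \<longleftrightarrow> n < p - s \<and> 1 \<le> t \<and> t \<le> p - s"
    "XM n t \<in> labels p s \<longleftrightarrow> n < s \<and> 1 \<le> t \<and> t \<le> p - s" "YM n t \<in> labels p s \<longleftrightarrow> n < s \<and> 1 \<le> t \<and> t \<le> p - s"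
    for n t
    by (auto simp: labels_def)
  \<comment> \<open>The left factor is chosen so that the product lands in the A part: A against B,
    Y against X, X against Y. Its second index n + 1 matches the lower index n, and the right factor
    with lower index t - 1 matches t.\<close>
  have BP: "c (BP n t) = 0" if "BP n t \<in> labels p s" for n t
  proof (rule *[OF that, of "AP 0 (n + 1)" "BP (t - 1) 1"])
    fix i assume "i \<in> labels p s" "i \<noteq> BP n t"
    then show "c i = 0 \<or> tri (AP 0 (n + 1)) i (BP (t - 1) 1) = None"
      using that by (cases i) (auto simp: tri_def labels_simps)
  qed (use that in \<open>auto simp: tri_def labels_simps\<close>)
  have XP: "c (XP n t) = 0" if "XP n t \<in> labels p s" for n t
  proof (rule *[OF that, of "YM 0 (n + 1)" "BP (t - 1) 1"])
    fix i assume "i \<in> labels p s" "i \<noteq> XP n t"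
    then show "c i = 0 \<or> tri (YM 0 (n + 1)) i (BP (t - 1) 1) = None"
      using that by (cases i) (auto simp: tri_def labels_simps)
  qed (use that in \<open>auto simp: tri_def labels_simps\<close>)
  have YP: "c (YP n t) = 0" if "YP n t \<in> labels p s" for n t
  proof (rule *[OF that, of "XM 0 (n + 1)" "BP (t - 1) 1"])
    fix i assume "i \<in> labels p s" "i \<noteq> YP n t"
    then show "c i = 0 \<or> tri (XM 0 (n + 1)) i (BP (t - 1) 1) = None"
      using that by (cases i) (auto simp: tri_def labels_simps)
  qed (use that in \<open>auto simp: tri_def labels_simps\<close>)
  have BM: "c (BM n t) = 0" if "BM n t \<in> labels p s" for n t
  proof (rule *[OF that, of "AM 0 (n + 1)" "BM (t - 1) 1"])
    fix i assume "i \<in> labels p s" "i \<noteq> BM n t"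
    then show "c i = 0 \<or> tri (AM 0 (n + 1)) i (BM (t - 1) 1) = None"
      using that by (cases i) (auto simp: tri_def labels_simps)
  qed (use that in \<open>auto simp: tri_def labels_simps\<close>)
  have XM: "c (XM n t) = 0" if "XM n t \<in> labels p s" for n t
  proof (rule *[OF that, of "YP 0 (n + 1)" "BM (t - 1) 1"])
    fix i assume "i \<in> labels p s" "i \<noteq> XM n t"
    then show "c i = 0 \<or> tri (YP 0 (n + 1)) i (BM (t - 1) 1) = None"
      using that by (cases i) (auto simp: tri_def labels_simps)
  qed (use that in \<open>auto simp: tri_def labels_simps\<close>)
  have YM: "c (YM n t) = 0" if "YM n t \<in> labels p s" for n t
  proof (rule *[OF that, of "XP 0 (n + 1)" "BM (t - 1) 1"])
    fix i assume "i \<in> labels p s" "i \<noteq> YM n t"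
    then show "c i = 0 \<or> tri (XP 0 (n + 1)) i (BM (t - 1) 1) = None"
      using that by (cases i) (auto simp: tri_def labels_simps)
  qed (use that in \<open>auto simp: tri_def labels_simps\<close>)
  \<comment> \<open>The B factors on both sides also preserve \<open>BP n t\<close>, so its
    coefficient must be known to vanish first.\<close>
  have AP: "c (AP n t) = 0" if "AP n t \<in> labels p s" for n t
  proof (rule *[OF that, of "BP 0 (n + 1)" "BP (t - 1) 1"])
    fix i assume "i \<in> labels p s" "i \<noteq> AP n t"
    then show "c i = 0 \<or> tri (BP 0 (n + 1)) i (BP (t - 1) 1) = None"
      using that BP by (cases i) (auto simp: tri_def labels_simps)
  qed (use that in \<open>auto simp: tri_def labels_simps\<close>)
  have AM: "c (AM n t) = 0" if "AM n t \<in> labels p s" for n t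
  proof (rule *[OF that, of "BM 0 (n + 1)" "BM (t - 1) 1"])
    fix i assume "i \<in> labels p s" "i \<noteq> AM n t"
    then show "c i = 0 \<or> tri (BM 0 (n + 1)) i (BM (t - 1) 1) = None"
      using that BM by (cases i) (auto simp: tri_def labels_simps)
  qed (use that in \<open>auto simp: tri_def labels_simps\<close>)
  show ?thesis
  proof
    fix i assume "i \<in> labels p s"
    then show "c i = 0"
      using BP XP YP AP BM XM YM AM by (cases i) auto
  qed
qed

lemma independent_top:
  assumes \<alpha>: "\<alpha> = 1 \<or> \<alpha> = - 1"
    and sum: "(\<Sum>(n, t)\<in>{..<p} \<times> {1..p}. c (n, t) *s Ag \<alpha> p t n) = 0"
    and nt: "n < p" "1 \<le> t" "t \<le> p"
  shows "c (n, t) = 0"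
proof (rule isolate[where f = "\<lambda>(n, t). Ag \<alpha> p t n" and I = "{..<p} \<times> {1..p}"
      and l = "Ag \<alpha> p (n + 1) 0" and r = "Ag \<alpha> p 1 (t - 1)"])
  have \<alpha>2: "\<alpha> * \<alpha> = 1" using \<alpha> by auto
  have m: "Ag \<alpha> p (n + 1) 0 * Ag \<alpha> p t' n' * Ag \<alpha> p 1 (t - 1)
      = (if n' = n \<and> t' = t then Ag \<alpha> p 1 0 else 0)" if "n' < p" "1 \<le> t'" "t' \<le> p" for n' t'
    using that nt by (simp add: Ag_top_mult[OF \<alpha>2]) auto
  show "c i = 0 \<or> Ag \<alpha> p (n + 1) 0 * (case i of (n, t) \<Rightarrow> Ag \<alpha> p t n) * Ag \<alpha> p 1 (t - 1) = 0"
    if "i \<in> {..<p} \<times> {1..p}" "i \<noteq> (n, t)" for i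
  proof -
    obtain a b where i: "i = (a, b)" by (cases i)
    with that have "a < p" "1 \<le> b" "b \<le> p" "\<not> (a = n \<and> b = t)" by auto
    with m[of a b] show ?thesis unfolding i by (simp only: if_False prod.case simp_thms)
  qed
  show "Ag \<alpha> p (n + 1) 0 * (case (n, t) of (n, t) \<Rightarrow> Ag \<alpha> p t n) * Ag \<alpha> p 1 (t - 1) \<noteq> 0"
    using m[OF nt] Ag_nonzero[OF p1 order.refl \<alpha>] by simp
  show "(\<Sum>i\<in>{..<p} \<times> {1..p}. c i *s (case i of (n, t) \<Rightarrow> Ag \<alpha> p t n)) = 0"
    using sum by (simp add: case_prod_beta')
qed (use nt in auto)

lemma independent_block:
  assumes s: "s \<le> p" and sum: "(\<Sum>i\<in>block_labels p s. c i *s block_elt s i) = 0"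
  shows "\<forall>i\<in>block_labels p s. c i = 0"
proof (cases "s = 0 \<or> s = p")
  case True
  then show ?thesis
  proof
    assume s': "s = 0"
    have bl: "block_labels p s = case_prod AM ` ({..<p} \<times> {1..p})"
      using s' p0 by (simp add: block_labels_def)
    have inj: "inj_on (case_prod AM) ({..<p} \<times> {1..p})" by (auto simp: inj_on_def)
    have "(\<Sum>(n, t)\<in>{..<p} \<times> {1..p}. (\<lambda>(n, t). c (AM n t)) (n, t) *s Ag (- 1) p t n)
        = (\<Sum>i\<in>block_labels p s. c i *s block_elt s i)"
      unfolding bl sum.reindex[OF inj] using s' by (intro sum.cong) auto
    note independent_top[OF disjI2[OF refl] this[unfolded sum]]
    then have "c (AM n t) = 0" if "n < p" "1 \<le> t" "t \<le> p" for n t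
      using that by (simp only: prod.case)
    then show ?thesis
      unfolding bl by auto
  next
    assume s': "s = p"
    have bl: "block_labels p s = case_prod AP ` ({..<p} \<times> {1..p})"
      using s' p0 by (simp add: block_labels_def)
    have inj: "inj_on (case_prod AP) ({..<p} \<times> {1..p})" by (auto simp: inj_on_def)
    have "(\<Sum>(n, t)\<in>{..<p} \<times> {1..p}. (\<lambda>(n, t). c (AP n t)) (n, t) *s Ag 1 p t n)
        = (\<Sum>i\<in>block_labels p s. c i *s block_elt s i)"
      unfolding bl sum.reindex[OF inj] using s' by (intro sum.cong) auto
    note independent_top[OF disjI1[OF refl] this[unfolded sum]]
    then have "c (AP n t) = 0" if "n < p" "1 \<le> t" "t \<le> p" for n t
      using that by (simp only: prod.case)
    then show ?thesis
      unfolding bl by auto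
  qed
next
  case False
  then have "block_labels p s = labels p s" by (simp add: block_labels_def)
  moreover have "1 \<le> s" "s < p" using False s by auto
  ultimately show ?thesis
    using independent_labels[of s c] sum by metis
qed

lemma N_square_combination:
  "s \<le> p \<Longrightarrow> N (cas_eig p (int s)) ^ 2 * (\<Sum>i\<in>block_labels p s. c i *s block_elt s i) = 0"
  by (simp add: sum_distrib_left N_square_block_elt)

lemma inj_cas_eig: "inj_on (\<lambda>s. cas_eig p (int s)) {..p}"
  by (rule inj_onI, rule cas_eig_inj[OF p2]) simp_all

lemma independent_all:
  assumes "(\<Sum>(s, i)\<in>Sigma {..p} (block_labels p). c (s, i) *s block_elt s i) = 0"
  shows "\<forall>si\<in>Sigma {..p} (block_labels p). c si = 0"
proof -
  have "(\<Sum>s\<in>{..p}. \<Sum>i\<in>block_labels p s. c (s, i) *s block_elt s i) = 0"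
    using assms by (subst sum.Sigma) (auto simp: finite_block_labels)
  moreover have "\<exists>n. N (cas_eig p (int s)) ^ n * (\<Sum>i\<in>block_labels p s. c (s, i) *s block_elt s i) = 0"
    if "s \<in> {..p}" for s
    using that by (intro exI[of _ 2] N_square_combination) simp
  ultimately have "\<forall>s\<in>{..p}. (\<Sum>i\<in>block_labels p s. c (s, i) *s block_elt s i) = 0"
    by (intro eigen_sum[OF finite_atMost inj_cas_eig])
  note 0 = this
  show ?thesis
  proof
    fix si assume "si \<in> Sigma {..p} (block_labels p)"
    then obtain s i where si: "si = (s, i)" "s \<le> p" "i \<in> block_labels p s" by auto
    have "\<forall>i\<in>block_labels p s. c (s, i) = 0"
      using 0 si by (intro independent_block) simp_all
    then show "c si = 0"
      using si by simp
  qed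
qed

text \<open>By counting, the elements of all blocks together span \<open>PBW\<close>. If x belongs
  to block s, subtracting x from its own component gives generalized eigenvectors with sum zero;
  each is zero, so x equals its component.\<close>

lemma block_span:
  assumes s: "s \<le> p" and x: "x \<in> PBW" and n: "N (cas_eig p (int s)) ^ n * x = 0"
  shows "\<exists>c. x = (\<Sum>i\<in>block_labels p s. c i *s block_elt s i)"
proof -
  let ?I = "Sigma {..p} (block_labels p)" and ?f = "\<lambda>(s, i). block_elt s i"
  let ?T = "(\<lambda>(i, j, l). E ^ i * (F ^ j * K ^ l)) ` ({..<p} \<times> {..<p} \<times> {..<2 * p})"
  have fin: "finite ?I" by (auto simp: finite_block_labels)
  have indep: "inj_on ?f ?I" "vs.independent (?f ` ?I)"
    by (rule vs.family_independent[OF fin]; rule independent_all; simp add: case_prod_beta')+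
  have "card ?T \<le> card ({..<p} \<times> {..<p} \<times> {..<2 * p})"
    by (rule card_image_le) simp
  also have "\<dots> = card ?I"
    using card_all_block_labels[OF p1] by (simp add: power3_eq_cube)
  finally have T: "card ?T \<le> card ?I" .
  have "?f ` ?I \<subseteq> vs.span ?T"
    using PBW_block_elt unfolding PBW_def by auto
  from vs.family_spans[OF fin indep _ T this x[unfolded PBW_def]]
  obtain c where "x = (\<Sum>si\<in>?I. c si *s ?f si)" by auto
  then have c: "x = (\<Sum>s\<in>{..p}. \<Sum>i\<in>block_labels p s. c (s, i) *s block_elt s i)"
    by (subst sum.Sigma) (auto simp: finite_block_labels case_prod_beta')
  define X where "X s = (\<Sum>i\<in>block_labels p s. c (s, i) *s block_elt s i)" for s
  define y where "y r = X r - (if r = s then x else 0)" for r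
  have "(\<Sum>r\<in>{..p}. y r) = 0"
    using s by (simp add: y_def sum_subtractf X_def flip: c)
  moreover have "\<exists>m. N (cas_eig p (int r)) ^ m * y r = 0" if "r \<in> {..p}" for r
  proof -
    have "N (cas_eig p (int r)) ^ 2 * X r = 0"
      unfolding X_def using that by (intro N_square_combination) simp
    then have "N (cas_eig p (int r)) ^ (n + 2) * X r = 0"
      by (rule N_pow_add)
    moreover have "N (cas_eig p (int s)) ^ (n + 2) * x = 0"
      using N_pow_add[OF n, of 2] by (simp add: add.commute)
    ultimately have "N (cas_eig p (int r)) ^ (n + 2) * y r = 0"
      unfolding y_def right_diff_distrib by (simp del: power_add add_2_eq_Suc')
    then show ?thesis by blast
  qed
  ultimately have "y s = 0"
    using eigen_sum[OF _ inj_cas_eig, of y] s by auto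
  then show ?thesis
    by (auto simp: y_def X_def)
qed

end

section \<open>Scalars and induction in the free algebra\<close>

lemma additive_induct [case_names zero single add]:
  fixes x :: "'a \<Rightarrow>\<^sub>0 'b::ab_group_add"
  assumes "P 0" "\<And>w c. P (Poly_Mapping.single w c)" "\<And>x y. P x \<Longrightarrow> P y \<Longrightarrow> P (x + y)"
  shows "P x"
proof (induction x rule: update_induct)
  case (update f a b)
  have "Poly_Mapping.update a b f = f + Poly_Mapping.single a b"
    using update(1)
    by (intro poly_mapping_eqI) (auto simp: lookup_update lookup_add lookup_single in_keys_iff when_def)
  with update assms show ?case by metis
qed (rule assms)

lemma scal_add: "scal (c + d) = scal c + scal d"
  by (simp add: scal_def single_add)

lemma scal_mult: "scal (c * d) = scal c * scal d"
  by (simp add: scal_def mult_single)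

lemma scal_1 [simp]: "scal 1 = 1"
  by (simp add: scal_def)

lemma scal_0 [simp]: "scal 0 = 0"
  by (simp add: scal_def)

lemma scal_central: "x * scal c = scal c * x"
  by (induction x rule: additive_induct) (simp_all add: scal_def mult_single distrib_left distrib_right mult.commute)

lemma free_alg_induct [case_names scal add gen]:
  assumes "\<And>c. P (scal c)" "\<And>x y. P x \<Longrightarrow> P y \<Longrightarrow> P (x + y)" "\<And>g x. P x \<Longrightarrow> P (gen g * x)"
  shows "P x"
proof (induction x rule: additive_induct)
  case (single w c)
  obtain l where w: "w = Word l" by (cases w)
  have "P (Poly_Mapping.single (Word l) c)"
  proof (induction l)
    case Nil
    then show ?case using assms(1)[of c] by (simp add: scal_def zero_free_monoid_def)
  next
    case (Cons g l)
    have "Poly_Mapping.single (Word (g # l)) c = gen g * Poly_Mapping.single (Word l) c"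
      by (simp add: gen_def mult_single)
    with Cons assms(3) show ?case by simp
  qed
  then show ?case by (simp add: w)
qed (use assms(1)[of 0] assms(2) in auto)

section \<open>The defining ideal\<close>

lemma rel_ideal_ideal: "ideal (rel_ideal p) class_ring"
  unfolding rel_ideal_def by (rule ring.genideal_ideal[OF class_ring.ring_axioms]) simp

lemma rel_ideal_relators: "r \<in> relators p \<Longrightarrow> r \<in> rel_ideal p"
  unfolding rel_ideal_def using ring.genideal_self[OF class_ring.ring_axioms, of "relators p"] by auto

lemma rel_ideal_0: "0 \<in> rel_ideal p"
  using additive_subgroup.zero_closed[OF ideal.axioms(1)[OF rel_ideal_ideal]] by simp

lemma rel_ideal_add: "x \<in> rel_ideal p \<Longrightarrow> y \<in> rel_ideal p \<Longrightarrow> x + y \<in> rel_ideal p"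
  using additive_subgroup.a_closed[OF ideal.axioms(1)[OF rel_ideal_ideal], of x p y] by simp

lemma rel_ideal_left: "x \<in> rel_ideal p \<Longrightarrow> a * x \<in> rel_ideal p"
  using ideal.I_l_closed[OF rel_ideal_ideal, of x p a] by simp

lemma rel_ideal_right: "x \<in> rel_ideal p \<Longrightarrow> x * a \<in> rel_ideal p"
  using ideal.I_r_closed[OF rel_ideal_ideal, of x p a] by simp

lemma rel_ideal_uminus: "x \<in> rel_ideal p \<Longrightarrow> - x \<in> rel_ideal p"
  using rel_ideal_left[of x p "- 1"] by simp

lemma rel_ideal_diff: "x \<in> rel_ideal p \<Longrightarrow> y \<in> rel_ideal p \<Longrightarrow> x - y \<in> rel_ideal p"
  using rel_ideal_add[of x p "- y"] rel_ideal_uminus[of y p] by simp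

lemma rel_ideal_minimal:
  assumes "0 \<in> J" "\<And>x y. x \<in> J \<Longrightarrow> y \<in> J \<Longrightarrow> x + y \<in> J" "\<And>a x. x \<in> J \<Longrightarrow> a * x \<in> J"
    "\<And>a x. x \<in> J \<Longrightarrow> x * a \<in> J" "relators p \<subseteq> J"
  shows "rel_ideal p \<subseteq> J"
proof -
  have "- x \<in> J" if "x \<in> J" for x
    using assms(3)[OF that, of "- 1"] by simp
  moreover have "inv\<^bsub>add_monoid class_ring\<^esub> x = - x" for x :: free_alg
    using class_ring_simps by (metis a_inv_def)
  ultimately have "ideal J class_ring"
    using assms by (intro idealI class_ring.ring_axioms subgroup.intro) auto
  then show ?thesis
    unfolding rel_ideal_def using assms(5) by (intro ring.genideal_minimal[OF class_ring.ring_axioms]) auto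
qed

section \<open>Modules over the free algebra\<close>

fun word_act :: "(gen \<Rightarrow> 'v \<Rightarrow> 'v) \<Rightarrow> gen free_monoid \<Rightarrow> 'v \<Rightarrow> 'v" where
  "word_act g (Word w) v = foldr g w v"

text \<open>By freeness any four linear operators define an action; the relations are tested
  afterwards, modulo an invariant subspace.\<close>

locale free_alg_module = vector_space m
  for m :: "complex \<Rightarrow> 'v::ab_group_add \<Rightarrow> 'v" +
  fixes g :: "gen \<Rightarrow> 'v \<Rightarrow> 'v"
  assumes g_add: "g a (x + y) = g a x + g a y"
    and g_scale: "g a (m c x) = m c (g a x)"
begin

definition act :: "free_alg \<Rightarrow> 'v \<Rightarrow> 'v" where
  "act x v = (\<Sum>w\<in>Poly_Mapping.keys x. m (Poly_Mapping.lookup x w) (word_act g w v))"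

lemma act_add: "act (x + y) v = act x v + act y v"
  unfolding act_def by (rule setsum_keys_plus_distrib) (simp_all add: scale_left_distrib)

lemma act_single: "act (Poly_Mapping.single w c) v = m c (word_act g w v)"
  by (simp add: act_def)

lemma act_0 [simp]: "act 0 v = 0"
  by (simp add: act_def)

lemma g_0: "g a 0 = 0"
  using g_scale[of a 0 0] by simp

lemma act_gen: "act (gen a * x) v = g a (act x v)"
proof (induction x rule: additive_induct)
  case (single w c)
  then show ?case by (cases w) (simp add: gen_def mult_single act_single g_scale)
qed (simp_all add: distrib_left act_add g_add g_0)

lemma act_scal_mult: "act (scal c * x) v = m c (act x v)"
proof (induction x rule: additive_induct)
  case (single w d)
  then show ?case by (simp add: scal_def mult_single act_single)
qed (simp_all add: distrib_left act_add scale_right_distrib)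

lemma act_scal: "act (scal c) v = m c v"
  by (simp add: scal_def act_single zero_free_monoid_def)

lemma act_1: "act 1 v = v"
  using act_scal[of 1 v] by simp

lemma act_mult: "act (x * y) v = act x (act y v)"
proof (induction x rule: free_alg_induct)
  case (gen a x)
  then show ?case by (simp add: act_gen mult.assoc)
qed (simp_all add: act_scal act_scal_mult act_add distrib_right)

lemma act_v_scale: "act x (m c v) = m c (act x v)"
  by (induction x rule: free_alg_induct)
     (simp_all add: act_scal act_add act_gen g_scale scale_right_distrib mult.commute)

lemma act_v_0 [simp]: "act x 0 = 0"
  using act_v_scale[of x 0 0] by simp

lemma act_uminus: "act (- x) v = - act x v"
  using act_add[of x "- x" v] by (simp add: eq_neg_iff_add_eq_0 add.commute)

lemma act_diff: "act (x - y) v = act x v - act y v"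
  using act_add[of x "- y" v] by (simp add: act_uminus)

lemma act_sum: "act (sum f A) v = (\<Sum>i\<in>A. act (f i) v)"
  by (induction A rule: infinite_finite_induct) (simp_all add: act_add)

lemma act_power: "act (x ^ n) v = (act x ^^ n) v"
  by (induction n arbitrary: v) (simp_all add: act_1 act_mult)

lemma act_gen': "act (gen a) = g a"
  using act_gen[of a 1] by (simp add: fun_eq_iff act_1)

lemma act_invariant:
  assumes "subspace S" "\<And>a v. v \<in> S \<Longrightarrow> g a v \<in> S" "v \<in> S"
  shows "act x v \<in> S"
  by (induction x rule: free_alg_induct)
     (simp_all add: act_scal act_add act_gen assms subspace_add subspace_scale)

text \<open>Says that the quotient by S is a module over the restricted quantum group, without
  forming that quotient.\<close>

lemma act_rel_ideal:
  assumes S: "subspace S" "\<And>a v. v \<in> S \<Longrightarrow> g a v \<in> S"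
    and r: "\<And>r v. r \<in> relators p \<Longrightarrow> act r v \<in> S" and x: "x \<in> rel_ideal p"
  shows "act x v \<in> S"
proof -
  have "rel_ideal p \<subseteq> {x. \<forall>v. act x v \<in> S}"
    by (rule rel_ideal_minimal)
       (auto simp: act_add act_mult r act_invariant[OF S] subspace_0[OF S(1)] intro: subspace_add[OF S(1)])
  with x show ?thesis by auto
qed

end

section \<open>The augmentation\<close>

text \<open>The counit: the one-dimensional module with E = F = 0 and K = 1.\<close>

definition aug_act :: "gen \<Rightarrow> complex \<Rightarrow> complex" where
  "aug_act a c = (if a \<in> {Gen_E, Gen_F} then 0 else c)"

interpretation aug: free_alg_module "(*)" aug_act
  by unfold_locales (auto simp: algebra_simps aug_act_def)

definition eps :: "free_alg \<Rightarrow> complex" where "eps x = aug.act x 1"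

lemma aug_act_eps: "aug.act x c = eps x * c"
  using aug.act_v_scale[of x c 1] by (simp add: eps_def)

lemma eps_mult: "eps (x * y) = eps x * eps y"
  by (simp add: eps_def aug.act_mult) (simp add: aug_act_eps)

lemma eps_add: "eps (x + y) = eps x + eps y"
  by (simp add: eps_def aug.act_add)

lemma eps_diff: "eps (x - y) = eps x - eps y"
  by (simp add: eps_def aug.act_diff)

lemma eps_scal [simp]: "eps (scal c) = c"
  by (simp add: eps_def aug.act_scal)

lemma eps_1 [simp]: "eps 1 = 1"
  using eps_scal[of 1] by simp

lemma eps_power: "eps (x ^ n) = eps x ^ n"
  by (induction n) (simp_all add: eps_mult)

lemma eps_gen [simp]: "eps gE = 0" "eps gF = 0" "eps gK = 1" "eps gKinv = 1"
  by (simp_all add: eps_def aug.act_gen' aug_act_def)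

lemma eps_rel_ideal:
  assumes "p \<ge> 2" "x \<in> rel_ideal p"
  shows "eps x = 0"
proof -
  have "aug.act x 1 \<in> {0}"
  proof (rule aug.act_rel_ideal[OF _ _ _ assms(2)])
    show "aug.subspace {0}" by (rule aug.subspace_single_0)
    show "aug.act r v \<in> {0}" if "r \<in> relators p" for r v
      using that assms(1)
      by (auto simp: aug_act_eps relators_def eps_diff eps_mult eps_power power_0_left)
  qed (auto simp: aug_act_def)
  then show ?thesis by (simp add: eps_def)
qed

section \<open>All restricted quantum groups at once\<close>

text \<open>A quotient type cannot depend on \<^term>\<open>p\<close>, so this is the product over all \<^term>\<open>p\<close> of the
  algebras in question. For fixed \<^term>\<open>p \<ge> 2\<close> the augmentation supplies the other components of
  a unital embedding of the \<^term>\<open>p\<close>-th factor, so that identities can be checked in a ring type.\<close>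

quotient_type total = "nat \<Rightarrow> free_alg" / "\<lambda>f g. \<forall>p. f p - g p \<in> rel_ideal p"
proof (rule equivpI)
  show "reflp (\<lambda>f g. \<forall>p. f p - g p \<in> rel_ideal p)"
    by (auto intro!: reflpI rel_ideal_0)
  show "symp (\<lambda>f g. \<forall>p. f p - g p \<in> rel_ideal p)"
    using rel_ideal_uminus by (fastforce intro!: sympI)
  show "transp (\<lambda>f g. \<forall>p. f p - g p \<in> rel_ideal p)"
  proof (rule transpI, rule allI)
    fix f g h p assume "\<forall>p. f p - g p \<in> rel_ideal p" "\<forall>p. g p - h p \<in> rel_ideal p"
    then have "(f p - g p) + (g p - h p) \<in> rel_ideal p"
      by (intro rel_ideal_add) auto
    then show "f p - h p \<in> rel_ideal p" by simp
  qed
qed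

instantiation total :: ring_1
begin

lift_definition zero_total :: total is "\<lambda>_. 0" .
lift_definition one_total :: total is "\<lambda>_. 1" .

lift_definition plus_total :: "total \<Rightarrow> total \<Rightarrow> total" is "\<lambda>f g p. f p + g p"
proof -
  fix f f' g g' :: "nat \<Rightarrow> free_alg" and p
  assume "\<And>p. f p - f' p \<in> rel_ideal p" "\<And>p. g p - g' p \<in> rel_ideal p"
  then have "(f p - f' p) + (g p - g' p) \<in> rel_ideal p" by (intro rel_ideal_add) auto
  then show "f p + g p - (f' p + g' p) \<in> rel_ideal p" by (simp add: algebra_simps)
qed

lift_definition uminus_total :: "total \<Rightarrow> total" is "\<lambda>f p. - f p"
proof -
  fix f f' :: "nat \<Rightarrow> free_alg" and p
  assume "\<And>p. f p - f' p \<in> rel_ideal p"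
  then have "- (f p - f' p) \<in> rel_ideal p" by (intro rel_ideal_uminus) auto
  then show "- f p - - f' p \<in> rel_ideal p" by simp
qed

definition minus_total :: "total \<Rightarrow> total \<Rightarrow> total" where
  "minus_total x y = x + - y"

lift_definition times_total :: "total \<Rightarrow> total \<Rightarrow> total" is "\<lambda>f g p. f p * g p"
proof -
  fix f f' g g' :: "nat \<Rightarrow> free_alg" and p
  assume "\<And>p. f p - f' p \<in> rel_ideal p" "\<And>p. g p - g' p \<in> rel_ideal p"
  then have "(f p - f' p) * g p + f' p * (g p - g' p) \<in> rel_ideal p"
    by (intro rel_ideal_add rel_ideal_left rel_ideal_right) auto
  then show "f p * g p - f' p * g' p \<in> rel_ideal p" by (simp add: algebra_simps)
qed

instance
proof
  fix a b c :: total
  show "a + b + c = a + (b + c)"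
    by transfer (auto simp: algebra_simps rel_ideal_0)
  show "a + b = b + a"
    by transfer (auto simp: algebra_simps rel_ideal_0)
  show "0 + a = a"
    by transfer (auto simp: rel_ideal_0)
  show "- a + a = 0"
    by transfer (auto simp: rel_ideal_0)
  show "a - b = a + - b"
    by (simp add: minus_total_def)
  show "a * b * c = a * (b * c)"
    by transfer (auto simp: mult.assoc rel_ideal_0)
  show "(a + b) * c = a * c + b * c"
    by transfer (auto simp: algebra_simps rel_ideal_0)
  show "a * (b + c) = a * b + a * c"
    by transfer (auto simp: algebra_simps rel_ideal_0)
  show "1 * a = a" "a * 1 = a"
    by (transfer; auto simp: rel_ideal_0)+
  show "(0::total) \<noteq> 1"
  proof transfer
    show "\<not> (\<forall>p. (0::free_alg) - 1 \<in> rel_ideal p)"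
      using eps_rel_ideal[of 2 "0 - 1"] eps_add[of "0 - 1" 1] eps_scal[of 0]
      by (intro notI) (drule spec[of _ 2], auto)
  qed
qed

end

definition comp_emb :: "nat \<Rightarrow> free_alg \<Rightarrow> total" where
  "comp_emb p x = abs_total (\<lambda>p'. if p' = p then x else scal (eps x))"

text \<open>The components other than p only see \<open>eps\<close>, and \<open>eps\<close> vanishes
  on the ideal of p, so component p decides equality.\<close>

lemma comp_emb_eq_iff:
  assumes "p \<ge> 2"
  shows "comp_emb p x = comp_emb p y \<longleftrightarrow> x - y \<in> rel_ideal p"
proof -
  have "eps x = eps y" if "x - y \<in> rel_ideal p"
    using eps_rel_ideal[OF assms that] by (simp add: eps_diff)
  then show ?thesis
    unfolding comp_emb_def total.abs_eq_iff by (auto simp: rel_ideal_0)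
qed

lemma comp_emb_add: "comp_emb p (x + y) = comp_emb p x + comp_emb p y"
  unfolding comp_emb_def plus_total.abs_eq total.abs_eq_iff by (simp add: eps_add scal_add rel_ideal_0)

lemma comp_emb_mult: "comp_emb p (x * y) = comp_emb p x * comp_emb p y"
  unfolding comp_emb_def times_total.abs_eq total.abs_eq_iff by (simp add: eps_mult scal_mult rel_ideal_0)

lemma comp_emb_1: "comp_emb p 1 = 1"
  unfolding comp_emb_def one_total.abs_eq total.abs_eq_iff by (simp add: rel_ideal_0)

text \<open>Every component of the image is the scalar c itself, so it commutes with all of
  \<open>total\<close> and not only with the image.\<close>

lemma comp_emb_scal_central: "x * comp_emb p (scal c) = comp_emb p (scal c) * x"
proof -
  obtain f where f: "x = abs_total f"
    using total.abs_induct[of "\<lambda>x. \<exists>f. x = abs_total f" x] by blast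
  show ?thesis
    unfolding f comp_emb_def times_total.abs_eq total.abs_eq_iff
    by (simp add: scal_central rel_ideal_0)
qed

section \<open>A graded module on which the longest monomials act non-trivially\<close>

text \<open>On the universal module generated by a vector of weight \<open>q^k\<close>, the vectors \<open>E^d u\<close> and
  \<open>F^d u\<close> generate a free module over the polynomials in the Casimir element, apart from
  \<open>E^p = F^p = 0\<close>. Degree \<open>d\<close> of \<^term>\<open>f\<close> stands for \<open>f(d)(C) E^d u\<close> or \<open>f(d)(C) F^-d u\<close>.\<close>

lemma scale_fun_vector_space: "vector_space (\<lambda>(c::complex) (f :: int \<Rightarrow> complex poly) d. Polynomial.smult c (f d))"
  by unfold_locales (auto simp: fun_eq_iff smult_add_right smult_add_left)

text \<open>With the Casimir element as variable, \<open>lin p k d\<close> is the action of F E in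
  degree d, and \<open>lin p k (d - 1)\<close> that of E F.\<close>

definition lin :: "nat \<Rightarrow> int \<Rightarrow> int \<Rightarrow> complex poly" where
  "lin p k d = [:- cas_eig p (k + 2 * d + 1), 1:]"

primrec wact :: "nat \<Rightarrow> int \<Rightarrow> gen \<Rightarrow> (int \<Rightarrow> complex poly) \<Rightarrow> int \<Rightarrow> complex poly" where
  "wact p k Gen_E = (\<lambda>f d. (if d > 0 then 1 else lin p k (d - 1)) * f (d - 1))"
| "wact p k Gen_F = (\<lambda>f d. (if d < 0 then 1 else lin p k d) * f (d + 1))"
| "wact p k Gen_K = (\<lambda>f d. Polynomial.smult (q_pow p (k + 2 * d)) (f d))"
| "wact p k Gen_Kinv = (\<lambda>f d. Polynomial.smult (q_pow p (- (k + 2 * d))) (f d))"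

text \<open>The polynomial that E^p = F^p = 0 forces to act as zero in degree d: E^p F^(p-d) u is
  this product times E^d u for 0 \<le> d < p, and F^p E^(p+d) u is this product times F^-d u for -p
  < d < 0. In degrees of absolute value at least p it is the empty product 1.\<close>

definition ann :: "nat \<Rightarrow> int \<Rightarrow> int \<Rightarrow> complex poly" where
  "ann p k d = (if d \<ge> 0 then \<Prod>j\<in>{d - int p..- 1}. lin p k j else \<Prod>j\<in>{0..int p + d - 1}. lin p k j)"

lemma lin_periodic: "p > 0 \<Longrightarrow> lin p k (j - int p) = lin p k j"
proof -
  assume p: "p > 0"
  have "q_pow p (k + 2 * (j - int p) + 1) = q_pow p (k + 2 * j + 1)"
    "q_pow p (- (k + 2 * (j - int p) + 1)) = q_pow p (- (k + 2 * j + 1))"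
    using p by (simp_all add: q_pow_eq_iff)
  then show ?thesis by (simp add: lin_def cas_eig_def)
qed

lemma lin_periodic': "p > 0 \<Longrightarrow> lin p k (j + int p) = lin p k j"
  using lin_periodic[of p k "j + int p"] by simp

text \<open>At d = 0 the conditions from E^p and F^p agree, since the linear factors have period
  p.\<close>

lemma ann_nonpos:
  assumes "p > 0" "d \<le> 0"
  shows "ann p k d = (\<Prod>j\<in>{0..int p + d - 1}. lin p k j)"
proof (cases "d = 0")
  case True
  have "(\<Prod>j\<in>{- int p..- 1}. lin p k j) = (\<Prod>j\<in>{0..int p - 1}. lin p k j)"
    by (rule prod.reindex_bij_witness[of _ "\<lambda>j. j - int p" "\<lambda>j. j + int p"])
       (auto simp: lin_periodic'[OF assms(1)])
  with True show ?thesis by (simp add: ann_def)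
qed (use assms in \<open>simp add: ann_def\<close>)

interpretation wm: free_alg_module "\<lambda>(c::complex) (f :: int \<Rightarrow> complex poly) d. Polynomial.smult c (f d)" "wact p k"
  for p k
proof -
  interpret vector_space "\<lambda>(c::complex) (f :: int \<Rightarrow> complex poly) d. Polynomial.smult c (f d)"
    by (rule scale_fun_vector_space)
  show "free_alg_module (\<lambda>(c::complex) (f :: int \<Rightarrow> complex poly) d. Polynomial.smult c (f d)) (wact p k)"
  proof
    fix a x y c
    show "wact p k a (x + y) = wact p k a x + wact p k a y"
      by (cases a) (auto simp: fun_eq_iff smult_add_right distrib_left)
    show "wact p k a (\<lambda>d. Polynomial.smult c (x d)) = (\<lambda>d. Polynomial.smult c (wact p k a x d))"
      by (cases a) (auto simp: fun_eq_iff mult.commute)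
  qed
qed

lemma wact_E_pow:
  "(wact p k Gen_E ^^ n) f d = (\<Prod>j\<in>{d - int n..min (d - 1) (- 1)}. lin p k j) * f (d - int n)"
proof (induction n arbitrary: d)
  case (Suc n)
  have "(if d > 0 then 1 else lin p k (d - 1)) * (\<Prod>j\<in>{d - 1 - int n..min (d - 2) (- 1)}. lin p k j)
    = (\<Prod>j\<in>{d - int (Suc n)..min (d - 1) (- 1)}. lin p k j)"
  proof (cases "d > 0")
    case True
    then have "min (d - 2) (- 1) = - 1" "min (d - 1) (- 1) = - 1" by auto
    with True show ?thesis by (simp add: algebra_simps)
  next
    case False
    then have "{d - int (Suc n)..min (d - 1) (- 1)} = insert (d - 1) {d - 1 - int n..min (d - 2) (- 1)}"
      by auto
    with False show ?thesis by simp
  qed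
  then show ?case
    using Suc[of "d - 1"] by (simp add: algebra_simps flip: mult.assoc)
qed simp

lemma wact_F_pow:
  "(wact p k Gen_F ^^ n) f d = (\<Prod>j\<in>{max d 0..d + int n - 1}. lin p k j) * f (d + int n)"
proof (induction n arbitrary: d)
  case (Suc n)
  have "(if d < 0 then 1 else lin p k d) * (\<Prod>j\<in>{max (d + 1) 0..d + 1 + int n - 1}. lin p k j)
    = (\<Prod>j\<in>{max d 0..d + int (Suc n) - 1}. lin p k j)"
  proof (cases "d < 0")
    case True
    then have "max (d + 1) 0 = 0" "max d 0 = 0" by auto
    with True show ?thesis by (simp add: algebra_simps)
  next
    case False
    then have "{max d 0..d + int (Suc n) - 1} = insert d {max (d + 1) 0..d + 1 + int n - 1}"
      by auto
    with False show ?thesis by simp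
  qed
  then show ?case
    using Suc[of "d + 1"] by (simp add: algebra_simps flip: mult.assoc)
qed simp

text \<open>Stability under E of the vectors divisible by \<open>ann\<close> in each degree. For d >
  0 the interval of factors only shrinks from d - 1 to d; otherwise the factor
  \<open>lin (d - 1)\<close> contributed by E equals the missing one at p + d - 1 by
  periodicity.\<close>

lemma ann_E:
  assumes "p > 0"
  shows "ann p k d dvd (if d > 0 then 1 else lin p k (d - 1)) * ann p k (d - 1)"
proof (cases "d > 0")
  case True
  then show ?thesis
    by (auto simp: ann_def intro!: prod_dvd_prod_subset)
next
  case False
  have "lin p k (d - 1) = lin p k (int p + d - 1)"
    using lin_periodic[OF assms, of k "int p + d - 1"] by simp
  moreover have "ann p k d dvd lin p k (int p + d - 1) * (\<Prod>j\<in>{0..int p + d - 2}. lin p k j)"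
  proof (cases "int p + d - 1 \<ge> 0")
    case True
    then have "{0..int p + d - 1} = insert (int p + d - 1) {0..int p + d - 2}" by auto
    then show ?thesis using False assms by (simp add: ann_nonpos)
  qed (use False assms in \<open>simp add: ann_nonpos\<close>)
  ultimately show ?thesis
    using False assms by (simp add: ann_nonpos diff_diff_eq)
qed

lemma ann_F:
  assumes "p > 0"
  shows "ann p k d dvd (if d < 0 then 1 else lin p k d) * ann p k (d + 1)"
proof (cases "d < 0")
  case True
  then show ?thesis
    using assms by (auto simp: ann_nonpos intro!: prod_dvd_prod_subset)
next
  case False
  have "lin p k d = lin p k (d - int p)"
    using lin_periodic[OF assms, of k d] by simp
  moreover have "ann p k d dvd lin p k (d - int p) * (\<Prod>j\<in>{d + 1 - int p..- 1}. lin p k j)"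
  proof (cases "d - int p \<le> - 1")
    case True
    then have "{d - int p..- 1} = insert (d - int p) {d + 1 - int p..- 1}" by auto
    then show ?thesis using False by (simp add: ann_def)
  qed (use False in \<open>simp add: ann_def\<close>)
  ultimately show ?thesis
    using False by (simp add: ann_def)
qed

lemma cas_eig_step:
  assumes "p \<ge> 2"
  shows "cas_eig p (m + 1) - cas_eig p (m - 1) = 1 / (q p - inverse (q p)) * (q_pow p m - q_pow p (- m))"
proof -
  let ?w = "q p - inverse (q p)"
  have "q_pow p (m + 1) + q_pow p (- (m + 1)) - (q_pow p (m - 1) + q_pow p (- (m - 1))) = ?w * (q_pow p m - q_pow p (- m))"
  proof -
    have e: "- (m + 1) = - m - 1" "- (m - 1) = - m + 1" by simp_all
    show ?thesis
      unfolding e q_pow_add q_pow_diff q_pow_1 by (simp only: algebra_simps)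
  qed
  then have "cas_eig p (m + 1) - cas_eig p (m - 1) = ?w * (q_pow p m - q_pow p (- m)) / ?w ^ 2"
    unfolding cas_eig_def by (simp flip: diff_divide_distrib)
  then show ?thesis
    using q_minus_inverse_nonzero[OF assms] by (simp add: power2_eq_square)
qed

text \<open>Only E^p and F^p act nontrivially on polynomial vectors; the other relators act as
  zero.\<close>

lemma wact_relators:
  assumes p: "p \<ge> 2" and r: "r \<in> relators p"
  shows "\<forall>d. ann p k d dvd wm.act p k r f d"
proof -
  have p0: "p > 0" using p by simp
  note act = wm.act_diff wm.act_mult wm.act_gen' wm.act_scal wm.act_1 wm.act_power
  have qz2: "q_pow p (2 * d) = q_pow p d ^ 2" for d
    by (simp add: q_pow_power)
  consider "r = gK * gKinv - 1" | "r = gKinv * gK - 1"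
    | "r = gK * gE * gKinv - scal (q p ^ 2) * gE"
    | "r = gK * gF * gKinv - scal (inverse (q p) ^ 2) * gF"
    | "r = gE * gF - gF * gE - scal (1 / (q p - inverse (q p))) * (gK - gKinv)"
    | "r = gE ^ p" | "r = gF ^ p" | "r = gK ^ (2 * p) - 1"
    using r unfolding relators_def by blast
  then show ?thesis
  proof cases
    case 1
    then have "wm.act p k r f = 0"
      by (simp add: act fun_eq_iff flip: q_pow_add)
    then show ?thesis by simp
  next
    case 2
    then have "wm.act p k r f = 0"
      by (simp add: act fun_eq_iff flip: q_pow_add)
    then show ?thesis by simp
  next
    case 3
    have "q_pow p (k + 2 * d) * q_pow p (- (k + 2 * (d - 1))) = q p ^ 2" for d
      using q_pow_nat[of p 2] by (simp flip: q_pow_add)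
    then have "wm.act p k r f = 0"
      unfolding 3 by (simp add: act fun_eq_iff algebra_simps)
    then show ?thesis by simp
  next
    case 4
    have "q_pow p (k + 2 * d) * q_pow p (- (k + 2 * (d + 1))) = inverse (q p) ^ 2" for d
      using q_pow_nat[of p 2] q_pow_minus[of p 2] by (simp add: power_inverse flip: q_pow_add)
    then have "wm.act p k r f = 0"
      unfolding 4 by (simp add: act fun_eq_iff algebra_simps)
    then show ?thesis by simp
  next
    case 5
    have "wm.act p k r f d = 0" for d
    proof -
      let ?m = "k + 2 * d"
      have "wm.act p k r f d = (lin p k (d - 1) - lin p k d) * f d
          - Polynomial.smult (1 / (q p - inverse (q p))) (Polynomial.smult (q_pow p ?m - q_pow p (- ?m)) (f d))"
        unfolding 5 by (simp add: act left_diff_distrib smult_diff_left smult_diff_right)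
      also have "lin p k (d - 1) - lin p k d = [:cas_eig p (?m + 1) - cas_eig p (?m - 1):]"
        by (simp add: lin_def algebra_simps)
      finally show ?thesis
        unfolding cas_eig_step[OF p] by simp
    qed
    then show ?thesis by simp
  next
    case 6
    have "ann p k d dvd (\<Prod>j\<in>{d - int p..min (d - 1) (- 1)}. lin p k j)" for d
    proof (cases "d > 0")
      case True
      then have "min (d - 1) (- 1) = - 1" by auto
      with True show ?thesis by (simp add: ann_def)
    next
      case False
      \<comment> \<open>Shifting by p moves the interval 0, ..., p + d - 1 to -p, ..., d - 1, which
        lies inside the interval of E^p.\<close>
      have "ann p k d = (\<Prod>j\<in>{- int p..d - 1}. lin p k j)"
        using False p0 unfolding ann_nonpos[OF p0 leI[OF False]]
        by (intro prod.reindex_bij_witness[of _ "\<lambda>j. j + int p" "\<lambda>j. j - int p"])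
           (auto simp: lin_periodic)
      also have "\<dots> dvd (\<Prod>j\<in>{d - int p..min (d - 1) (- 1)}. lin p k j)"
        using False by (intro prod_dvd_prod_subset) auto
      finally show ?thesis .
    qed
    then show ?thesis
      unfolding 6 act wact_E_pow by (intro allI dvd_mult2)
  next
    case 7
    have "ann p k d dvd (\<Prod>j\<in>{max d 0..d + int p - 1}. lin p k j)" for d
    proof (cases "d < 0")
      case True
      then have "max d 0 = 0" by auto
      with True show ?thesis using p0 by (simp add: ann_nonpos add.commute)
    next
      case False
      have "ann p k d = (\<Prod>j\<in>{d..int p - 1}. lin p k j)"
        using False p0 unfolding ann_def
        by simp (intro prod.reindex_bij_witness[of _ "\<lambda>j. j - int p" "\<lambda>j. j + int p"],
            auto simp: lin_periodic')
      also have "\<dots> dvd (\<Prod>j\<in>{max d 0..d + int p - 1}. lin p k j)"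
        using False by (intro prod_dvd_prod_subset) auto
      finally show ?thesis .
    qed
    then show ?thesis
      unfolding 7 act wact_F_pow by (intro allI dvd_mult2)
  next
    case 8
    have K: "(wact p k Gen_K ^^ n) f d = Polynomial.smult (q_pow p (k + 2 * d) ^ n) (f d)" for n d
      by (induction n) simp_all
    have "q_pow p (k + 2 * d) ^ (2 * p) = 1" for d
      unfolding q_pow_power q_pow_eq_1_iff[OF p0] by simp
    then have "wm.act p k r f = 0"
      unfolding 8 by (simp add: act fun_eq_iff K del: wact.simps)
    then show ?thesis by simp
  qed
qed

lemma wact_rel_ideal:
  assumes p: "p \<ge> 2" and x: "x \<in> rel_ideal p"
  shows "ann p k d dvd wm.act p k x f d"
proof -
  have p0: "p > 0" using p by simp
  have "wm.act p k x f \<in> {f. \<forall>d. ann p k d dvd f d}"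
  proof (rule wm.act_rel_ideal[OF _ _ _ x])
    show "wm.subspace {f. \<forall>d. ann p k d dvd f d}"
      by (auto simp: wm.subspace_def dvd_smult)
    show "wact p k a v \<in> {f. \<forall>d. ann p k d dvd f d}" if v: "v \<in> {f. \<forall>d. ann p k d dvd f d}" for a v
    proof (cases a)
      case Gen_E
      have "ann p k d dvd (if d > 0 then 1 else lin p k (d - 1)) * v (d - 1)" for d
        by (rule dvd_trans[OF ann_E[OF p0] mult_dvd_mono[OF dvd_refl]]) (use v in blast)
      then show ?thesis by (simp add: Gen_E)
    next
      case Gen_F
      have "ann p k d dvd (if d < 0 then 1 else lin p k d) * v (d + 1)" for d
        by (rule dvd_trans[OF ann_F[OF p0] mult_dvd_mono[OF dvd_refl]]) (use v in blast)
      then show ?thesis by (simp add: Gen_F)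
    qed (use v in \<open>auto intro: dvd_smult\<close>)
    show "wm.act p k r v \<in> {f. \<forall>d. ann p k d dvd f d}" if "r \<in> relators p" for r v
      using wact_relators[OF p that] by blast
  qed
  then show ?thesis by blast
qed

text \<open>On the generator u, V acts as 2p and the monomial gives 2p times p - 1 linear factors in
  degree 0. A member of the ideal would give a multiple of \<open>ann p k 0\<close>, which has
  degree p.\<close>

lemma longest_monomial_not_in_rel_ideal:
  assumes p: "p \<ge> 2"
  shows "gE ^ (p - 1) * (gF ^ (p - 1) * (\<Sum>l<2 * p. scal ((1 * q_pow p (- k)) ^ l) * gK ^ l)) \<notin> rel_ideal p"
    (is "?x \<notin> _")
proof
  assume x: "?x \<in> rel_ideal p"
  have p0: "p > 0" using p by simp
  define u :: "int \<Rightarrow> complex poly" where "u d = (if d = 0 then 1 else 0)" for d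
  have K: "(wact p k Gen_K ^^ n) u = (\<lambda>d. Polynomial.smult (q_pow p k ^ n) (u d))" for n
    by (induction n) (auto simp: u_def fun_eq_iff)
  have "q_pow p (- k) * q_pow p k = 1"
    by (simp flip: q_pow_add)
  then have "wm.act p k (scal ((1 * q_pow p (- k)) ^ l) * gK ^ l) u = u" for l
    by (simp add: wm.act_mult wm.act_scal wm.act_power wm.act_gen' K fun_eq_iff
        del: wact.simps flip: power_mult_distrib)
  moreover have "(\<Sum>l<n. u) = (\<lambda>d. Polynomial.smult (of_nat n) (u d))" for n :: nat
    by (induction n) (auto simp: fun_eq_iff smult_add_left simp del: sum_constant)
  ultimately have V: "wm.act p k (\<Sum>l<2 * p. scal ((1 * q_pow p (- k)) ^ l) * gK ^ l) u
      = (\<lambda>d. Polynomial.smult (2 * of_nat p) (u d))"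
    by (simp add: wm.act_sum del: sum_constant)
  have F: "(wact p k Gen_F ^^ (p - 1)) (\<lambda>d. Polynomial.smult (2 * of_nat p) (u d)) (- int (p - 1)) = [:2 * of_nat p:]"
    unfolding wact_F_pow using p by (auto simp: u_def max_def)
  have "wm.act p k ?x u 0 = (\<Prod>j\<in>{- int (p - 1)..- 1}. lin p k j) * [:2 * of_nat p:]"
    unfolding wm.act_mult V wm.act_power wm.act_gen' wact_E_pow using F by simp
  moreover have "ann p k 0 dvd wm.act p k ?x u 0"
    by (rule wact_rel_ideal[OF p x])
  ultimately have "(\<Prod>j\<in>{- int p..- 1}. lin p k j) dvd Polynomial.smult (2 * of_nat p) (\<Prod>j\<in>{- int (p - 1)..- 1}. lin p k j)"
    by (simp add: ann_def mult.commute)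
  moreover have nz: "(\<Prod>j\<in>{- int (p - 1)..- 1}. lin p k j) \<noteq> 0"
    by (auto simp: lin_def)
  moreover have deg: "degree (\<Prod>j\<in>{- int n..- 1}. lin p k j) = n" for n
    by (subst degree_prod_eq_sum_degree) (auto simp: lin_def)
  ultimately show False
    using p dvd_imp_degree_le[of "\<Prod>j\<in>{- int p..- 1}. lin p k j" "Polynomial.smult (2 * of_nat p) (\<Prod>j\<in>{- int (p - 1)..- 1}. lin p k j)"]
    by (simp add: deg del: of_nat_diff)
qed

section \<open>The algebra for a fixed p inside the ring type\<close>

locale restricted_qg =
  fixes p :: nat
  assumes p2: "p \<ge> 2"
begin

abbreviation cemb :: "free_alg \<Rightarrow> total" where "cemb \<equiv> comp_emb p"

lemma emb_0: "cemb 0 = 0"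
  using comp_emb_add[of p 0 0] by simp

lemma emb_diff: "cemb (x - y) = cemb x - cemb y"
  using comp_emb_add[of p "x - y" y] by simp

lemma emb_power: "cemb (x ^ n) = cemb x ^ n"
  by (induction n) (simp_all add: comp_emb_1 comp_emb_mult)

lemma emb_sum: "cemb (sum f A) = (\<Sum>i\<in>A. cemb (f i))"
  by (induction A rule: infinite_finite_induct) (simp_all add: emb_0 comp_emb_add)

lemma emb_relator: "x - y \<in> relators p \<Longrightarrow> cemb x = cemb y"
  using comp_emb_eq_iff[OF p2] rel_ideal_relators by blast

lemma emb_relator_0: "x \<in> relators p \<Longrightarrow> cemb x = 0"
  using emb_relator[of x 0] by (simp add: emb_0)

sublocale uq_alg p "\<lambda>c. cemb (scal c)" "cemb gE" "cemb gF" "cemb gK" "cemb gKinv"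
proof
  show "2 \<le> p" by (rule p2)
  show "cemb (scal (c + d)) = cemb (scal c) + cemb (scal d)" for c d
    by (simp add: scal_add comp_emb_add)
  show "cemb (scal (c * d)) = cemb (scal c) * cemb (scal d)" for c d
    by (simp add: scal_mult comp_emb_mult)
  show "cemb (scal 1) = 1"
    by (simp add: comp_emb_1)
  show "x * cemb (scal c) = cemb (scal c) * x" for x c
    by (rule comp_emb_scal_central)
  show "cemb gK * cemb gKinv = 1" "cemb gKinv * cemb gK = 1"
    unfolding comp_emb_mult[symmetric] comp_emb_1[of p, symmetric]
    by (rule emb_relator, simp add: relators_def)+
  show "cemb gK * cemb gE * cemb gKinv = cemb (scal (q p ^ 2)) * cemb gE"
    "cemb gK * cemb gF * cemb gKinv = cemb (scal (inverse (q p) ^ 2)) * cemb gF"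
    unfolding comp_emb_mult[symmetric] by (rule emb_relator, simp add: relators_def)+
  show "cemb gE * cemb gF - cemb gF * cemb gE = cemb (scal (1 / (q p - inverse (q p)))) * (cemb gK - cemb gKinv)"
    unfolding comp_emb_mult[symmetric] emb_diff[symmetric] by (rule emb_relator) (simp add: relators_def)
  show "cemb gE ^ p = 0" "cemb gF ^ p = 0"
    unfolding emb_power[symmetric] by (rule emb_relator_0, simp add: relators_def)+
  show "cemb gK ^ (2 * p) = 1"
    unfolding emb_power[symmetric] comp_emb_1[of p, symmetric] by (rule emb_relator) (simp add: relators_def)
qed

lemma emb_scal_mult: "cemb (scal c * x) = smul c (cemb x)"
  by (simp add: comp_emb_mult smul_def)

sublocale uq_alg_nonzero p "\<lambda>c. cemb (scal c)" "cemb gE" "cemb gF" "cemb gK" "cemb gKinv"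
proof
  fix k
  let ?x = "gE ^ (p - 1) * (gF ^ (p - 1) * (\<Sum>l<2 * p. scal ((1 * q_pow p (- k)) ^ l) * gK ^ l))"
  have "cemb ?x \<noteq> cemb 0"
    using longest_monomial_not_in_rel_ideal[OF p2, of k] comp_emb_eq_iff[OF p2, of ?x 0] by simp
  moreover have "cemb ?x = cemb gE ^ (p - 1) * (cemb gF ^ (p - 1) * V 1 k)"
    by (simp only: comp_emb_mult emb_power emb_sum emb_scal_mult V_def smul_def)
  ultimately show "cemb gE ^ (p - 1) * (cemb gF ^ (p - 1) * V 1 k) \<noteq> 0"
    by (simp add: emb_0)
qed

end

section \<open>Operations on residue classes\<close>

lemma cls_image: "cls p x = (\<lambda>i. i + x) ` rel_ideal p"
  unfolding cls_def a_r_coset_def' by auto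

lemma cls_eq_iff: "cls p x = cls p y \<longleftrightarrow> x - y \<in> rel_ideal p"
proof
  assume "cls p x = cls p y"
  then have "x \<in> cls p y"
    unfolding cls_image using rel_ideal_0[of p] by (auto intro: image_eqI[of _ _ 0])
  then show "x - y \<in> rel_ideal p"
    unfolding cls_image by auto
next
  assume d: "x - y \<in> rel_ideal p"
  have "i + x \<in> cls p y" if "i \<in> rel_ideal p" for i
    unfolding cls_image using rel_ideal_add[OF that d] by (auto intro: image_eqI[of _ _ "i + (x - y)"])
  moreover have "i + y \<in> cls p x" if "i \<in> rel_ideal p" for i
    unfolding cls_image using rel_ideal_diff[OF that d] by (auto intro: image_eqI[of _ _ "i - (x - y)"])
  ultimately show "cls p x = cls p y"
    unfolding cls_image by auto
qed

lemma Uq_simps: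
  "carrier (Uq p) = range (cls p)"
  "cls p x \<otimes>\<^bsub>Uq p\<^esub> cls p y = cls p (x * y)"
  "cls p x \<oplus>\<^bsub>Uq p\<^esub> cls p y = cls p (x + y)"
  "\<one>\<^bsub>Uq p\<^esub> = cls p 1"
  "\<zero>\<^bsub>Uq p\<^esub> = cls p 0"
  "c \<odot>\<^bsub>Uq p\<^esub> cls p x = cls p (scal c * x)"
proof -
  have m: "rcoset_mult class_ring (rel_ideal p) (cls p x) (cls p y) = cls p (x * y)" for x y
    unfolding cls_def using ideal.rcoset_mult_add[OF rel_ideal_ideal, of x y] by simp
  have z: "rel_ideal p = cls p 0"
    unfolding cls_image by simp
  show "carrier (Uq p) = range (cls p)"
    by (auto simp: Uq_def Let_def FactRing_def A_RCOSETS_def' cls_image a_r_coset_def')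
  show "cls p x \<otimes>\<^bsub>Uq p\<^esub> cls p y = cls p (x * y)" "c \<odot>\<^bsub>Uq p\<^esub> cls p x = cls p (scal c * x)"
    by (simp_all add: Uq_def Let_def FactRing_def m)
  show "cls p x \<oplus>\<^bsub>Uq p\<^esub> cls p y = cls p (x + y)"
    unfolding cls_def using ideal.a_rcos_sum[OF rel_ideal_ideal, of x y]
    by (simp add: Uq_def Let_def FactRing_def)
  show "\<one>\<^bsub>Uq p\<^esub> = cls p 1" "\<zero>\<^bsub>Uq p\<^esub> = cls p 0"
    using z by (simp_all add: Uq_def Let_def FactRing_def cls_def)
qed

lemma cls_pow: "cls p x [^]\<^bsub>Uq p\<^esub> (n::nat) = cls p (x ^ n)"
proof (induction n)
  case 0
  then show ?case by (simp add: nat_pow_def Uq_simps)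
next
  case (Suc n)
  have "cls p x [^]\<^bsub>Uq p\<^esub> Suc n = cls p x [^]\<^bsub>Uq p\<^esub> n \<otimes>\<^bsub>Uq p\<^esub> cls p x"
    by (simp add: nat_pow_def)
  then show ?case
    unfolding Suc Uq_simps by (simp only: power_Suc2)
qed

context restricted_qg
begin

lemma cls_eq_emb: "cls p x = cls p y \<longleftrightarrow> cemb x = cemb y"
  unfolding cls_eq_iff comp_emb_eq_iff[OF p2] ..

section \<open>Subspaces of the restricted quantum group\<close>

text \<open>M stays open in its other fields so as to cover both \<open>Uq p\<close> and the blocks
  \<open>Q p s\<close>, which have different units.\<close>

lemma vectorspace_sub:
  assumes U: "vs.subspace U"
    and M: "carrier M = cls p ` {x. cemb x \<in> U}" "add M = add (Uq p)" "zero M = zero (Uq p)"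
      "module.smult M = module.smult (Uq p)"
  shows "vectorspace class_ring M"
proof -
  note [simp] = M Uq_simps
  have "abelian_group M"
  proof (rule abelian_groupI)
    show "x \<oplus>\<^bsub>M\<^esub> y \<in> carrier M" if "x \<in> carrier M" "y \<in> carrier M" for x y
      using that by (auto simp: comp_emb_add intro!: imageI vs.subspace_add[OF U])
    show "\<zero>\<^bsub>M\<^esub> \<in> carrier M"
      by (auto simp: emb_0 intro!: imageI vs.subspace_0[OF U])
    show "\<exists>y\<in>carrier M. y \<oplus>\<^bsub>M\<^esub> x = \<zero>\<^bsub>M\<^esub>" if "x \<in> carrier M" for x
    proof -
      obtain y where y: "x = cls p y" "cemb y \<in> U" using \<open>x \<in> carrier M\<close> by auto
      then have "cemb (- y) \<in> U"
        using vs.subspace_neg[OF U] emb_diff[of 0 y] by (simp add: emb_0)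
      then show ?thesis
        using y by (intro bexI[of _ "cls p (- y)"]) auto
    qed
  qed (auto simp: add_ac)
  moreover have "module_axioms class_ring M"
  proof
    show "a \<odot>\<^bsub>M\<^esub> x \<in> carrier M" if "a \<in> carrier class_ring" "x \<in> carrier M" for a x
      using that by (auto simp: emb_scal_mult intro!: imageI vs.subspace_scale[OF U])
  qed (auto simp: scal_add scal_mult distrib_left distrib_right mult.assoc)
  ultimately show ?thesis
    using class_field by (intro vectorspace.intro Module.module.intro) (auto simp: field_def domain_def)
qed

lemma abelian_group_Uq: "abelian_group (Uq p)"
proof -
  have "vectorspace class_ring (Uq p)"
    by (rule vectorspace_sub[of UNIV]) (auto simp: Uq_simps)
  then interpret U: vectorspace class_ring "Uq p" .
  show ?thesis by (rule U.abelian_group_axioms)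
qed

lemma cls_minus: "cls p x \<ominus>\<^bsub>Uq p\<^esub> cls p y = cls p (x - y)"
proof -
  have "\<ominus>\<^bsub>Uq p\<^esub> cls p y = cls p (- y)"
    by (rule abelian_group.minus_equality[OF abelian_group_Uq]) (simp_all add: Uq_simps)
  then show ?thesis
    by (simp add: a_minus_def Uq_simps)
qed

lemma finsum_cls:
  assumes M: "abelian_monoid M" "carrier M = cls p ` {x. cemb x \<in> U}" "add M = add (Uq p)" "zero M = zero (Uq p)"
    and J: "finite J" "\<And>i. i \<in> J \<Longrightarrow> cemb (h i) \<in> U"
  shows "finsum M (\<lambda>i. cls p (h i)) J = cls p (sum h J)"
  using J
proof (induction J rule: finite_induct)
  case empty
  then show ?case
    using M by (simp add: abelian_monoid.finsum_empty Uq_simps)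
next
  case (insert i J)
  then have "finsum M (\<lambda>i. cls p (h i)) (insert i J) = cls p (h i) \<oplus>\<^bsub>M\<^esub> finsum M (\<lambda>i. cls p (h i)) J"
    by (intro abelian_monoid.finsum_insert[OF M(1)]) (auto simp: M)
  with insert show ?case
    by (simp add: M Uq_simps)
qed

text \<open>The bridge between the two settings: \<open>e\<close> is the family in the ring type,
  where independence and spanning are proved, and \<open>f\<close> the corresponding family of
  classes.\<close>

lemma family_basisI:
  assumes U: "vs.subspace U"
    and M: "carrier M = cls p ` {x. cemb x \<in> U}" "add M = add (Uq p)" "zero M = zero (Uq p)"
      "module.smult M = module.smult (Uq p)"
    and I: "finite I" "\<And>i. i \<in> I \<Longrightarrow> \<exists>x. f i = cls p x \<and> cemb x = e i" "\<And>i. i \<in> I \<Longrightarrow> e i \<in> U"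
    and indep: "\<And>c. (\<Sum>i\<in>I. smul (c i) (e i)) = 0 \<Longrightarrow> \<forall>i\<in>I. c i = 0"
    and span: "\<And>x. cemb x \<in> U \<Longrightarrow> \<exists>c. cemb x = (\<Sum>i\<in>I. smul (c i) (e i))"
  shows "family_basis M I f"
proof -
  obtain r where r: "\<And>i. i \<in> I \<Longrightarrow> f i = cls p (r i)" "\<And>i. i \<in> I \<Longrightarrow> cemb (r i) = e i"
    using I(2) by metis
  interpret M: vectorspace class_ring M
    by (rule vectorspace_sub[OF U M])
  have ab: "abelian_monoid M" by (rule M.abelian_monoid_axioms)
  have "inj_on e I"
    by (rule vs.family_independent(1)[OF I(1) indep])
  then have inj: "inj_on f I"
    using r by (auto simp: inj_on_def cls_eq_emb)
  have fin: "finite (f ` I)" using I(1) by simp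
  have sub: "f ` I \<subseteq> carrier M"
    using r I(3) by (auto simp: M)
  have lc: "M.lincomb a (f ` I) = cls p (\<Sum>i\<in>I. scal (a (f i)) * r i)" for a
  proof -
    have "M.lincomb a (f ` I) = finsum M (\<lambda>i. a (f i) \<odot>\<^bsub>M\<^esub> f i) I"
      unfolding M.lincomb_def using sub inj by (intro M.finsum_reindex) auto
    also have "\<dots> = finsum M (\<lambda>i. cls p (scal (a (f i)) * r i)) I"
      using r I(3) U by (intro M.finsum_cong') (auto simp: M Uq_simps emb_scal_mult intro!: imageI vs.subspace_scale)
    also have "\<dots> = cls p (\<Sum>i\<in>I. scal (a (f i)) * r i)"
      using r I U by (intro finsum_cls[OF ab M(1-3)]) (auto simp: emb_scal_mult intro!: vs.subspace_scale)
    finally show ?thesis .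
  qed
  have emb_lc: "cemb (\<Sum>i\<in>I. scal (c i) * r i) = (\<Sum>i\<in>I. smul (c i) (e i))" for c
    using r by (simp add: emb_sum emb_scal_mult)
  have "M.lin_indpt (f ` I)"
  proof (rule M.finite_lin_indpt2[OF fin sub])
    fix a assume "M.lincomb a (f ` I) = \<zero>\<^bsub>M\<^esub>"
    then have "(\<Sum>i\<in>I. smul (a (f i)) (e i)) = 0"
      unfolding lc M Uq_simps cls_eq_emb emb_lc by (simp add: emb_0)
    from indep[OF this] show "\<forall>v\<in>f ` I. a v = \<zero>\<^bsub>class_ring\<^esub>" by simp
  qed
  moreover have "carrier M \<subseteq> M.span (f ` I)"
  proof
    fix X assume "X \<in> carrier M"
    then obtain x where x: "X = cls p x" "cemb x \<in> U" by (auto simp: M)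
    obtain c where c: "cemb x = (\<Sum>i\<in>I. smul (c i) (e i))" using span[OF x(2)] by auto
    have "X = M.lincomb (\<lambda>v. c (the_inv_into I f v)) (f ` I)"
      unfolding lc x(1) cls_eq_emb emb_lc c
      by (intro sum.cong) (auto simp: the_inv_into_f_f[OF inj])
    then show "X \<in> M.span (f ` I)"
      unfolding M.finite_span[OF fin sub] by auto
  qed
  moreover have "M.span (f ` I) \<subseteq> carrier M"
    using M.span_is_subset2[OF sub] .
  ultimately show ?thesis
    unfolding family_basis_def M.basis_def using inj sub M.vectorspace_axioms by auto
qed

section \<open>Blocks\<close>

definition Qsub :: "nat \<Rightarrow> total set" where
  "Qsub s = {y. \<exists>n. N (cas_eig p (int s)) ^ n * y = 0}"

lemma Qsub_subspace: "vs.subspace (Qsub s)"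
proof (rule vs.subspaceI)
  show "0 \<in> Qsub s" by (simp add: Qsub_def)
  show "x + y \<in> Qsub s" if xy: "x \<in> Qsub s" "y \<in> Qsub s" for x y
  proof -
    obtain m n where mn: "N (cas_eig p (int s)) ^ m * x = 0" "N (cas_eig p (int s)) ^ n * y = 0"
      using xy by (auto simp: Qsub_def)
    have "N (cas_eig p (int s)) ^ (m + n) * (x + y) = 0"
      unfolding distrib_left using N_pow_add[OF mn(1), of n] N_pow_add[OF mn(2), of m]
      by (simp add: add.commute)
    then show ?thesis by (auto simp: Qsub_def)
  qed
  show "smul c x \<in> Qsub s" if x: "x \<in> Qsub s" for c x
  proof -
    obtain n where "N (cas_eig p (int s)) ^ n * x = 0" using x by (auto simp: Qsub_def)
    then have "N (cas_eig p (int s)) ^ n * smul c x = 0" by simp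
    then show ?thesis unfolding Qsub_def by blast
  qed
qed

lemma Q_space_eq: "Q_space p s = cls p ` {x. cemb x \<in> Qsub s}"
proof -
  define cas where "cas = gE * gF
     + scal (1 / (q p - inverse (q p)) ^ 2) * (scal (inverse (q p)) * gK + scal (q p) * gKinv)"
  have cas: "cemb cas = Cas"
    by (simp add: cas_def Cas_def comp_emb_add comp_emb_mult smul_def)
  have eq: "casimir p \<ominus>\<^bsub>Uq p\<^esub> casimir_eigval p s \<odot>\<^bsub>Uq p\<^esub> \<one>\<^bsub>Uq p\<^esub>
      = cls p (cas - scal (cas_eig p (int s)) * 1)"
    unfolding casimir_def cas_def[symmetric] Uq_simps cls_minus casimir_eigval_cas_eig ..
  have "cemb (cas - scal (cas_eig p (int s)) * 1) = N (cas_eig p (int s))"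
    unfolding emb_diff emb_scal_mult cas N_def comp_emb_1 ..
  then have "cls p ((cas - scal (cas_eig p (int s)) * 1) ^ n * x) = cls p 0 \<longleftrightarrow> N (cas_eig p (int s)) ^ n * cemb x = 0" for n x
    unfolding cls_eq_emb comp_emb_mult emb_power emb_0 by simp
  then show ?thesis
    unfolding Q_space_def eq unfolding cls_pow Qsub_def by (auto simp: Uq_simps intro!: imageI)
qed

lemma Q_simps:
  "carrier (Q p s) = cls p ` {x. cemb x \<in> Qsub s}" "add (Q p s) = add (Uq p)" "zero (Q p s) = zero (Uq p)"
  "module.smult (Q p s) = module.smult (Uq p)" "mult (Q p s) = mult (Uq p)"
  by (simp_all add: Q_def Q_space_eq)

lemma emb_PBW: "cemb x \<in> PBW"
proof (induction x rule: free_alg_induct)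
  case (scal c)
  then show ?case using PBW_smul[OF PBW_1, of c] by (simp add: smul_def)
next
  case (add x y)
  then show ?case by (simp add: comp_emb_add PBW_add)
next
  case (gen a x)
  then show ?case by (cases a) (simp_all add: comp_emb_mult PBW_E PBW_F PBW_K PBW_K')
qed

lemma Qsub_span:
  assumes "s \<le> p" "cemb x \<in> Qsub s"
  shows "\<exists>c. cemb x = (\<Sum>i\<in>block_labels p s. smul (c i) (block_elt s i))"
  using block_span[OF assms(1) emb_PBW] assms(2) by (auto simp: Qsub_def)

lemma block_elt_Qsub: "s \<le> p \<Longrightarrow> i \<in> block_labels p s \<Longrightarrow> block_elt s i \<in> Qsub s"
  unfolding Qsub_def using N_square_block_elt by blast

end

context restricted_qg
begin

section \<open>The representatives of the basis elements\<close>

lemma emb_v_rep: "cemb (v_rep p \<alpha> s t) = V \<alpha> (int s - 2 * int t + 1)"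
  unfolding v_rep_def V_def q_pow_def by (simp add: emb_sum emb_scal_mult emb_power)

lemma emb_a_rep:
  assumes "t \<le> p"
  shows "cemb (a_rep p \<alpha> s t n) = cemb gF ^ n * a0 \<alpha> s t"
  unfolding a_rep_def a0_def W_def using p2
  by (simp add: comp_emb_mult emb_power emb_v_rep mult.assoc)

lemma beta_qint: "i \<le> s \<Longrightarrow> beta p \<alpha> (int s) (int i) = \<alpha> * qint p i * qint p (s - i)"
  using q_int_nat[of p "s - i"] by (simp add: beta_def q_int_nat of_nat_diff)

text \<open>The factor of \<open>mu\<close> at j \<ge> 1 is the partner's \<open>beta\<close> at j,
  that is, \<open>beta_seq\<close> at s + j - 1, strictly above the zero.\<close>

lemma mu_prod:
  assumes "1 \<le> s" "s < p" "m \<in> {1..p - s}"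
  shows "mu p \<alpha> s m = prod (beta_seq \<alpha> s) {p - m - 1 + 1..<p - 1}"
  unfolding mu_def
proof (rule prod.reindex_bij_witness[of _ "\<lambda>j. j + 1 - s" "\<lambda>j. s + j - 1"])
  fix j assume j: "j \<in> {p - s - (m - 1)..p - s - 1}"
  then have "1 + int (s + j - 1) = int s + int j" using assms by auto
  then have "beta_seq \<alpha> s (s + j - 1) = beta p (- \<alpha>) (int (p - s)) (int j)"
    using assms by (simp add: beta_seq_def beta_s_plus[OF p0] of_nat_diff)
  moreover have "j \<le> p - s" using j by auto
  ultimately show "beta_seq \<alpha> s (s + j - 1) = - \<alpha> * qint p j * qint p (p - s - j)"
    by (simp only: beta_qint)
qed (use assms in auto)

lemma emb_b_rep:
  assumes "1 \<le> t" "t \<le> s" "s < p"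
  shows "cemb (b_rep p \<alpha> s t n) = cemb gF ^ n * b0 \<alpha> s t"
proof -
  have "(\<Sum>m = 1..p - s. smul (mu p \<alpha> s m) (cemb gE ^ (p - m - 1) * (cemb gF ^ (p - t - m) * V \<alpha> (int s - 2 * int t + 1))))
    = (\<Sum>N=s - 1..<p - 1. smul (prod (beta_seq \<alpha> s) {N + 1..<p - 1}) (W \<alpha> s t N))"
    using assms
    by (intro sum.reindex_bij_witness[of _ "\<lambda>N. p - N - 1" "\<lambda>m. p - m - 1"])
       (auto simp: mu_prod W_def Suc_diff_Suc diff_diff_eq add.commute)
  then show ?thesis
    unfolding b_rep_def b0_def
    by (simp add: comp_emb_mult emb_power emb_sum emb_v_rep mult.assoc smul_def)
qed

lemma emb_y_rep:
  assumes "1 \<le> t" "t \<le> s" "s < p"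
  shows "cemb (y_rep p \<alpha> s t k) = cemb gF ^ k * y0 \<alpha> s t"
  unfolding y_rep_def y0_def using emb_b_rep[OF assms, of \<alpha> 0]
  by (simp add: comp_emb_mult emb_power F_F_pow add.commute)

text \<open>\<open>x_rep\<close> has E^(p-m) where \<open>b_rep\<close> has E^(p-m-1), so its sum is
  E b_0 and the total power of E becomes p - s - k, as in \<open>F_x0\<close>.\<close>

lemma emb_x_rep:
  assumes \<alpha>: "\<alpha> * \<alpha> = 1" and t: "1 \<le> t" "t \<le> s" "s < p" and k: "k < p - s"
  shows "cemb (x_rep p \<alpha> s t k) = cemb gF ^ k * x0 \<alpha> s t"
proof -
  let ?w = "\<lambda>m. cemb gF ^ (p - t - m) * V \<alpha> (int s - 2 * int t + 1)"
  have x_norm: "(\<Prod>i = k + 1..p - s - 1. - \<alpha> * qint p i * qint p (p - s - i)) = x_norm \<alpha> s k"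
    unfolding x_norm_def by (intro prod.cong) (auto simp: beta_qint simp del: of_nat_diff)
  have "cemb gE * cemb (b_rep p \<alpha> s t 0)
    = (\<Sum>m = 1..p - s. smul (mu p \<alpha> s m) (cemb gE * (cemb gE ^ (p - m - 1) * ?w m)))"
  proof -
    have "cemb (b_rep p \<alpha> s t 0) = (\<Sum>m = 1..p - s. smul (mu p \<alpha> s m) (cemb gE ^ (p - m - 1) * ?w m))"
      unfolding b_rep_def
      by (simp add: comp_emb_mult emb_power emb_sum emb_v_rep mult.assoc smul_def)
    then show ?thesis
      by (simp add: sum_distrib_left)
  qed
  also have "\<dots> = (\<Sum>m = 1..p - s. smul (mu p \<alpha> s m) (cemb gE ^ (p - m) * ?w m))"
  proof (intro sum.cong refl)
    fix m assume "m \<in> {1..p - s}"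
    then obtain k where k: "p - m = Suc k" "p - m - 1 = k"
      using t by (cases "p - m") auto
    show "smul (mu p \<alpha> s m) (cemb gE * (cemb gE ^ (p - m - 1) * ?w m)) = smul (mu p \<alpha> s m) (cemb gE ^ (p - m) * ?w m)"
      unfolding k(2) unfolding k(1) by (simp only: power_Suc mult.assoc)
  qed
  finally have E: "(\<Sum>m = 1..p - s. smul (mu p \<alpha> s m) (cemb gE ^ (p - m) * ?w m)) = cemb gE * b0 \<alpha> s t"
    using emb_b_rep[OF t, of \<alpha> 0] by simp
  have "cemb (x_rep p \<alpha> s t k) = smul (1 / x_norm \<alpha> s k) (cemb gE ^ (p - s - k - 1) *
      (\<Sum>m = 1..p - s. smul (mu p \<alpha> s m) (cemb gE ^ (p - m) * ?w m)))"
    unfolding x_rep_def x_norm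
    by (simp add: comp_emb_mult emb_power emb_sum emb_v_rep mult.assoc smul_def)
  also have "\<dots> = smul (1 / x_norm \<alpha> s k) (cemb gE ^ Suc (p - s - k - 1) * b0 \<alpha> s t)"
    unfolding E by (simp only: power_Suc2 mult.assoc)
  also have "Suc (p - s - k - 1) = p - s - k" using k by simp
  finally show ?thesis
    unfolding F_x0[OF \<alpha> t k] .
qed

lemma gamma_norm_gamma:
  assumes "1 \<le> s" "s < p"
  shows "gamma p s = norm_gamma 1 s" "delta p s = norm_delta 1 s"
proof -
  have m: "(\<Prod>m\<in>A. beta p (- 1) (int (p - s)) (int m)) = (\<Prod>m\<in>A. - qint p m * qint p (p - s - m))"
    if "A \<subseteq> {1..p - s - 1}" for A
    using that by (intro prod.cong refl, subst beta_qint) fastforce+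
  have i: "(\<Prod>i\<in>A. beta p 1 (int s) (int i)) = (\<Prod>i\<in>A. qint p i * qint p (s - i))"
    if "A \<subseteq> {1..s - 1}" for A
    using that by (intro prod.cong refl, subst beta_qint) fastforce+
  show "gamma p s = norm_gamma 1 s"
    unfolding gamma_def norm_gamma_def beta_seq_split(1)[OF assms] m[OF subset_refl] i[OF subset_refl]
    by simp
  have "prod_omit (\<lambda>i. beta p 1 (int s) (int i)) {1..s - 1} = (\<Sum>j = 1..s - 1. \<Prod>k \<in> {1..s - 1} - {j}. qint p k * qint p (s - k))"
    unfolding prod_omit_def by (intro sum.cong refl i) auto
  moreover have "prod_omit (\<lambda>m. beta p (- 1) (int (p - s)) (int m)) {1..p - s - 1}
      = (\<Sum>n = 1..p - s - 1. \<Prod>k \<in> {1..p - s - 1} - {n}. - qint p k * qint p (p - s - k))"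
    unfolding prod_omit_def by (intro sum.cong refl m) auto
  ultimately show "delta p s = norm_delta 1 s"
    unfolding delta_def norm_delta_def beta_seq_split(2)[OF assms] m[OF subset_refl] i[OF subset_refl]
    by (simp only: distrib_left mult.assoc)
qed

lemma elt_rep:
  assumes s: "1 \<le> s" "s < p" and i: "i \<in> labels p s"
  shows "\<exists>x. elt p s i = cls p x \<and> cemb x = block_elt s i"
proof -
  have s': "p - s < p" using s by simp
  \<comment> \<open>\<open>elt\<close> normalizes the minus half by the constants of s,
    \<open>block_elt\<close> by those of the partner p - s; they coincide.\<close>
  have g: "norm_gamma (- 1) (p - s) = norm_gamma 1 s" "norm_delta (- 1) (p - s) = norm_delta 1 s"
    using norm_gamma_flip[OF s, of 1] norm_delta_flip[OF s, of 1] by simp_all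
  note e = emb_scal_mult emb_diff emb_a_rep emb_b_rep emb_x_rep emb_y_rep gamma_norm_gamma[OF s] g
  note d = Ag_def Bg_def Xg_def Yg_def
  show ?thesis
  proof (cases i)
case (BP n t)
    with i have "1 \<le> t" "t \<le> s" "n < s"
      by (auto simp: labels_def)
    then show ?thesis
      unfolding BP elt.simps block_elt.simps d using s s'
      by - (rule exI, rule conjI[OF refl], simp add: e right_diff_distrib vs.scale_right_diff_distrib)
  next
    case (XP n t)
    with i have "1 \<le> t" "t \<le> s" "n < p - s"
      by (auto simp: labels_def)
    then show ?thesis
      unfolding XP elt.simps block_elt.simps d using s s'
      by - (rule exI, rule conjI[OF refl], simp add: e right_diff_distrib vs.scale_right_diff_distrib)
  next
    case (YP n t)
    with i have "1 \<le> t" "t \<le> s" "n < p - s"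
      by (auto simp: labels_def)
    then show ?thesis
      unfolding YP elt.simps block_elt.simps d using s s'
      by - (rule exI, rule conjI[OF refl], simp add: e right_diff_distrib vs.scale_right_diff_distrib)
  next
    case (AP n t)
    with i have "1 \<le> t" "t \<le> s" "n < s"
      by (auto simp: labels_def)
    then show ?thesis
      unfolding AP elt.simps block_elt.simps d using s s'
      by - (rule exI, rule conjI[OF refl], simp add: e right_diff_distrib vs.scale_right_diff_distrib)
  next
    case (BM n t)
    with i have "1 \<le> t" "t \<le> p - s" "n < p - s"
      by (auto simp: labels_def)
    then show ?thesis
      unfolding BM elt.simps block_elt.simps d using s s'
      by - (rule exI, rule conjI[OF refl], simp add: e right_diff_distrib vs.scale_right_diff_distrib)
  next
    case (XM n t)
    with i have "1 \<le> t" "t \<le> p - s" "n < s"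
      by (auto simp: labels_def)
    then show ?thesis
      unfolding XM elt.simps block_elt.simps d using s s'
      by - (rule exI, rule conjI[OF refl], simp add: e right_diff_distrib vs.scale_right_diff_distrib)
  next
    case (YM n t)
    with i have "1 \<le> t" "t \<le> p - s" "n < s"
      by (auto simp: labels_def)
    then show ?thesis
      unfolding YM elt.simps block_elt.simps d using s s'
      by - (rule exI, rule conjI[OF refl], simp add: e right_diff_distrib vs.scale_right_diff_distrib)
  next
    case (AM n t)
    with i have "1 \<le> t" "t \<le> p - s" "n < p - s"
      by (auto simp: labels_def)
    then show ?thesis
      unfolding AM elt.simps block_elt.simps d using s s'
      by - (rule exI, rule conjI[OF refl], simp add: e right_diff_distrib vs.scale_right_diff_distrib)
  qed
qed

lemma elt_mult:
  assumes s: "1 \<le> s" "s < p" and ij: "i \<in> labels p s" "j \<in> labels p s"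
  shows "elt p s i \<otimes>\<^bsub>Uq p\<^esub> elt p s j
    = (case label_mult i j of Some k \<Rightarrow> elt p s k | None \<Rightarrow> \<zero>\<^bsub>Uq p\<^esub>)"
proof -
  obtain x y where x: "elt p s i = cls p x" "cemb x = block_elt s i" and y: "elt p s j = cls p y" "cemb y = block_elt s j"
    using elt_rep[OF s] ij by metis
  have xy: "cemb (x * y) = (case label_mult i j of Some k \<Rightarrow> block_elt s k | None \<Rightarrow> 0)"
    unfolding comp_emb_mult x(2) y(2) by (rule block_elt_mult[OF s ij])
  show ?thesis
  proof (cases "label_mult i j")
    case None
    then show ?thesis
      using xy by (simp add: x(1) y(1) Uq_simps cls_eq_emb emb_0)
  next
    case (Some k)
    then have "k \<in> labels p s" using label_mult_closed ij by blast
    from elt_rep[OF s this] obtain z where "elt p s k = cls p z" "cemb z = block_elt s k" by auto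
    with Some show ?thesis
      using xy by (simp add: x(1) y(1) Uq_simps cls_eq_emb)
  qed
qed

lemma block_basis:
  assumes s: "1 \<le> s" "s < p"
  shows "family_basis (Q p s) (labels p s) (elt p s)"
proof (rule family_basisI[OF Qsub_subspace[of s] Q_simps(1-4)])
  have bl: "block_labels p s = labels p s" using s by (simp add: block_labels_def)
  show "finite (labels p s)" using s by (simp add: card_labels)
  show "\<exists>x. elt p s i = cls p x \<and> cemb x = block_elt s i" if "i \<in> labels p s" for i
    by (rule elt_rep[OF s that])
  show "block_elt s i \<in> Qsub s" if "i \<in> labels p s" for i
    using block_elt_Qsub[of s i] that s bl by simp
  show "\<forall>i\<in>labels p s. c i = 0" if "(\<Sum>i\<in>labels p s. smul (c i) (block_elt s i)) = 0" for c
    by (rule independent_labels[OF s that])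
  show "\<exists>c. cemb x = (\<Sum>i\<in>labels p s. smul (c i) (block_elt s i))" if "cemb x \<in> Qsub s" for x
    using Qsub_span[of s x] that s bl by simp
qed

section \<open>The two matrix blocks\<close>

context
  fixes \<alpha> :: complex and s :: nat
  assumes \<alpha>s: "(\<alpha>, s) \<in> {(1, p), (- 1, 0)}"
begin

lemma sign: "\<alpha> = 1 \<or> \<alpha> = - 1" "\<alpha> * \<alpha> = 1" "s \<le> p"
  using \<alpha>s by auto

lemma A_top_rep:
  assumes "t \<in> {1..p}"
  shows "\<exists>x. A_top p \<alpha> n t = cls p x \<and> cemb x = Ag \<alpha> p t n"
proof -
  have "prod (beta_seq \<alpha> p) ({..<p - 1} - {p - 1}) = (\<Prod>i = 1..p - 1. \<alpha> * qint p i * qint p (p - i))"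
  proof (rule prod.reindex_bij_witness[of _ "\<lambda>i. i - 1" "\<lambda>j. j + 1"])
    fix j assume "j \<in> {..<p - 1} - {p - 1}"
    then have "j + 1 \<le> p" by auto
    from beta_qint[OF this, of \<alpha>] show "\<alpha> * qint p (j + 1) * qint p (p - (j + 1)) = beta_seq \<alpha> p j"
      by (simp add: beta_seq_def add.commute)
  qed auto
  then have g: "2 * of_nat p * (\<Prod>i = 1..p - 1. \<alpha> * qint p i * qint p (p - i)) = norm_gamma \<alpha> p"
    by (simp only: norm_gamma_def)
  have "t \<le> p" using assms by simp
  then show ?thesis
    unfolding A_top_def g by - (rule exI, rule conjI[OF refl], simp add: emb_scal_mult emb_a_rep Ag_def)
qed

lemma A_top_mult:
  assumes "n < p" "t1 \<in> {1..p}" "t2 \<in> {1..p}"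
  shows "A_top p \<alpha> m t1 \<otimes>\<^bsub>Uq p\<^esub> A_top p \<alpha> n t2 = (if n = t1 - 1 then A_top p \<alpha> m t2 else \<zero>\<^bsub>Uq p\<^esub>)"
proof -
  obtain x y z where x: "A_top p \<alpha> m t1 = cls p x" "cemb x = Ag \<alpha> p t1 m"
    and y: "A_top p \<alpha> n t2 = cls p y" "cemb y = Ag \<alpha> p t2 n"
    and z: "A_top p \<alpha> m t2 = cls p z" "cemb z = Ag \<alpha> p t2 m"
    using A_top_rep assms by meson
  have "cemb (x * y) = (if n = t1 - 1 then Ag \<alpha> p t2 m else 0)"
    unfolding comp_emb_mult x(2) y(2) using assms by (intro Ag_top_mult[OF sign(2)]) auto
  then show ?thesis
    unfolding x(1) y(1) z(1) Uq_simps by (simp add: cls_eq_emb z(2) emb_0)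
qed

lemma Ag_Qsub:
  assumes "n < p" "t \<in> {1..p}"
  shows "Ag \<alpha> p t n \<in> Qsub s"
proof -
  have nt: "(n, t) \<in> {..<p} \<times> {1..p}" using assms by simp
  consider "\<alpha> = 1" "s = p" | "\<alpha> = - 1" "s = 0" using \<alpha>s by auto
  then show ?thesis
  proof cases
    case 1
    have "AP n t \<in> block_labels p p"
      using p0 imageI[OF nt, of "case_prod AP"] by (simp add: block_labels_def)
    from block_elt_Qsub[OF order.refl this] 1 show ?thesis by simp
  next
    case 2
    have "AM n t \<in> block_labels p 0"
      using imageI[OF nt, of "case_prod AM"] by (simp add: block_labels_def)
    from block_elt_Qsub[OF _ this] 2 show ?thesis by simp
  qed
qed

lemma Qsub_span_top:
  assumes "cemb x \<in> Qsub s"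
  shows "\<exists>c. cemb x = (\<Sum>i\<in>{..<p} \<times> {1..p}. smul (c i) (case i of (n, t) \<Rightarrow> Ag \<alpha> p t n))"
proof -
  obtain c where c: "cemb x = (\<Sum>i\<in>block_labels p s. smul (c i) (block_elt s i))"
    using Qsub_span[OF sign(3) assms] by auto
  define h where "h = (if s = 0 then case_prod AM else case_prod AP)"
  have bl: "block_labels p s = h ` ({..<p} \<times> {1..p})"
    using \<alpha>s p0 by (auto simp: block_labels_def h_def)
  have inj: "inj_on h ({..<p} \<times> {1..p})"
    by (auto simp: inj_on_def h_def)
  have "block_elt s (h i) = (case i of (n, t) \<Rightarrow> Ag \<alpha> p t n)" for i
    using \<alpha>s p0 by (cases i) (auto simp: h_def)
  then have "cemb x = (\<Sum>i\<in>{..<p} \<times> {1..p}. smul (c (h i)) (case i of (n, t) \<Rightarrow> Ag \<alpha> p t n))"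
    unfolding c bl sum.reindex[OF inj] by simp
  then show ?thesis by (rule exI[of _ "\<lambda>i. c (h i)"])
qed

lemma top_basis: "family_basis (Q p s) ({..p - 1} \<times> {1..p}) (\<lambda>(n, t). A_top p \<alpha> n t)"
proof -
  have *: "{..p - 1} = {..<p}" using p0 by auto
  show ?thesis
    unfolding *
  proof (rule family_basisI[OF Qsub_subspace[of s] Q_simps(1-4), where e = "\<lambda>(n, t). Ag \<alpha> p t n"])
    show "\<exists>x. (case i of (n, t) \<Rightarrow> A_top p \<alpha> n t) = cls p x \<and> cemb x = (case i of (n, t) \<Rightarrow> Ag \<alpha> p t n)"
      if "i \<in> {..<p} \<times> {1..p}" for i
      using that A_top_rep by (cases i) auto
    show "(case i of (n, t) \<Rightarrow> Ag \<alpha> p t n) \<in> Qsub s" if "i \<in> {..<p} \<times> {1..p}" for i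
      using that Ag_Qsub by (cases i) auto
    show "\<forall>i\<in>{..<p} \<times> {1..p}. c i = 0"
      if sum: "(\<Sum>i\<in>{..<p} \<times> {1..p}. smul (c i) (case i of (n, t) \<Rightarrow> Ag \<alpha> p t n)) = 0" for c
    proof -
      have "(\<Sum>(n, t)\<in>{..<p} \<times> {1..p}. smul (c (n, t)) (Ag \<alpha> p t n)) = 0"
        using sum by (simp add: case_prod_beta')
      from independent_top[OF sign(1) this] show ?thesis by auto
    qed
  qed (use Qsub_span_top in auto)
qed

text \<open>Matrix units: \<open>A\<^sub>i(p,j+1)\<close> corresponds to the \<open>(i,j)\<close>-th one.\<close>

definition mat_emb :: "complex mat \<Rightarrow> total" where
  "mat_emb M = (\<Sum>i<p. \<Sum>j<p. smul (M $$ (i, j)) (Ag \<alpha> p (j + 1) i))"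

lemma mat_emb_mult:
  assumes "A \<in> carrier_mat p p" "B \<in> carrier_mat p p"
  shows "mat_emb (A * B) = mat_emb A * mat_emb B"
proof -
  have u: "Ag \<alpha> p (k + 1) i * Ag \<alpha> p (j + 1) l = (if l = k then Ag \<alpha> p (j + 1) i else 0)"
    if "k < p" "j < p" "l < p" for i j k l
    using that by (subst Ag_top_mult[OF sign(2)]) auto
  have "mat_emb A * mat_emb B = (\<Sum>i<p. \<Sum>k<p. \<Sum>l<p. \<Sum>j<p.
      smul (A $$ (i, k) * B $$ (l, j)) (Ag \<alpha> p (k + 1) i * Ag \<alpha> p (j + 1) l))"
    unfolding mat_emb_def sum_distrib_right unfolding sum_distrib_left
    by (intro sum.cong refl) (simp add: mult.commute)
  also have "\<dots> = (\<Sum>i<p. \<Sum>k<p. \<Sum>l<p. \<Sum>j<p.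
      if l = k then smul (A $$ (i, k) * B $$ (k, j)) (Ag \<alpha> p (j + 1) i) else 0)"
    by (intro sum.cong refl) (simp add: u[simplified])
  also have "\<dots> = (\<Sum>i<p. \<Sum>k<p. \<Sum>j<p. smul (A $$ (i, k) * B $$ (k, j)) (Ag \<alpha> p (j + 1) i))"
  proof (rule sum.cong[OF refl], rule sum.cong[OF refl])
    fix i k assume "k \<in> {..<p}"
    then show "(\<Sum>l<p. \<Sum>j<p. if l = k then smul (A $$ (i, k) * B $$ (k, j)) (Ag \<alpha> p (j + 1) i) else 0)
      = (\<Sum>j<p. smul (A $$ (i, k) * B $$ (k, j)) (Ag \<alpha> p (j + 1) i))"
      by (subst sum.swap) (simp add: sum.delta)
  qed
  also have "\<dots> = (\<Sum>i<p. \<Sum>j<p. smul (\<Sum>k<p. A $$ (i, k) * B $$ (k, j)) (Ag \<alpha> p (j + 1) i))"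
    unfolding vs.scale_sum_left by (rule sum.cong[OF refl]) (rule sum.swap)
  also have "\<dots> = mat_emb (A * B)"
    unfolding mat_emb_def using assms
    by (intro sum.cong refl) (simp add: scalar_prod_def atLeast0LessThan)
  finally show ?thesis ..
qed

lemma mat_emb_rep: "\<exists>x. cemb x = mat_emb M"
proof -
  have "\<forall>i j. \<exists>x. j < p \<longrightarrow> cemb x = Ag \<alpha> p (j + 1) i"
    using A_top_rep by (metis Suc_eq_plus1 Suc_leI atLeastAtMost_iff le_add2)
  then obtain r where "\<And>i j. j < p \<Longrightarrow> cemb (r i j) = Ag \<alpha> p (j + 1) i"
    by metis
  then have "cemb (\<Sum>i<p. \<Sum>j<p. scal (M $$ (i, j)) * r i j) = mat_emb M"
    by (simp add: mat_emb_def emb_sum emb_scal_mult)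
  then show ?thesis by blast
qed

text \<open>The choice is harmless: elements with the same image under \<open>cemb\<close> have the
  same class.\<close>

definition mat_cls :: "complex mat \<Rightarrow> free_alg set" where
  "mat_cls M = cls p (SOME x. cemb x = mat_emb M)"

lemma mat_cls: "cemb x = mat_emb M \<Longrightarrow> mat_cls M = cls p x"
  unfolding mat_cls_def cls_eq_emb using someI_ex[OF mat_emb_rep[of M]] by simp

lemma mat_emb_Qsub: "mat_emb M \<in> Qsub s"
  unfolding mat_emb_def
  by (intro vs.subspace_sum[OF Qsub_subspace] vs.subspace_scale[OF Qsub_subspace] Ag_Qsub) auto

lemma mat_cls_inj: "inj_on mat_cls (carrier_mat p p)"
proof (rule inj_onI)
  fix A B assume AB: "A \<in> carrier_mat p p" "B \<in> carrier_mat p p" "mat_cls A = mat_cls B"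
  then have "mat_emb A = mat_emb B"
    using mat_emb_rep[of A] mat_emb_rep[of B] mat_cls cls_eq_emb by metis
  then have "(\<Sum>i<p. \<Sum>j<p. smul (A $$ (i, j) - B $$ (i, j)) (Ag \<alpha> p (j + 1) i)) = 0"
    by (simp add: mat_emb_def vs.scale_left_diff_distrib sum_subtractf)
  also have "(\<Sum>i<p. \<Sum>j<p. smul (A $$ (i, j) - B $$ (i, j)) (Ag \<alpha> p (j + 1) i))
    = (\<Sum>(n, t)\<in>{..<p} \<times> {1..p}. smul ((\<lambda>(n, t). A $$ (n, t - 1) - B $$ (n, t - 1)) (n, t)) (Ag \<alpha> p t n))"
    unfolding sum.cartesian_product
    by (rule sum.reindex_bij_witness[of _ "\<lambda>(n, t). (n, t - 1)" "\<lambda>(n, j). (n, j + 1)"]) auto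
  finally have sum0: "\<dots> = 0" .
  have "A $$ (i, j) = B $$ (i, j)" if "i < p" "j < p" for i j
    using independent_top[OF sign(1) sum0, of i "j + 1"] that by simp
  then show "A = B" using AB by auto
qed

lemma mat_cls_image: "mat_cls ` carrier_mat p p = carrier (Q p s)"
proof
  show "mat_cls ` carrier_mat p p \<subseteq> carrier (Q p s)"
    using mat_emb_rep mat_cls mat_emb_Qsub by (fastforce simp: Q_simps)
  show "carrier (Q p s) \<subseteq> mat_cls ` carrier_mat p p"
  proof
    fix X assume "X \<in> carrier (Q p s)"
    then obtain x where x: "X = cls p x" "cemb x \<in> Qsub s" by (auto simp: Q_simps)
    obtain c where c: "cemb x = (\<Sum>i\<in>{..<p} \<times> {1..p}. smul (c i) (case i of (n, t) \<Rightarrow> Ag \<alpha> p t n))"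
      using Qsub_span_top[OF x(2)] by auto
    define M where "M = mat p p (\<lambda>(i, j). c (i, j + 1))"
    have "mat_emb M = (\<Sum>i<p. \<Sum>j<p. smul (c (i, j + 1)) (Ag \<alpha> p (j + 1) i))"
      by (simp add: mat_emb_def M_def)
    also have "\<dots> = cemb x"
      unfolding c sum.cartesian_product
      by (rule sum.reindex_bij_witness[of _ "\<lambda>(n, t). (n, t - 1)" "\<lambda>(n, j). (n, j + 1)"]) auto
    finally have "mat_cls M = X"
      using mat_cls[of x M] x(1) by simp
    then show "X \<in> mat_cls ` carrier_mat p p"
      by (auto simp: M_def)
  qed
qed

lemma mat_cls_hom:
  assumes "A \<in> carrier_mat p p" "B \<in> carrier_mat p p"
  shows "mat_cls (A * B) = mat_cls A \<otimes>\<^bsub>Q p s\<^esub> mat_cls B"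
    and "mat_cls (A + B) = mat_cls A \<oplus>\<^bsub>Q p s\<^esub> mat_cls B"
    and "mat_cls (c \<cdot>\<^sub>m A) = c \<odot>\<^bsub>Q p s\<^esub> mat_cls A"
proof -
  obtain a b where a: "cemb a = mat_emb A" and b: "cemb b = mat_emb B"
    using mat_emb_rep by metis
  have "cemb (a * b) = mat_emb (A * B)"
    by (simp add: comp_emb_mult a b mat_emb_mult assms)
  then show "mat_cls (A * B) = mat_cls A \<otimes>\<^bsub>Q p s\<^esub> mat_cls B"
    by (simp add: mat_cls[OF a] mat_cls[OF b] mat_cls Q_simps Uq_simps)
  have "mat_emb (A + B) = mat_emb A + mat_emb B"
    unfolding mat_emb_def sum.distrib[symmetric] using assms
    by (intro sum.cong refl) (simp add: vs.scale_left_distrib)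
  then have "cemb (a + b) = mat_emb (A + B)"
    by (simp add: comp_emb_add a b)
  then show "mat_cls (A + B) = mat_cls A \<oplus>\<^bsub>Q p s\<^esub> mat_cls B"
    by (simp add: mat_cls[OF a] mat_cls[OF b] mat_cls Q_simps Uq_simps)
  have "mat_emb (c \<cdot>\<^sub>m A) = smul c (mat_emb A)"
    unfolding mat_emb_def vs.scale_sum_right using assms
    by (intro sum.cong refl) simp
  then have "cemb (scal c * a) = mat_emb (c \<cdot>\<^sub>m A)"
    by (simp add: emb_scal_mult a)
  then show "mat_cls (c \<cdot>\<^sub>m A) = c \<odot>\<^bsub>Q p s\<^esub> mat_cls A"
    by (simp add: mat_cls[OF a] mat_cls Q_simps Uq_simps)
qed

text \<open>The unit of the block is defined by description. The image of the identity matrix is a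
  two-sided unit because \<open>mat_cls\<close> is multiplicative and onto, and two such units
  coincide.\<close>

lemma mat_cls_one: "mat_cls (1\<^sub>m p) = \<one>\<^bsub>Q p s\<^esub>"
proof -
  let ?P = "\<lambda>e. e \<in> Q_space p s \<and> (\<forall>x\<in>Q_space p s. e \<otimes>\<^bsub>Uq p\<^esub> x = x \<and> x \<otimes>\<^bsub>Uq p\<^esub> e = x)"
  have im: "Q_space p s = mat_cls ` carrier_mat p p"
    unfolding mat_cls_image by (simp add: Q_def)
  have 1: "?P (mat_cls (1\<^sub>m p))"
    unfolding im
    using mat_cls_hom(1)[of "1\<^sub>m p"] mat_cls_hom(1)[of _ "1\<^sub>m p"] by (auto simp: Q_simps)
  have "(THE e. ?P e) = mat_cls (1\<^sub>m p)"
    using 1 by (intro the_equality) metis+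
  then show ?thesis by (simp add: Q_def)
qed

lemma algebra_isomorphic_mat: "algebra_isomorphic (Q p s) (module_mat TYPE(complex) p p)"
proof -
  let ?C = "carrier_mat p p" and ?\<phi> = "inv_into (carrier_mat p p) mat_cls"
  have inv: "?\<phi> (mat_cls A) = A" if "A \<in> ?C" for A
    using that by (rule inv_into_f_f[OF mat_cls_inj])
  have carr: "carrier (Q p s) = mat_cls ` ?C" by (simp add: mat_cls_image)
  have bij: "bij_betw ?\<phi> (carrier (Q p s)) ?C"
    using mat_cls_inj mat_cls_image by (intro bij_betw_inv_into) (simp add: bij_betw_def)
  have "?\<phi> \<in> ring_iso (Q p s) (module_mat TYPE(complex) p p)"
  proof (rule ring_iso_memI)
    show "?\<phi> (X \<otimes>\<^bsub>Q p s\<^esub> Y) = ?\<phi> X \<otimes>\<^bsub>module_mat TYPE(complex) p p\<^esub> ?\<phi> Y"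
      if XY: "X \<in> carrier (Q p s)" "Y \<in> carrier (Q p s)" for X Y
      using XY unfolding carr by (auto simp: module_mat_simps inv simp flip: mat_cls_hom)
    show "?\<phi> (X \<oplus>\<^bsub>Q p s\<^esub> Y) = ?\<phi> X \<oplus>\<^bsub>module_mat TYPE(complex) p p\<^esub> ?\<phi> Y"
      if XY: "X \<in> carrier (Q p s)" "Y \<in> carrier (Q p s)" for X Y
      using XY unfolding carr by (auto simp: module_mat_simps inv simp flip: mat_cls_hom)
    show "?\<phi> \<one>\<^bsub>Q p s\<^esub> = \<one>\<^bsub>module_mat TYPE(complex) p p\<^esub>"
      by (simp add: module_mat_simps inv flip: mat_cls_one)
  qed (use bij in \<open>auto simp: module_mat_simps bij_betw_def\<close>)
  moreover have "?\<phi> (c \<odot>\<^bsub>Q p s\<^esub> X) = c \<odot>\<^bsub>module_mat TYPE(complex) p p\<^esub> ?\<phi> X"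
    if "X \<in> carrier (Q p s)" for c X
    using that unfolding carr by (auto simp: module_mat_simps inv simp flip: mat_cls_hom(3))
  ultimately show ?thesis
    unfolding algebra_isomorphic_def by blast
qed

end

end

theorem mainTheorem5:
  fixes p :: nat
  assumes "p \<ge> 2"
  shows
    "(\<forall>(\<alpha>, s) \<in> {(1, p), (-1, 0)}.
        family_basis (Q p s) ({..p - 1} \<times> {1..p}) (\<lambda>(n, t). A_top p \<alpha> n t) \<and>
        (\<forall>m\<le>p - 1. \<forall>n\<le>p - 1. \<forall>t1\<in>{1..p}. \<forall>t2\<in>{1..p}.
           A_top p \<alpha> m t1 \<otimes>\<^bsub>Uq p\<^esub> A_top p \<alpha> n t2
             = (if n = t1 - 1 then A_top p \<alpha> m t2 else \<zero>\<^bsub>Uq p\<^esub>))) \<and>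
     algebra_isomorphic (Q p 0) (module_mat TYPE(complex) p p) \<and>
     algebra_isomorphic (Q p p) (module_mat TYPE(complex) p p) \<and>
     (\<forall>s\<in>{1..p - 1}.
        family_basis (Q p s) (labels p s) (elt p s) \<and>
        (\<forall>i\<in>labels p s. \<forall>j\<in>labels p s.
           elt p s i \<otimes>\<^bsub>Uq p\<^esub> elt p s j
             = (case label_mult i j of Some k \<Rightarrow> elt p s k | None \<Rightarrow> \<zero>\<^bsub>Uq p\<^esub>)))"
proof -
  interpret restricted_qg p by unfold_locales (rule assms)
  have top: "family_basis (Q p s) ({..p - 1} \<times> {1..p}) (\<lambda>(n, t). A_top p \<alpha> n t) \<and>
      (\<forall>m\<le>p - 1. \<forall>n\<le>p - 1. \<forall>t1\<in>{1..p}. \<forall>t2\<in>{1..p}.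
         A_top p \<alpha> m t1 \<otimes>\<^bsub>Uq p\<^esub> A_top p \<alpha> n t2
           = (if n = t1 - 1 then A_top p \<alpha> m t2 else \<zero>\<^bsub>Uq p\<^esub>))"
    if "(\<alpha>, s) \<in> {(1, p), (-1, 0)}" for \<alpha> s
  proof (intro conjI allI impI ballI)
    show "family_basis (Q p s) ({..p - 1} \<times> {1..p}) (\<lambda>(n, t). A_top p \<alpha> n t)"
      by (rule top_basis[OF that])
    fix m n t1 t2 assume "n \<le> p - 1" "t1 \<in> {1..p}" "t2 \<in> {1..p}"
    then show "A_top p \<alpha> m t1 \<otimes>\<^bsub>Uq p\<^esub> A_top p \<alpha> n t2
           = (if n = t1 - 1 then A_top p \<alpha> m t2 else \<zero>\<^bsub>Uq p\<^esub>)"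
      using assms by (intro A_top_mult[OF that]) auto
  qed
  have mid: "family_basis (Q p s) (labels p s) (elt p s) \<and>
      (\<forall>i\<in>labels p s. \<forall>j\<in>labels p s. elt p s i \<otimes>\<^bsub>Uq p\<^esub> elt p s j
        = (case label_mult i j of Some k \<Rightarrow> elt p s k | None \<Rightarrow> \<zero>\<^bsub>Uq p\<^esub>))"
    if "s \<in> {1..p - 1}" for s
  proof -
    have s: "1 \<le> s" "s < p" using that by auto
    show ?thesis
      using block_basis[OF s] elt_mult[OF s] by blast
  qed
  show ?thesis
  proof (intro conjI)
    show "\<forall>(\<alpha>, s) \<in> {(1, p), (-1, 0)}.
        family_basis (Q p s) ({..p - 1} \<times> {1..p}) (\<lambda>(n, t). A_top p \<alpha> n t) \<and>
        (\<forall>m\<le>p - 1. \<forall>n\<le>p - 1. \<forall>t1\<in>{1..p}. \<forall>t2\<in>{1..p}.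
           A_top p \<alpha> m t1 \<otimes>\<^bsub>Uq p\<^esub> A_top p \<alpha> n t2
             = (if n = t1 - 1 then A_top p \<alpha> m t2 else \<zero>\<^bsub>Uq p\<^esub>))"
      by (rule ballI, erule rev_mp, rule prod.induct, unfold prod.case, rule impI, rule top)
    show "algebra_isomorphic (Q p 0) (module_mat TYPE(complex) p p)"
      by (rule algebra_isomorphic_mat[of "- 1"]) simp
    show "algebra_isomorphic (Q p p) (module_mat TYPE(complex) p p)"
      by (rule algebra_isomorphic_mat[of 1]) simp
  qed (rule ballI, rule mid)
qed

end
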